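(* Let $m<n$ and $L\ge 1$ be integers, and let $A\in\mathbb{R}^{m\times n}$ have i.i.d. $\mathcal{N}(0,1)$ entries. Let $0<x_{\min}\le x_{\max}$ and let $\boldsymbol{x}_o\in\mathbb{R}^n$ satisfy $x_{\min}\le x_{o,i}\le x_{\max}$ for all $i$. For $\ell=1,\dots,L$ observe $\boldsymbol{y}_\ell = A X_o \boldsymbol{w}_\ell$, where $X_o=\mathrm{diag}(\boldsymbol{x}_o)$ and $\boldsymbol{w}_1,\dots,\boldsymbol{w}_L$ are i.i.d. $\mathcal{N}(\mathbf 0,\sigma_w^2 I_n)$, independent of $A$. Fix a vector $\boldsymbol{u}$ and a map $\boldsymbol\theta\mapsto g_{\boldsymbol\theta}(\boldsymbol u)\in\mathbb{R}^n$ which, as a function of $\boldsymbol\theta\in B_k\big(\mathbf 0, x_{\max}\sqrt{n/k}\big)=\{\boldsymbol\theta\in\mathbb{R}^k:\|\boldsymbol\theta\|_2\le x_{\max}\sqrt{n/k}\}$, is Lipschitz with Lipschitz constant $1$. Let $\mathcal{C}\subseteq\{g_{\boldsymbol\theta}(\boldsymbol u):\boldsymbol\theta\in B_k(\mathbf 0,x_{\max}\sqrt{n/k})\}$ be a set with $\boldsymbol{x}_o\in\mathcal{C}$ and such that every $\boldsymbol x\in\mathcal C$ satisfies $x_{\min}\le x_i\le x_{\max}$ for all $i$. Let $$\hat{\boldsymbol x}\in\arg\min_{\boldsymbol x\in\mathcal C} f(\boldsymbol x),\qquad f(\boldsymbol x)=\log\det\big(\sigma_w^2 A X^2 A^{\top}\big)+\frac1L\sum_{\ell=1}^L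 \boldsymbol y_\ell^{\top}\big(\sigma_w^2 A X^2A^{\top}\big)^{-1}\boldsymbol y_\ell,\quad X=\mathrm{diag}(\boldsymbol x).$$ Then there exist constants $C_1,C_2,C_3>0$ such that $$\frac1n\|\hat{\boldsymbol x}-\boldsymbol x_o\|_2^2\le C_1\Big(\frac{n}{m^2}\cdot\frac{k\log n}{L}+\frac{\sqrt{k\log n}}{m}\Big)$$ with probability at least $1-C_2\big(e^{-m/2}+e^{-Ln/8}+e^{-C_3k\log n}+e^{k\log n-n/2}\big)$.
   Context: This is the maximum-likelihood estimator for the real-valued multilook speckle model with no additive noise ($\sigma_z=0$): $f$ is (up to constants) the negative log-likelihood of $\boldsymbol y_1,\dots,\boldsymbol y_L$ given $\boldsymbol x$. The probability is over both $A$ and the speckle vectors $\boldsymbol w_\ell$. *)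

theory Defs
  imports "HOL-Probability.Probability" "Jordan_Normal_Form.Gauss_Jordan_Elimination" "Jordan_Normal_Form.Determinant"
begin

definition l2norm :: "real Matrix.vec \<Rightarrow> real" where
  "l2norm v = sqrt (scalar_prod v v)"

text \<open>Matrix inverse (an arbitrary value, the zero matrix, if singular).\<close>
definition minv :: "real mat \<Rightarrow> real mat" where
  "minv S = (case mat_inverse S of Some B \<Rightarrow> B | None \<Rightarrow> 0\<^sub>m (dim_row S) (dim_col S))"

definition diagm :: "real Matrix.vec \<Rightarrow> real mat" where
  "diagm x = Matrix.mat (dim_vec x) (dim_vec x) (\<lambda>(i,j). if i = j then x $ i else 0)"

definition covm :: "real \<Rightarrow> real mat \<Rightarrow> real Matrix.vec \<Rightarrow> real mat" where
  "covm \<sigma> A x = (\<sigma>^2) \<cdot>\<^sub>m (A * (diagm x * diagm x) * transpose_mat A)"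

definition nll :: "real \<Rightarrow> real mat \<Rightarrow> nat \<Rightarrow> (nat \<Rightarrow> real Matrix.vec) \<Rightarrow> real Matrix.vec \<Rightarrow> real" where
  "nll \<sigma> A L y x = ln (Determinant.det (covm \<sigma> A x))
     + (1 / real L) * (\<Sum>l<L. scalar_prod (y l) (minv (covm \<sigma> A x) *\<^sub>v y l))"

text \<open>Sample space: A entries indexed by {..<m}x{..<n}, speckle W entries by {..<L}x{..<n}.\<close>
definition speckle_space :: "nat \<Rightarrow> nat \<Rightarrow> nat \<Rightarrow> real \<Rightarrow>
     ((nat \<times> nat \<Rightarrow> real) \<times> (nat \<times> nat \<Rightarrow> real)) measure" where
  "speckle_space m n L \<sigma> =
     (\<Pi>\<^sub>M ij\<in>{..<m}\<times>{..<n}. density lborel (normal_density 0 1)) \<Otimes>\<^sub>M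
     (\<Pi>\<^sub>M lj\<in>{..<L}\<times>{..<n}. density lborel (normal_density 0 \<sigma>))"

definition sensA :: "nat \<Rightarrow> nat \<Rightarrow> (nat \<times> nat \<Rightarrow> real) \<Rightarrow> real mat" where
  "sensA m n a = Matrix.mat m n (\<lambda>(i,j). a (i,j))"

definition speckle :: "nat \<Rightarrow> (nat \<times> nat \<Rightarrow> real) \<Rightarrow> nat \<Rightarrow> real Matrix.vec" where
  "speckle n w l = Matrix.vec n (\<lambda>j. w (l,j))"

end

theory Submission
  imports Defs
begin

text \<open>
The log-likelihood ratio of x against the truth xo is \<open>ln det\<close> plus a quadratic form in the speckle
with matrix \<open>N = \<sigma>^2 Xo A^T (\<Sigma>(x)^(-1) - \<Sigma>(xo)^(-1)) A Xo\<close>. Conditionally on A, a Chernoff bound with a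
small constant exponent, in which the log-determinant wins a multiple of \<open>|N|_F^2\<close>, shows that
every net point x which is almost as likely as xo has \<open>|N|_F^2 \<lesssim> k log n / L\<close>. No lower
bound on the singular values of A is needed, because \<open>\<Sigma>(x)\<close> is compared with \<open>\<Sigma>(xo)\<close> only relatively.
With \<open>D = X^2 - Xo^2\<close> one has \<open>A D A^T = - (A X^2 Xo^(-1)) N (Xo A^T)\<close>, so \<open>|A D A^T|_F \<lesssim> n |N|_F\<close> as the
operator norm of A is of order \<open>sqrt n\<close>. Conversely, splitting the rows of A into two independent
halves gives \<open>|A D A^T|_F^2 \<gtrsim> m^2 |D|_F^2 - m n sqrt (k log n)\<close> uniformly on the net.
\<close>

section \<open>Gaussian chaos\<close>

text \<open>The chaos bound asks only for an upper bound on the matrix of the quadratic form. In the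
  lower-tail estimates that matrix is negative semidefinite, so every exponent s \<ge> 0 is
  admissible and can be tuned to the size of the net. In the likelihood it is a small multiple of
  -N, and N \<ge> -I holds for every A of full rank, however badly conditioned; this matters because
  m may be as large as n - 1. The energy |A D A^T|_F^2 is quartic in A and thus not a Gaussian chaos
  of order two. Keeping only the products of a row of one half with a row of the other, and freezing
  one half, leaves a quadratic form in the other half, with a compensator that is itself random and
  is bounded below by a second Chernoff step. The threshold is T = A k log n, where (A - 1) k log n
  bounds the logarithm of the net size, so that each union bound over the net leaves exp (- k log
  n). The net has radius 1/n^2: replacing a minimiser by a net point then costs O(1/n) in the
  likelihood, which after the passage to the signal is at most of order 1/m and is absorbed by sqrt
  (k log n) / m.\<close>

abbreviation gaussian :: "real \<Rightarrow> real measure" where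
  "gaussian s \<equiv> density lborel (normal_density 0 s)"

text \<open>Completing the square turns the integrand into a constant times the density of a normal
  law with mean \<open>\<mu>\<close> and standard deviation \<open>r\<close>; the assumption on
  \<open>a\<close> keeps the tilted variance finite.\<close>

lemma gaussian_exp_quad:
  fixes a b s :: real
  assumes s: "s > 0" and a: "2 * a * s\<^sup>2 < 1"
  shows "(\<integral>\<^sup>+t. ennreal (exp (a * t\<^sup>2 + b * t)) \<partial>gaussian s)
    = ennreal (exp (b\<^sup>2 * s\<^sup>2 / (2 * (1 - 2 * a * s\<^sup>2))) / sqrt (1 - 2 * a * s\<^sup>2))"
proof -
  define r where "r = s / sqrt (1 - 2 * a * s\<^sup>2)"
  define \<mu> where "\<mu> = b * r\<^sup>2"
  have q: "1 - 2 * a * s\<^sup>2 > 0" using a by simp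
  have r0: "r > 0" unfolding r_def using s q by simp
  have r2: "r\<^sup>2 = s\<^sup>2 / (1 - 2 * a * s\<^sup>2)" unfolding r_def using q by (simp add: power_divide)
  have rs: "r / s = 1 / sqrt (1 - 2 * a * s\<^sup>2)" unfolding r_def using s by simp
  have inv: "1 / r\<^sup>2 = 1 / s\<^sup>2 - 2 * a" unfolding r2 using s q by (simp add: field_simps)
  have sq: "a * t\<^sup>2 + b * t - t\<^sup>2 / (2 * s\<^sup>2) = b\<^sup>2 * r\<^sup>2 / 2 - (t - \<mu>)\<^sup>2 / (2 * r\<^sup>2)" for t
  proof -
    have "(t - \<mu>)\<^sup>2 / (2 * r\<^sup>2) = t\<^sup>2 / 2 * (1 / r\<^sup>2) - b * t + b\<^sup>2 * r\<^sup>2 / 2"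
      unfolding \<mu>_def using r0 by (simp add: field_simps power2_eq_square)
    also have "\<dots> = t\<^sup>2 / (2 * s\<^sup>2) - a * t\<^sup>2 - b * t + b\<^sup>2 * r\<^sup>2 / 2"
      unfolding inv by (simp add: field_simps)
    finally show ?thesis by simp
  qed
  have eq: "normal_density 0 s t * exp (a * t\<^sup>2 + b * t)
      = exp (b\<^sup>2 * r\<^sup>2 / 2) * (r / s) * normal_density \<mu> r t" for t
  proof -
    have "normal_density 0 s t * exp (a * t\<^sup>2 + b * t)
      = 1 / sqrt (2 * pi * s\<^sup>2) * (exp (- t\<^sup>2 / (2 * s\<^sup>2)) * exp (a * t\<^sup>2 + b * t))"
      by (simp add: normal_density_def)
    also have "exp (- t\<^sup>2 / (2 * s\<^sup>2)) * exp (a * t\<^sup>2 + b * t) = exp (b\<^sup>2 * r\<^sup>2 / 2) * exp (- (t - \<mu>)\<^sup>2 / (2 * r\<^sup>2))"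
      unfolding exp_add[symmetric] using sq[of t] by (simp add: algebra_simps)
    also have "1 / sqrt (2 * pi * s\<^sup>2) = (r / s) * (1 / sqrt (2 * pi * r\<^sup>2))"
      using r0 s by (simp add: real_sqrt_mult)
    finally show ?thesis by (simp add: normal_density_def)
  qed
  have one: "(\<integral>\<^sup>+t. ennreal (normal_density \<mu> r t) \<partial>lborel) = 1"
    using prob_space.emeasure_space_1[OF prob_space_normal_density[OF r0, of \<mu>]]
    by (simp add: emeasure_density)
  have "(\<integral>\<^sup>+t. ennreal (exp (a * t\<^sup>2 + b * t)) \<partial>gaussian s)
     = (\<integral>\<^sup>+t. ennreal (normal_density 0 s t) * ennreal (exp (a * t\<^sup>2 + b * t)) \<partial>lborel)"
    by (subst nn_integral_density) auto
  also have "\<dots> = (\<integral>\<^sup>+t. ennreal (exp (b\<^sup>2 * r\<^sup>2 / 2) * (r / s)) * ennreal (normal_density \<mu> r t) \<partial>lborel)"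
    by (intro nn_integral_cong) (simp add: ennreal_mult[symmetric] eq r0 s less_imp_le)
  also have "\<dots> = ennreal (exp (b\<^sup>2 * r\<^sup>2 / 2) * (r / s))"
    by (subst nn_integral_cmult) (auto simp: one)
  also have "\<dots> = ennreal (exp (b\<^sup>2 * s\<^sup>2 / (2 * (1 - 2 * a * s\<^sup>2))) / sqrt (1 - 2 * a * s\<^sup>2))"
    unfolding rs r2 by (simp add: mult.commute)
  finally show ?thesis .
qed

text \<open>The derivative of the gap is y (1 - 2 y) / (1 - y), which on this range changes sign
  only at 0. The estimate pays for the normalising factor 1 / sqrt (1 - 2 a s^2) of each integrated
  coordinate.\<close>

lemma ln_one_minus_lower:
  fixes x :: real assumes "x \<le> 1/4" shows "- ln (1 - x) \<le> x + x\<^sup>2"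
proof -
  define f where "f = (\<lambda>x::real. x + x\<^sup>2 + ln (1 - x))"
  have der: "(f has_real_derivative y * (1 - 2 * y) / (1 - y)) (at y)" if "y \<le> 1/4" for y
  proof -
    have "(f has_real_derivative 1 + 2 * y + (- 1) / (1 - y)) (at y)"
      unfolding f_def using that by (auto intro!: derivative_eq_intros)
    moreover have "1 + 2 * y + (- 1) / (1 - y) = y * (1 - 2 * y) / (1 - y)"
      using that by (simp add: field_simps power2_eq_square)
    ultimately show ?thesis by simp
  qed
  have "f 0 \<le> f x"
  proof (cases "x \<ge> 0")
    case True
    show ?thesis
    proof (rule DERIV_nonneg_imp_nondecreasing[OF True])
      fix y :: real assume y: "0 \<le> y" "y \<le> x"
      then have "y * (1 - 2 * y) / (1 - y) \<ge> 0" using assms by simp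
      then show "\<exists>z. (f has_real_derivative z) (at y) \<and> 0 \<le> z" using der[of y] y assms by auto
    qed
  next
    case False
    show ?thesis
    proof (rule DERIV_nonpos_imp_nonincreasing[of x 0 f])
      show "x \<le> 0" using False by simp
      fix y :: real assume y: "x \<le> y" "y \<le> 0"
      then have "y * (1 - 2 * y) / (1 - y) \<le> 0"
        by (intro divide_nonpos_pos mult_nonpos_nonneg) auto
      then show "\<exists>z. (f has_real_derivative z) (at y) \<and> z \<le> 0" using der[of y] y by auto
    qed
  qed
  then show ?thesis by (simp add: f_def)
qed

text \<open>Arbitrary index sets serve both single vectors and families of rows indexed by pairs,
  and let an induction remove one index at a time.\<close>

definition qform :: "'i set \<Rightarrow> ('i \<Rightarrow> 'i \<Rightarrow> real) \<Rightarrow> ('i \<Rightarrow> real) \<Rightarrow> real" where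
  "qform I Q u = (\<Sum>i\<in>I. \<Sum>j\<in>I. Q i j * u i * u j)"

lemma qform_cong: "(\<And>i. i \<in> I \<Longrightarrow> u i = v i) \<Longrightarrow> qform I Q u = qform I Q v"
  by (simp add: qform_def)

lemma qform_insert:
  assumes "finite I" "i \<notin> I" and sym: "\<And>j. j \<in> I \<Longrightarrow> Q j i = Q i j"
  shows "qform (insert i I) Q u = Q i i * (u i)\<^sup>2 + 2 * u i * (\<Sum>j\<in>I. Q i j * u j) + qform I Q u"
proof -
  have "qform (insert i I) Q u = Q i i * (u i)\<^sup>2 + (\<Sum>j\<in>I. Q i j * u i * u j)
      + (\<Sum>j\<in>I. Q j i * u j * u i + (\<Sum>k\<in>I. Q j k * u j * u k))"
    using assms(1,2) by (simp add: qform_def power2_eq_square)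
  also have "(\<Sum>j\<in>I. Q j i * u j * u i + (\<Sum>k\<in>I. Q j k * u j * u k))
     = u i * (\<Sum>j\<in>I. Q i j * u j) + qform I Q u"
    by (simp add: sum.distrib qform_def sum_distrib_left sym mult.commute mult.left_commute)
  also have "(\<Sum>j\<in>I. Q i j * u i * u j) = u i * (\<Sum>j\<in>I. Q i j * u j)"
    by (simp add: sum_distrib_left mult.commute mult.left_commute)
  finally show ?thesis by simp
qed

lemma qform_rank1:
  "qform I (\<lambda>j k. Q j k + c * b j * b k) u = qform I Q u + c * (\<Sum>j\<in>I. b j * u j)\<^sup>2"
proof -
  have "qform I (\<lambda>j k. Q j k + c * b j * b k) u
    = (\<Sum>j\<in>I. \<Sum>k\<in>I. Q j k * u j * u k + c * ((b j * u j) * (b k * u k)))"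
    unfolding qform_def by (intro sum.cong refl) (simp add: algebra_simps)
  also have "\<dots> = qform I Q u + c * (\<Sum>j\<in>I. \<Sum>k\<in>I. (b j * u j) * (b k * u k))"
    by (simp add: sum.distrib qform_def sum_distrib_left)
  finally show ?thesis by (simp add: power2_eq_square sum_product)
qed

lemma frob_rank1:
  fixes Q :: "'i \<Rightarrow> 'i \<Rightarrow> real"
  shows "(\<Sum>j\<in>I. \<Sum>k\<in>I. (Q j k + c * b j * b k)\<^sup>2)
    = (\<Sum>j\<in>I. \<Sum>k\<in>I. (Q j k)\<^sup>2) + 2 * c * qform I Q b + c\<^sup>2 * (\<Sum>j\<in>I. (b j)\<^sup>2)\<^sup>2"
proof -
  have "(\<Sum>j\<in>I. \<Sum>k\<in>I. (Q j k + c * b j * b k)\<^sup>2)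
    = (\<Sum>j\<in>I. \<Sum>k\<in>I. (Q j k)\<^sup>2 + 2 * c * (Q j k * b j * b k) + c\<^sup>2 * ((b j)\<^sup>2 * (b k)\<^sup>2))"
    by (intro sum.cong refl) (simp add: algebra_simps power2_eq_square)
  also have "\<dots> = (\<Sum>j\<in>I. \<Sum>k\<in>I. (Q j k)\<^sup>2) + 2 * c * qform I Q b
      + c\<^sup>2 * (\<Sum>j\<in>I. \<Sum>k\<in>I. (b j)\<^sup>2 * (b k)\<^sup>2)"
    by (simp add: sum.distrib qform_def sum_distrib_left)
  finally show ?thesis by (simp add: power2_eq_square[of "sum _ _"] sum_product)
qed

lemma frob_insert:
  fixes Q :: "'i \<Rightarrow> 'i \<Rightarrow> real"
  assumes "finite I" "i \<notin> I" and sym: "\<And>j. j \<in> I \<Longrightarrow> Q j i = Q i j"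
  shows "(\<Sum>j\<in>insert i I. \<Sum>k\<in>insert i I. (Q j k)\<^sup>2)
    = (Q i i)\<^sup>2 + 2 * (\<Sum>j\<in>I. (Q i j)\<^sup>2) + (\<Sum>j\<in>I. \<Sum>k\<in>I. (Q j k)\<^sup>2)"
  using assms by (simp add: sum.distrib)

lemma measurable_qform [measurable]:
  "qform I Q \<in> borel_measurable (PiM I (\<lambda>_. gaussian s))"
  unfolding qform_def by measurable

text \<open>Integrating out one coordinate replaces Q by a Schur complement, which preserves the bound
  \<open>s^2 Q \<le> 1/8\<close>; this is why no spectral decomposition of Q is needed.\<close>
lemma chaos_mgf:
  fixes Q :: "'i \<Rightarrow> 'i \<Rightarrow> real"
  assumes fin: "finite I" and s: "s > 0"
    and sym: "\<And>i j. i \<in> I \<Longrightarrow> j \<in> I \<Longrightarrow> Q i j = Q j i"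
    and le: "\<And>u. s\<^sup>2 * qform I Q u \<le> (\<Sum>i\<in>I. (u i)\<^sup>2) / 8"
  shows "(\<integral>\<^sup>+w. ennreal (exp (qform I Q w)) \<partial>PiM I (\<lambda>_. gaussian s))
    \<le> ennreal (exp (s\<^sup>2 * (\<Sum>i\<in>I. Q i i) + 2 * s^4 * (\<Sum>i\<in>I. \<Sum>j\<in>I. (Q i j)\<^sup>2)))"
  using fin sym le
proof (induction I arbitrary: Q rule: finite_induct)
  case empty
  then show ?case by (simp add: qform_def PiM_empty nn_integral_count_space_finite)
next
  case (insert i I)
  have ps: "prob_space (gaussian s)" by (rule prob_space_normal_density[OF s])
  interpret P: prob_space "gaussian s" by fact
  interpret PP: product_sigma_finite "\<lambda>_. gaussian s"
    by standard
  define a where "a = Q i i"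
  \<comment> \<open>Integrating out coordinate i, whose linear coefficient is twice the sum of the
    b_j x_j, leaves exp of \<open>c\<close> times the square of that sum. Hence \<open>Q'\<close> is
    the matrix of the remaining form.\<close>
  define c where "c = 2 * s\<^sup>2 / (1 - 2 * a * s\<^sup>2)"
  define b where "b = Q i"
  define Q' where "Q' = (\<lambda>j k. Q j k + c * b j * b k)"
  have sym: "Q j i = Q i j" if "j \<in> I" for j using insert.prems(1) that by auto
  have qi: "qform (insert i I) Q u = Q i i * (u i)\<^sup>2 + 2 * u i * (\<Sum>j\<in>I. Q i j * u j) + qform I Q u" for u
    by (rule qform_insert[OF insert.hyps(1,2)]) (rule sym)
  have s2: "s\<^sup>2 > 0" using s by simp
  have a8: "s\<^sup>2 * a \<le> 1/8"
  proof -
    have "s\<^sup>2 * qform (insert i I) Q (\<lambda>j. if j = i then 1 else 0) \<le> (\<Sum>j\<in>insert i I. (if j = i then 1 else 0)\<^sup>2) / 8"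
      by (rule insert.prems(2))
    moreover have "qform (insert i I) Q (\<lambda>j. if j = i then 1 else 0) = a"
    proof -
      have "(\<Sum>j\<in>I. Q i j * (if j = i then 1 else 0)) = 0"
        using insert.hyps by (intro sum.neutral ballI) auto
      moreover have "qform I Q (\<lambda>j. if j = i then 1 else 0) = 0"
        unfolding qform_def using insert.hyps by (intro sum.neutral ballI) auto
      ultimately show ?thesis unfolding qi a_def by simp
    qed
    moreover have "(\<Sum>j\<in>insert i I. (if j = i then 1 else 0)\<^sup>2) = (1::real)"
      using insert.hyps by (simp add: sum.delta if_distrib[of "\<lambda>x. x\<^sup>2"] cong: if_cong)
    ultimately show ?thesis by simp
  qed
  have d: "1 - 2 * a * s\<^sup>2 \<ge> 3/4" using a8 by (simp add: mult.commute)
  have c0: "c > 0" unfolding c_def using s2 d by simp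
  have "c \<le> 2 * s\<^sup>2 / (3/4)" unfolding c_def using d by (intro divide_left_mono) auto
  then have cs: "c \<le> 8/3 * s\<^sup>2" by simp
  have key: "s\<^sup>2 * qform I Q' u \<le> (\<Sum>j\<in>I. (u j)\<^sup>2) / 8" for u
  proof -
    define \<beta> where "\<beta> = (\<Sum>j\<in>I. b j * u j)"
    \<comment> \<open>The value \<open>c * \<beta>\<close> maximises a y^2 + 2 \<beta> y - y^2 / (2
      s^2), the exponent of the integrated coordinate. Testing the hypothesis there bounds the form
      of \<open>Q'\<close>, because a s^2 c + s^2 = c/2 exceeds c/8.\<close>
    define v where "v = u(i := c * \<beta>)"
    have uv: "u j = v j" if "j \<in> I" for j using that insert.hyps by (auto simp: v_def)
    have "s\<^sup>2 * qform (insert i I) Q v \<le> (\<Sum>j\<in>insert i I. (v j)\<^sup>2) / 8" by (rule insert.prems(2))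
    moreover have "qform (insert i I) Q v = a * (c * \<beta>)\<^sup>2 + 2 * (c * \<beta>) * \<beta> + qform I Q u"
    proof -
      have "qform I Q v = qform I Q u" using uv by (intro qform_cong) auto
      moreover have "(\<Sum>j\<in>I. Q i j * v j) = \<beta>" unfolding \<beta>_def b_def by (intro sum.cong) (auto simp: uv)
      ultimately show ?thesis by (subst qi) (auto simp: v_def a_def)
    qed
    moreover have "(\<Sum>j\<in>insert i I. (v j)\<^sup>2) = (c * \<beta>)\<^sup>2 + (\<Sum>j\<in>I. (u j)\<^sup>2)"
    proof -
      have "(\<Sum>j\<in>I. (v j)\<^sup>2) = (\<Sum>j\<in>I. (u j)\<^sup>2)" by (intro sum.cong) (auto simp: uv)
      then show ?thesis using insert.hyps by (simp add: v_def)
    qed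
    ultimately have 1: "s\<^sup>2 * (a * (c * \<beta>)\<^sup>2 + 2 * (c * \<beta>) * \<beta> + qform I Q u) \<le> (c * \<beta>)\<^sup>2 / 8 + (\<Sum>j\<in>I. (u j)\<^sup>2)/8"
      by simp
    have "qform I Q' u = qform I Q u + c * \<beta>\<^sup>2" unfolding Q'_def \<beta>_def by (rule qform_rank1)
    moreover have "s\<^sup>2 * (c * \<beta>\<^sup>2) \<le> s\<^sup>2 * (a * (c * \<beta>)\<^sup>2 + 2 * (c * \<beta>) * \<beta>) - (c * \<beta>)\<^sup>2 / 8"
    proof -
      have e: "s\<^sup>2 * (a * (c * \<beta>)\<^sup>2 + 2 * (c * \<beta>) * \<beta>) - (c * \<beta>)\<^sup>2 / 8 - s\<^sup>2 * (c * \<beta>\<^sup>2)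
        = c * \<beta>\<^sup>2 * (s\<^sup>2 * a * c + s\<^sup>2 - c / 8)" by (simp add: algebra_simps power2_eq_square)
      have "c * (1 - 2 * a * s\<^sup>2) = 2 * s\<^sup>2" using d by (simp add: c_def)
      then have "2 * (s\<^sup>2 * a * c + s\<^sup>2) = c" by (simp add: algebra_simps)
      then have "s\<^sup>2 * a * c + s\<^sup>2 - c / 8 \<ge> 0" using c0 by simp
      then have "c * \<beta>\<^sup>2 * (s\<^sup>2 * a * c + s\<^sup>2 - c / 8) \<ge> 0" using c0 by simp
      then show ?thesis using e by linarith
    qed
    ultimately show ?thesis using 1 by (simp add: algebra_simps)
  qed
  have Qsym': "Q' j k = Q' k j" if "j \<in> I" "k \<in> I" for j k
    using insert.prems(1) that by (simp add: Q'_def)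
  define B where "B = (\<Sum>j\<in>I. (b j)\<^sup>2)"
  define T where "T = (\<Sum>j\<in>I. Q j j)"
  define F where "F = (\<Sum>j\<in>I. \<Sum>k\<in>I. (Q j k)\<^sup>2)"
  define q where "q = qform I Q b"
  have B0: "B \<ge> 0" unfolding B_def by (intro sum_nonneg) simp
  have "(\<integral>\<^sup>+w. ennreal (exp (qform (insert i I) Q w)) \<partial>PiM (insert i I) (\<lambda>_. gaussian s))
     = (\<integral>\<^sup>+x. (\<integral>\<^sup>+y. ennreal (exp (qform (insert i I) Q (x(i := y)))) \<partial>gaussian s) \<partial>PiM I (\<lambda>_. gaussian s))"
    by (rule PP.product_nn_integral_insert[OF insert.hyps]) measurable
  also have "\<dots> = (\<integral>\<^sup>+x. ennreal (exp (qform I Q' x) / sqrt (1 - 2 * a * s\<^sup>2)) \<partial>PiM I (\<lambda>_. gaussian s))"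
  proof (intro nn_integral_cong)
    fix x :: "'i \<Rightarrow> real"
    have xq: "qform (insert i I) Q (x(i := y)) = qform I Q x + (a * y\<^sup>2 + (2 * (\<Sum>j\<in>I. b j * x j)) * y)" for y
    proof -
      have "qform I Q (x(i := y)) = qform I Q x" using insert.hyps by (intro qform_cong) auto
      moreover have "(\<Sum>j\<in>I. Q i j * (x(i := y)) j) = (\<Sum>j\<in>I. b j * x j)"
        using insert.hyps by (intro sum.cong) (auto simp: b_def)
      ultimately show ?thesis by (subst qi) (auto simp: a_def)
    qed
    have "(\<integral>\<^sup>+y. ennreal (exp (qform (insert i I) Q (x(i := y)))) \<partial>gaussian s)
      = (\<integral>\<^sup>+y. ennreal (exp (qform I Q x)) * ennreal (exp (a * y\<^sup>2 + (2 * (\<Sum>j\<in>I. b j * x j)) * y)) \<partial>gaussian s)"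
      by (intro nn_integral_cong) (simp add: xq exp_add ennreal_mult)
    also have "\<dots> = ennreal (exp (qform I Q x)) * ennreal (exp ((2 * (\<Sum>j\<in>I. b j * x j))\<^sup>2 * s\<^sup>2 / (2 * (1 - 2 * a * s\<^sup>2))) / sqrt (1 - 2 * a * s\<^sup>2))"
      using d by (subst nn_integral_cmult) (auto simp: gaussian_exp_quad[OF s])
    also have "\<dots> = ennreal (exp (qform I Q x) * exp ((2 * (\<Sum>j\<in>I. b j * x j))\<^sup>2 * s\<^sup>2 / (2 * (1 - 2 * a * s\<^sup>2))) / sqrt (1 - 2 * a * s\<^sup>2))"
      using d by (subst ennreal_mult[symmetric]) auto
    also have "exp (qform I Q x) * exp ((2 * (\<Sum>j\<in>I. b j * x j))\<^sup>2 * s\<^sup>2 / (2 * (1 - 2 * a * s\<^sup>2))) = exp (qform I Q' x)"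
    proof -
      have eq: "(2 * z)\<^sup>2 * s\<^sup>2 / (2 * D) = 2 * s\<^sup>2 / D * z\<^sup>2" for z D :: real
        by (simp add: power_mult_distrib)
      show ?thesis unfolding exp_add[symmetric] Q'_def qform_rank1 c_def by (simp only: eq)
    qed
    finally show "(\<integral>\<^sup>+y. ennreal (exp (qform (insert i I) Q (x(i := y)))) \<partial>gaussian s)
      = ennreal (exp (qform I Q' x) / sqrt (1 - 2 * a * s\<^sup>2))" .
  qed
  also have "\<dots> = (\<integral>\<^sup>+x. ennreal (1 / sqrt (1 - 2 * a * s\<^sup>2)) * ennreal (exp (qform I Q' x)) \<partial>PiM I (\<lambda>_. gaussian s))"
    using d by (intro nn_integral_cong) (simp add: ennreal_mult[symmetric])
  also have "\<dots> = ennreal (1 / sqrt (1 - 2 * a * s\<^sup>2)) * (\<integral>\<^sup>+x. ennreal (exp (qform I Q' x)) \<partial>PiM I (\<lambda>_. gaussian s))"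
    by (rule nn_integral_cmult) measurable
  also have "\<dots> \<le> ennreal (1 / sqrt (1 - 2 * a * s\<^sup>2)) *
     ennreal (exp (s\<^sup>2 * (\<Sum>j\<in>I. Q' j j) + 2 * s^4 * (\<Sum>j\<in>I. \<Sum>k\<in>I. (Q' j k)\<^sup>2)))"
    by (intro mult_left_mono insert.IH Qsym' key) auto
  also have "\<dots> = ennreal (1 / sqrt (1 - 2 * a * s\<^sup>2) * exp (s\<^sup>2 * (\<Sum>j\<in>I. Q' j j) + 2 * s^4 * (\<Sum>j\<in>I. \<Sum>k\<in>I. (Q' j k)\<^sup>2)))"
    using d by (intro ennreal_mult[symmetric]) auto
  also have "\<dots> \<le> ennreal (exp (s\<^sup>2 * (\<Sum>j\<in>insert i I. Q j j) + 2 * s^4 * (\<Sum>j\<in>insert i I. \<Sum>k\<in>insert i I. (Q j k)\<^sup>2)))"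
  proof (rule ennreal_leI)
    have t': "(\<Sum>j\<in>I. Q' j j) = T + c * B"
      by (simp add: Q'_def T_def B_def sum.distrib sum_distrib_left power2_eq_square mult_ac)
    have f': "(\<Sum>j\<in>I. \<Sum>k\<in>I. (Q' j k)\<^sup>2) = F + 2 * c * q + c\<^sup>2 * B\<^sup>2"
      unfolding Q'_def frob_rank1 F_def q_def B_def by simp
    have f: "(\<Sum>j\<in>insert i I. \<Sum>k\<in>insert i I. (Q j k)\<^sup>2) = a\<^sup>2 + 2 * B + F"
      unfolding a_def B_def b_def F_def by (rule frob_insert[OF insert.hyps(1,2)]) (rule sym)
    have t: "(\<Sum>j\<in>insert i I. Q j j) = a + T" using insert.hyps by (simp add: a_def T_def)
    have l: "1 / sqrt (1 - 2 * a * s\<^sup>2) \<le> exp (s\<^sup>2 * a + 2 * s^4 * a\<^sup>2)"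
    proof -
      have "1 / sqrt (1 - 2 * a * s\<^sup>2) = exp (- (ln (1 - 2 * (s\<^sup>2 * a)) / 2))"
        using d by (simp add: exp_minus ln_sqrt[symmetric] field_simps)
      also have "\<dots> \<le> exp (s\<^sup>2 * a + 2 * s^4 * a\<^sup>2)"
        using ln_one_minus_lower[of "2 * (s\<^sup>2 * a)"] a8 by (simp add: power_mult_distrib power_mult[symmetric])
      finally show ?thesis .
    qed
    have kb: "s\<^sup>2 * (q + c * B\<^sup>2) \<le> B / 8"
      using key[of b] unfolding Q'_def qform_rank1 q_def B_def by (simp add: power2_eq_square)
    \<comment> \<open>The growth of trace and Frobenius norm under the rank-one update is paid by
      the off-diagonal entries of the removed row, which count 2 B in the Frobenius norm. The
      constants 1/8 and 2 of the lemma fit exactly: 3/2 * 8/3 = 4.\<close>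
    have m: "s\<^sup>2 * c * B + 2 * s^4 * (2 * c * q + c\<^sup>2 * B\<^sup>2) \<le> 4 * s^4 * B"
    proof -
      have "2 * s^4 * (2 * c * q + c\<^sup>2 * B\<^sup>2) \<le> 4 * s\<^sup>2 * c * (s\<^sup>2 * (q + c * B\<^sup>2))"
      proof -
        have "0 \<le> 2 * (s^4 * c\<^sup>2 * B\<^sup>2)" by simp
        then show ?thesis by (simp add: algebra_simps power2_eq_square power4_eq_xxxx)
      qed
      also have "\<dots> \<le> 4 * s\<^sup>2 * c * (B / 8)"
        using kb c0 by (intro mult_left_mono) auto
      finally have "s\<^sup>2 * c * B + 2 * s^4 * (2 * c * q + c\<^sup>2 * B\<^sup>2) \<le> (3/2 * s\<^sup>2 * B) * c" by simp
      also have "\<dots> \<le> (3/2 * s\<^sup>2 * B) * (8/3 * s\<^sup>2)"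
        using cs B0 by (intro mult_left_mono) auto
      also have "\<dots> = 4 * s^4 * B" by (simp add: power2_eq_square power4_eq_xxxx)
      finally show ?thesis .
    qed
    have "1 / sqrt (1 - 2 * a * s\<^sup>2) * exp (s\<^sup>2 * (T + c * B) + 2 * s^4 * (F + 2 * c * q + c\<^sup>2 * B\<^sup>2))
      \<le> exp (s\<^sup>2 * a + 2 * s^4 * a\<^sup>2) * exp (s\<^sup>2 * (T + c * B) + 2 * s^4 * (F + 2 * c * q + c\<^sup>2 * B\<^sup>2))"
      by (intro mult_right_mono l) auto
    also have "\<dots> \<le> exp (s\<^sup>2 * (a + T) + 2 * s^4 * (a\<^sup>2 + 2 * B + F))"
      unfolding exp_add[symmetric] using m by (simp add: algebra_simps)
    finally show "1 / sqrt (1 - 2 * a * s\<^sup>2) * exp (s\<^sup>2 * (\<Sum>j\<in>I. Q' j j) + 2 * s^4 * (\<Sum>j\<in>I. \<Sum>k\<in>I. (Q' j k)\<^sup>2))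
      \<le> exp (s\<^sup>2 * (\<Sum>j\<in>insert i I. Q j j) + 2 * s^4 * (\<Sum>j\<in>insert i I. \<Sum>k\<in>insert i I. (Q j k)\<^sup>2))"
      unfolding t t' f f' .
  qed
  finally show ?case .
qed

section \<open>Independent copies of a chaos, and exponential Markov\<close>

definition trc :: "nat \<Rightarrow> (nat \<Rightarrow> nat \<Rightarrow> real) \<Rightarrow> real" where
  "trc n G = (\<Sum>j<n. G j j)"

definition frob2 :: "nat \<Rightarrow> (nat \<Rightarrow> nat \<Rightarrow> real) \<Rightarrow> real" where
  "frob2 n G = (\<Sum>j<n. \<Sum>k<n. (G j k)\<^sup>2)"

lemma frob2_nonneg: "frob2 n G \<ge> 0"
  unfolding frob2_def by (intro sum_nonneg) auto

lemma sum_block_diag: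
  fixes f :: "'p \<Rightarrow> 'j \<Rightarrow> 'j \<Rightarrow> real"
  assumes P: "finite P" "finite J"
  shows "(\<Sum>a\<in>P \<times> J. \<Sum>b\<in>P \<times> J. if fst a = fst b then f (fst a) (snd a) (snd b) else 0)
    = (\<Sum>p\<in>P. \<Sum>j\<in>J. \<Sum>k\<in>J. f p j k)"
proof -
  have "(\<Sum>b\<in>P \<times> J. if p = fst b then f p j (snd b) else 0) = (\<Sum>k\<in>J. f p j k)" if "p \<in> P" for p j
  proof -
    have "(\<Sum>b\<in>P \<times> J. if p = fst b then f p j (snd b) else 0)
      = (\<Sum>q\<in>P. \<Sum>k\<in>J. if p = q then f p j k else 0)"
      by (subst sum.cartesian_product) (auto intro!: sum.cong)
    also have "\<dots> = (\<Sum>q\<in>P. if p = q then (\<Sum>k\<in>J. f p j k) else 0)"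
      by (intro sum.cong) auto
    also have "\<dots> = (\<Sum>k\<in>J. f p j k)" using P that by simp
    finally show ?thesis .
  qed
  then have "(\<Sum>a\<in>P \<times> J. \<Sum>b\<in>P \<times> J. if fst a = fst b then f (fst a) (snd a) (snd b) else 0)
    = (\<Sum>a\<in>P \<times> J. \<Sum>k\<in>J. f (fst a) (snd a) k)"
    by (intro sum.cong refl) (metis mem_Times_iff)
  also have "\<dots> = (\<Sum>p\<in>P. \<Sum>j\<in>J. \<Sum>k\<in>J. f p j k)"
    by (subst sum.cartesian_product) (auto intro!: sum.cong)
  finally show ?thesis .
qed

text \<open>Independent vectors sharing the matrix \<open>G\<close> form one Gaussian vector with a
  block diagonal matrix: trace and squared Frobenius norm are multiplied by the number of blocks,
  while the spectral bound 1/8 is inherited.\<close>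

lemma chaos_mgf_block:
  fixes G :: "nat \<Rightarrow> nat \<Rightarrow> real" and P :: "'p set"
  assumes fin: "finite P" and s: "s > 0"
    and sym: "\<And>j k. j < n \<Longrightarrow> k < n \<Longrightarrow> G j k = G k j"
    and le: "\<And>u. s\<^sup>2 * qform {..<n} G u \<le> (\<Sum>j<n. (u j)\<^sup>2) / 8"
  shows "(\<integral>\<^sup>+w. ennreal (exp (\<Sum>p\<in>P. qform {..<n} G (\<lambda>j. w (p, j)))) \<partial>PiM (P \<times> {..<n}) (\<lambda>_. gaussian s))
    \<le> ennreal (exp (real (card P) * (s\<^sup>2 * trc n G + 2 * s^4 * frob2 n G)))"
proof -
  define Q where "Q = (\<lambda>a b :: 'p \<times> nat. if fst a = fst b then G (snd a) (snd b) else 0)"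
  have qf: "qform (P \<times> {..<n}) Q w = (\<Sum>p\<in>P. qform {..<n} G (\<lambda>j. w (p, j)))" for w
  proof -
    have "qform (P \<times> {..<n}) Q w = (\<Sum>a\<in>P \<times> {..<n}. \<Sum>b\<in>P \<times> {..<n}. if fst a = fst b
        then (\<lambda>p j k. G j k * w (p, j) * w (p, k)) (fst a) (snd a) (snd b) else 0)"
      unfolding qform_def Q_def by (intro sum.cong) auto
    also have "\<dots> = (\<Sum>p\<in>P. \<Sum>j<n. \<Sum>k<n. G j k * w (p, j) * w (p, k))"
      using fin by (subst sum_block_diag) auto
    finally show ?thesis by (simp add: qform_def)
  qed
  have fr: "(\<Sum>a\<in>P \<times> {..<n}. \<Sum>b\<in>P \<times> {..<n}. (Q a b)\<^sup>2) = real (card P) * frob2 n G"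
  proof -
    have "(\<Sum>a\<in>P \<times> {..<n}. \<Sum>b\<in>P \<times> {..<n}. (Q a b)\<^sup>2) = (\<Sum>a\<in>P \<times> {..<n}. \<Sum>b\<in>P \<times> {..<n}. if fst a = fst b
        then (\<lambda>p j k. (G j k)\<^sup>2) (fst a) (snd a) (snd b) else 0)"
      unfolding Q_def by (intro sum.cong) auto
    also have "\<dots> = (\<Sum>p\<in>P. \<Sum>j<n. \<Sum>k<n. (G j k)\<^sup>2)"
      using fin by (subst sum_block_diag) auto
    finally show ?thesis by (simp add: frob2_def)
  qed
  have tr: "(\<Sum>a\<in>P \<times> {..<n}. Q a a) = real (card P) * trc n G"
  proof -
    have "(\<Sum>a\<in>P \<times> {..<n}. Q a a) = (\<Sum>p\<in>P. \<Sum>j<n. G j j)"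
      by (subst sum.cartesian_product) (auto intro!: sum.cong simp: Q_def)
    then show ?thesis by (simp add: trc_def)
  qed
  have "(\<integral>\<^sup>+w. ennreal (exp (qform (P \<times> {..<n}) Q w)) \<partial>PiM (P \<times> {..<n}) (\<lambda>_. gaussian s))
    \<le> ennreal (exp (s\<^sup>2 * (\<Sum>a\<in>P \<times> {..<n}. Q a a) + 2 * s^4 * (\<Sum>a\<in>P \<times> {..<n}. \<Sum>b\<in>P \<times> {..<n}. (Q a b)\<^sup>2)))"
  proof (rule chaos_mgf[OF _ s])
    show "finite (P \<times> {..<n})" using fin by simp
    show "Q i j = Q j i" if "i \<in> P \<times> {..<n}" "j \<in> P \<times> {..<n}" for i j
      using that sym by (auto simp: Q_def)
    fix u :: "'p \<times> nat \<Rightarrow> real"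
    have "s\<^sup>2 * qform (P \<times> {..<n}) Q u = (\<Sum>p\<in>P. s\<^sup>2 * qform {..<n} G (\<lambda>j. u (p, j)))"
      by (simp add: qf sum_distrib_left)
    also have "\<dots> \<le> (\<Sum>p\<in>P. (\<Sum>j<n. (u (p, j))\<^sup>2) / 8)" by (intro sum_mono le)
    also have "\<dots> = (\<Sum>i\<in>P \<times> {..<n}. (u i)\<^sup>2) / 8"
      by (simp add: sum_divide_distrib[symmetric] sum.cartesian_product)
    finally show "s\<^sup>2 * qform (P \<times> {..<n}) Q u \<le> (\<Sum>i\<in>P \<times> {..<n}. (u i)\<^sup>2) / 8" .
  qed
  then show ?thesis unfolding qf fr tr by (simp add: algebra_simps)
qed

lemma (in prob_space) exp_markov:
  fixes Y :: "'a \<Rightarrow> real"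
  assumes [measurable]: "Y \<in> borel_measurable M"
    and le: "(\<integral>\<^sup>+x. ennreal (exp (Y x)) \<partial>M) \<le> 1"
  shows "prob {x \<in> space M. t \<le> Y x} \<le> exp (- t)"
proof -
  have "{x \<in> space M. t \<le> Y x} = {x \<in> space M. 1 \<le> ennreal (exp (-t)) * ennreal (exp (Y x))}"
    by (auto simp: ennreal_mult[symmetric] exp_add[symmetric] simp flip: ennreal_1)
  then have "emeasure M {x \<in> space M. t \<le> Y x} = emeasure M {x \<in> space M. 1 \<le> ennreal (exp (-t)) * ennreal (exp (Y x))}"
    by simp
  also have "\<dots> \<le> ennreal (exp (-t)) * (\<integral>\<^sup>+x. ennreal (exp (Y x)) * indicator (space M) x \<partial>M)"
    by (rule nn_integral_Markov_inequality[where A="space M"]) auto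
  also have "(\<integral>\<^sup>+x. ennreal (exp (Y x)) * indicator (space M) x \<partial>M) = (\<integral>\<^sup>+x. ennreal (exp (Y x)) \<partial>M)"
    by (intro nn_integral_cong) auto
  also have "ennreal (exp (-t)) * \<dots> \<le> ennreal (exp (-t)) * 1" by (intro mult_left_mono le) auto
  finally show ?thesis by (simp add: emeasure_eq_measure)
qed

section \<open>Determinants by elimination\<close>

text \<open>Matrices are functions of two indices whose values outside the range are ignored, so
  that submatrices and Schur complements are plain index shifts.\<close>

definition fdet :: "nat \<Rightarrow> (nat \<Rightarrow> nat \<Rightarrow> real) \<Rightarrow> real" where
  "fdet m f = Determinant.det (Matrix.mat m m (\<lambda>(i, j). f i j))"

lemma fdet_0 [simp]: "fdet 0 f = 1"
  unfolding fdet_def by (simp add: Determinant.det_def)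

lemma fdet_cong: "(\<And>i j. i < m \<Longrightarrow> j < m \<Longrightarrow> f i j = g i j) \<Longrightarrow> fdet m f = fdet m g"
  unfolding fdet_def by (intro arg_cong[of _ _ Determinant.det]) (auto intro!: eq_matI)

text \<open>One elimination step as a factorisation: \<open>Lm\<close> is unit lower triangular, and
  the first column of \<open>U\<close> vanishes below the pivot.\<close>

lemma fdet_pivot:
  assumes a: "f 0 0 \<noteq> 0"
  shows "fdet (Suc m) f = f 0 0 * fdet m (\<lambda>i j. f (Suc i) (Suc j) + (- 1 / f 0 0) * f (Suc i) 0 * f 0 (Suc j))"
proof -
  let ?n = "Suc m"
  define Lm where "Lm = Matrix.mat ?n ?n (\<lambda>(i, j). if i = j then 1 else if j = 0 then f i 0 / f 0 0 else 0)"
  define U where "U = Matrix.mat ?n ?n (\<lambda>(i, j). if i = 0 then f 0 j else if j = 0 then 0 else f i j - f i 0 * f 0 j / f 0 0)"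
  have LU: "Matrix.mat ?n ?n (\<lambda>(i, j). f i j) = Lm * U"
  proof (rule eq_matI)
    fix i j assume "i < dim_row (Lm * U)" "j < dim_col (Lm * U)"
    then have ij: "i < ?n" "j < ?n" by (auto simp: Lm_def U_def)
    have "(Lm * U) $$ (i, j) = (\<Sum>k\<in>{0..<?n}. Lm $$ (i, k) * U $$ (k, j))"
      using ij by (simp add: Lm_def U_def scalar_prod_def)
    also have "\<dots> = f i j"
    proof (cases "i = 0")
      case True
      have "(\<Sum>k\<in>{0..<?n}. Lm $$ (i, k) * U $$ (k, j)) = (\<Sum>k\<in>{0..<?n}. if k = 0 then f 0 j else 0)"
        using ij True by (intro sum.cong) (auto simp: Lm_def U_def)
      then show ?thesis using True by simp
    next
      case False
      have "(\<Sum>k\<in>{0..<?n}. Lm $$ (i, k) * U $$ (k, j))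
        = (\<Sum>k\<in>{0..<?n}. (if k = 0 then f i 0 / f 0 0 * f 0 j else 0) + (if k = i then U $$ (i, j) else 0))"
        using ij False by (intro sum.cong) (auto simp: Lm_def U_def)
      also have "\<dots> = f i 0 / f 0 0 * f 0 j + U $$ (i, j)"
        using ij by (simp add: sum.distrib)
      finally show ?thesis using ij False a by (simp add: U_def)
    qed
    finally show "Matrix.mat ?n ?n (\<lambda>(i, j). f i j) $$ (i, j) = (Lm * U) $$ (i, j)"
      using ij by simp
  qed (auto simp: Lm_def U_def)
  have Lc: "Lm \<in> carrier_mat ?n ?n" "U \<in> carrier_mat ?n ?n" by (auto simp: Lm_def U_def)
  have "Determinant.det Lm = prod_list (diag_mat Lm)"
    by (rule det_lower_triangular[OF _ Lc(1)]) (auto simp: Lm_def)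
  also have "\<dots> = 1"
  proof -
    have "diag_mat Lm = map (\<lambda>_. 1) [0..<?n]"
      unfolding diag_mat_def by (intro map_cong) (auto simp: Lm_def)
    also have "prod_list \<dots> = 1" by (simp add: map_replicate_const)
    finally show ?thesis .
  qed
  finally have dL: "Determinant.det Lm = 1" .
  have "Determinant.det U = (\<Sum>i<?n. U $$ (i, 0) * cofactor U i 0)"
    by (rule laplace_expansion_column[OF Lc(2)]) simp
  also have "\<dots> = (\<Sum>i<?n. if i = 0 then f 0 0 * cofactor U 0 0 else 0)"
    by (intro sum.cong) (auto simp: U_def)
  also have "\<dots> = f 0 0 * cofactor U 0 0" by simp
  also have "cofactor U 0 0 = Determinant.det (mat_delete U 0 0)" by (simp add: cofactor_def)
  also have "mat_delete U 0 0 = Matrix.mat m m (\<lambda>(i, j). f (Suc i) (Suc j) + (- 1 / f 0 0) * f (Suc i) 0 * f 0 (Suc j))"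
    by (rule eq_matI) (auto simp: mat_delete_def U_def)
  finally show ?thesis unfolding fdet_def LU det_mult[OF Lc] dL by simp
qed

lemma qform_Suc:
  assumes sym: "\<And>i j. i < Suc m \<Longrightarrow> j < Suc m \<Longrightarrow> f i j = f j i"
  shows "qform {..<Suc m} f (case_nat y u) = f 0 0 * y\<^sup>2 + 2 * y * (\<Sum>j<m. f 0 (Suc j) * u j)
    + qform {..<m} (\<lambda>i j. f (Suc i) (Suc j)) u"
proof -
  have "qform {..<Suc m} f (case_nat y u) = f 0 0 * y * y + (\<Sum>j<m. f 0 (Suc j) * y * u j)
    + (\<Sum>i<m. f (Suc i) 0 * u i * y + (\<Sum>j<m. f (Suc i) (Suc j) * u i * u j))"
    unfolding qform_def sum.lessThan_Suc_shift by simp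
  also have "\<dots> = f 0 0 * y * y + (\<Sum>j<m. f 0 (Suc j) * y * u j)
    + ((\<Sum>i<m. f 0 (Suc i) * y * u i) + qform {..<m} (\<lambda>i j. f (Suc i) (Suc j)) u)"
    unfolding qform_def sum.distrib using sym by (simp add: mult_ac)
  also have "(\<Sum>j<m. f 0 (Suc j) * y * u j) = y * (\<Sum>j<m. f 0 (Suc j) * u j)"
    by (simp add: sum_distrib_left mult_ac)
  finally show ?thesis by (simp add: power2_eq_square)
qed

lemma sum_case_nat_sq: "(\<Sum>i<Suc m. (case_nat y u i)\<^sup>2) = y\<^sup>2 + (\<Sum>i<m. (u i :: real)\<^sup>2)"
  unfolding sum.lessThan_Suc_shift by simp

section \<open>Positive definite matrices: Schur complements, Cholesky factors,
  log-determinants\<close>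

definition posdef :: "nat \<Rightarrow> (nat \<Rightarrow> nat \<Rightarrow> real) \<Rightarrow> bool" where
  "posdef m f \<longleftrightarrow> (\<forall>i<m. \<forall>j<m. f i j = f j i) \<and> (\<forall>u. (\<exists>i<m. u i \<noteq> 0) \<longrightarrow> 0 < qform {..<m} f u)"

lemma posdef_sym: "posdef m f \<Longrightarrow> i < m \<Longrightarrow> j < m \<Longrightarrow> f i j = f j i"
  by (simp add: posdef_def)

lemma posdef_pos: "posdef m f \<Longrightarrow> i < m \<Longrightarrow> u i \<noteq> 0 \<Longrightarrow> 0 < qform {..<m} f u"
  by (auto simp: posdef_def)

lemma posdef_nonneg: assumes "posdef m f" shows "0 \<le> qform {..<m} f u"
proof (cases "\<exists>i<m. u i \<noteq> 0")
  case True
  then show ?thesis using assms unfolding posdef_def by (meson less_imp_le)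
next
  case False
  then show ?thesis by (simp add: qform_def)
qed

abbreviation schur :: "(nat \<Rightarrow> nat \<Rightarrow> real) \<Rightarrow> nat \<Rightarrow> nat \<Rightarrow> real" where
  "schur f \<equiv> (\<lambda>i j. f (Suc i) (Suc j) + (- 1 / f 0 0) * f 0 (Suc i) * f 0 (Suc j))"

lemma posdef_00: assumes "posdef (Suc m) f" shows "f 0 0 > 0"
proof -
  have "0 < qform {..<Suc m} f (case_nat 1 (\<lambda>_. 0))"
    by (rule posdef_pos[OF assms, of 0]) auto
  then show ?thesis using qform_Suc[of m f 1 "\<lambda>_. 0"] posdef_sym[OF assms]
    by (simp add: qform_def[of "{..<m}"])
qed

text \<open>Prepending the coordinate -\<beta> / f 0 0 to \<open>u\<close> minimises the form over
  that coordinate, and the minimum is the form of the Schur complement.\<close>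

lemma posdef_schur: assumes "posdef (Suc m) f" shows "posdef m (schur f)"
  unfolding posdef_def
proof (intro conjI allI impI)
  fix i j assume "i < m" "j < m" then show "schur f i j = schur f j i"
    using posdef_sym[OF assms, of "Suc i" "Suc j"] by simp
next
  fix u :: "nat \<Rightarrow> real" assume "\<exists>i<m. u i \<noteq> 0"
  then obtain i where i: "i < m" "u i \<noteq> 0" by auto
  define \<beta> where "\<beta> = (\<Sum>j<m. f 0 (Suc j) * u j)"
  have a: "f 0 0 > 0" by (rule posdef_00[OF assms])
  have "0 < qform {..<Suc m} f (case_nat (- \<beta> / f 0 0) u)"
    using i by (intro posdef_pos[OF assms, of "Suc i"]) auto
  also have "\<dots> = f 0 0 * (- \<beta> / f 0 0)\<^sup>2 + 2 * (- \<beta> / f 0 0) * \<beta> + qform {..<m} (\<lambda>i j. f (Suc i) (Suc j)) u"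
    unfolding \<beta>_def by (rule qform_Suc) (rule posdef_sym[OF assms])
  also have "\<dots> = qform {..<m} (schur f) u"
    unfolding qform_rank1 \<beta>_def[symmetric] using a by (simp add: field_simps power2_eq_square)
  finally show "0 < qform {..<m} (schur f) u" .
qed

lemma fdet_schur: assumes "posdef (Suc m) f" shows "fdet (Suc m) f = f 0 0 * fdet m (schur f)"
proof -
  have "fdet (Suc m) f = f 0 0 * fdet m (\<lambda>i j. f (Suc i) (Suc j) + (- 1 / f 0 0) * f (Suc i) 0 * f 0 (Suc j))"
    using posdef_00[OF assms] by (intro fdet_pivot) simp
  also have "fdet m (\<lambda>i j. f (Suc i) (Suc j) + (- 1 / f 0 0) * f (Suc i) 0 * f 0 (Suc j)) = fdet m (schur f)"
    using posdef_sym[OF assms] by (intro fdet_cong) simp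
  finally show ?thesis .
qed

lemma fdet_pos: "posdef m f \<Longrightarrow> fdet m f > 0"
proof (induction m arbitrary: f)
  case (Suc m)
  show ?case unfolding fdet_schur[OF Suc.prems]
    by (intro mult_pos_pos posdef_00[OF Suc.prems] Suc.IH posdef_schur[OF Suc.prems])
qed simp

lemma cholesky:
  assumes "posdef m f"
  shows "\<exists>r. \<forall>i<m. \<forall>j<m. f i j = (\<Sum>k<m. r i k * r j k)"
  using assms
proof (induction m arbitrary: f)
  case 0
  then show ?case by simp
next
  case (Suc m)
  have a: "f 0 0 > 0" by (rule posdef_00[OF Suc.prems])
  from Suc.IH[OF posdef_schur[OF Suc.prems]] obtain r where
    r: "\<And>i j. i < m \<Longrightarrow> j < m \<Longrightarrow> schur f i j = (\<Sum>k<m. r i k * r j k)" by blast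
  define R where "R = (\<lambda>i k. case k of 0 \<Rightarrow> f 0 i / sqrt (f 0 0) | Suc k' \<Rightarrow> (case i of 0 \<Rightarrow> 0 | Suc i' \<Rightarrow> r i' k'))"
  have "f i j = (\<Sum>k<Suc m. R i k * R j k)" if "i < Suc m" "j < Suc m" for i j
  proof -
    have "(\<Sum>k<Suc m. R i k * R j k) = f 0 i * f 0 j / f 0 0 + (\<Sum>k<m. R i (Suc k) * R j (Suc k))"
      unfolding sum.lessThan_Suc_shift using a by (simp add: R_def)
    also have "\<dots> = f i j"
    proof (cases "i = 0 \<or> j = 0")
      case True
      then have "(\<Sum>k<m. R i (Suc k) * R j (Suc k)) = 0" by (auto simp: R_def)
      then show ?thesis using True a posdef_sym[OF Suc.prems, of i j] that by auto
    next
      case False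
      then obtain i' j' where ij: "i = Suc i'" "j = Suc j'" by (metis not0_implies_Suc)
      then show ?thesis using r[of i' j'] that by (simp add: R_def field_simps)
    qed
    finally show ?thesis by simp
  qed
  then show ?case by blast
qed

text \<open>The derivative (y - 1) (1/y - 2 / (5 \<kappa>)) of the gap changes sign only at 1, since
  1/y \<ge> 1/\<kappa> on the range. This is the scalar case of the determinant inequality.\<close>

lemma ln_le_quadratic:
  fixes a \<kappa> :: real assumes "0 < a" "a \<le> \<kappa>" "1 \<le> \<kappa>"
  shows "ln a \<le> (a - 1) - (a - 1)\<^sup>2 / (5 * \<kappa>)"
proof -
  define g where "g = (\<lambda>x::real. x - 1 - (x - 1)\<^sup>2 / (5 * \<kappa>) - ln x)"
  have der: "(g has_real_derivative (y - 1) * (1 / y - 2 / (5 * \<kappa>))) (at y)" if "0 < y" for y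
  proof -
    have "(g has_real_derivative 1 - 2 * (y - 1) / (5 * \<kappa>) - 1 / y) (at y)"
      unfolding g_def using that assms by (auto intro!: derivative_eq_intros simp: field_simps)
    moreover have "1 - 2 * (y - 1) / (5 * \<kappa>) - 1 / y = (y - 1) * (1 / y - 2 / (5 * \<kappa>))"
      using that assms by (simp add: field_simps)
    ultimately show ?thesis by simp
  qed
  have pos: "1 / y - 2 / (5 * \<kappa>) \<ge> 0" if "0 < y" "y \<le> \<kappa>" for y
    using that assms by (simp add: field_simps)
  have "g 1 \<le> g a"
  proof (cases "a \<ge> 1")
    case True
    show ?thesis
    proof (rule DERIV_nonneg_imp_nondecreasing[OF True])
      fix y :: real assume y: "1 \<le> y" "y \<le> a"
      have "(y - 1) * (1 / y - 2 / (5 * \<kappa>)) \<ge> 0" using y assms by (intro mult_nonneg_nonneg pos) auto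
      then show "\<exists>z. (g has_real_derivative z) (at y) \<and> 0 \<le> z" using der[of y] y by auto
    qed
  next
    case False
    show ?thesis
    proof (rule DERIV_nonpos_imp_nonincreasing[of a 1 g])
      show "a \<le> 1" using False by simp
      fix y :: real assume y: "a \<le> y" "y \<le> 1"
      have "(y - 1) * (1 / y - 2 / (5 * \<kappa>)) \<le> 0" using y assms by (intro mult_nonpos_nonneg pos) auto
      then show "\<exists>z. (g has_real_derivative z) (at y) \<and> z \<le> 0" using der[of y] y assms by auto
    qed
  qed
  then show ?thesis by (simp add: g_def)
qed

abbreviation kron :: "nat \<Rightarrow> nat \<Rightarrow> real" where "kron i j \<equiv> (if i = j then 1 else 0)"

lemma qform_kron: "qform {..<m} kron u = (\<Sum>i<m. (u i)\<^sup>2)"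
proof -
  have "(\<Sum>j<m. kron i j * u i * u j) = (u i)\<^sup>2" if "i < m" for i
  proof -
    have "(\<Sum>j<m. kron i j * u i * u j) = (\<Sum>j<m. if i = j then u i * u i else 0)"
      by (intro sum.cong) auto
    then show ?thesis using that by (simp add: power2_eq_square)
  qed
  then show ?thesis by (simp add: qform_def)
qed

lemma qform_diff: "qform I (\<lambda>i j. f i j - g i j) u = qform I f u - qform I g u"
  by (simp add: qform_def left_diff_distrib sum_subtractf)

text \<open>Both positive definiteness and the upper bound \<open>\<kappa>\<close> pass to the Schur complement; the constant 5
  is what the induction step needs to absorb the eliminated row.\<close>
lemma ln_fdet_le:
  assumes "posdef m f" "1 \<le> \<kappa>" "\<And>u. qform {..<m} f u \<le> \<kappa> * (\<Sum>i<m. (u i)\<^sup>2)"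
  shows "ln (fdet m f) \<le> (trc m f - real m) - frob2 m (\<lambda>i j. f i j - kron i j) / (5 * \<kappa>)"
  using assms
proof (induction m arbitrary: f)
  case 0
  then show ?case by (simp add: trc_def frob2_def)
next
  case (Suc m)
  note pd = Suc.prems(1) and k1 = Suc.prems(2) and le = Suc.prems(3)
  define a where "a = f 0 0"
  define b where "b = (\<lambda>j. f 0 (Suc j))"
  define f' where "f' = schur f"
  define C where "C = (\<lambda>i j. f (Suc i) (Suc j))"
  define B where "B = (\<Sum>j<m. (b j)\<^sup>2)"
  define q where "q = qform {..<m} f' b"
  define F' where "F' = frob2 m (\<lambda>i j. f' i j - kron i j)"
  have a: "a > 0" unfolding a_def by (rule posdef_00[OF pd])
  have pd': "posdef m f'" unfolding f'_def by (rule posdef_schur[OF pd])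
  have B0: "B \<ge> 0" unfolding B_def by (intro sum_nonneg) auto
  have qs: "qform {..<Suc m} f (case_nat y u) = a * y\<^sup>2 + 2 * y * (\<Sum>j<m. b j * u j) + qform {..<m} C u" for y u
    unfolding a_def b_def C_def by (rule qform_Suc) (rule posdef_sym[OF pd])
  have ak: "a \<le> \<kappa>"
    using le[of "case_nat 1 (\<lambda>_. 0)"] unfolding qs sum_case_nat_sq by (simp add: qform_def)
  have Ck: "qform {..<m} C u \<le> \<kappa> * (\<Sum>i<m. (u i)\<^sup>2)" for u
    using le[of "case_nat 0 u"] unfolding qs sum_case_nat_sq by simp
  have f'r: "f' = (\<lambda>j k. C j k + (- 1 / a) * b j * b k)" unfolding f'_def C_def b_def a_def ..
  have f'C: "qform {..<m} f' u = qform {..<m} C u - (\<Sum>j<m. b j * u j)\<^sup>2 / a" for u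
    unfolding f'r qform_rank1 by simp
  have "qform {..<m} f' u \<le> qform {..<m} C u" for u
    unfolding f'C using a by simp
  then have f'k: "qform {..<m} f' u \<le> \<kappa> * (\<Sum>i<m. (u i)\<^sup>2)" for u
    using Ck[of u] order_trans by blast
  have IH: "ln (fdet m f') \<le> (trc m f' - real m) - F' / (5 * \<kappa>)"
    unfolding F'_def by (rule Suc.IH[OF pd' k1 f'k])
  have q0: "q \<ge> 0" unfolding q_def by (rule posdef_nonneg[OF pd'])
  have qC: "q + B\<^sup>2 / a \<le> \<kappa> * B"
    using Ck[of b] unfolding q_def f'C B_def by (simp add: power2_eq_square)
  have B2: "B\<^sup>2 / a \<le> \<kappa> * B" "q \<le> \<kappa> * B" using qC q0 a by (auto intro: order_trans[rotated])
  have tr': "trc m f' = trc m C - B / a"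
    unfolding trc_def f'r B_def by (simp add: sum_subtractf sum_divide_distrib power2_eq_square)
  have tr: "trc (Suc m) f = a + trc m C"
    unfolding trc_def sum.lessThan_Suc_shift a_def C_def by simp
  \<comment> \<open>Here C - I equals f' - I plus the rank-one matrix b b^T / a, and the form of f'
    - I at \<open>b\<close> is q - B.\<close>
  have F: "frob2 m (\<lambda>i j. C i j - kron i j) = F' + (2 / a) * (q - B) + B\<^sup>2 / a\<^sup>2"
  proof -
    have "frob2 m (\<lambda>i j. C i j - kron i j) = (\<Sum>i<m. \<Sum>j<m. ((f' i j - kron i j) + (1 / a) * b i * b j)\<^sup>2)"
      unfolding frob2_def f'r by (intro sum.cong refl) (simp add: algebra_simps)
    also have "\<dots> = F' + 2 * (1 / a) * qform {..<m} (\<lambda>i j. f' i j - kron i j) b + (1 / a)\<^sup>2 * B\<^sup>2"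
      unfolding frob_rank1 F'_def frob2_def B_def ..
    finally show ?thesis unfolding qform_diff qform_kron q_def[symmetric] B_def[symmetric]
      by (simp add: power_divide)
  qed
  have FF: "frob2 (Suc m) (\<lambda>i j. f i j - kron i j) = (a - 1)\<^sup>2 + 2 * B + frob2 m (\<lambda>i j. C i j - kron i j)"
  proof -
    have "frob2 (Suc m) (\<lambda>i j. f i j - kron i j) = (a - 1)\<^sup>2 + (\<Sum>j<m. (b j)\<^sup>2)
      + (\<Sum>i<m. (f (Suc i) 0)\<^sup>2 + (\<Sum>j<m. (C i j - kron i j)\<^sup>2))"
      unfolding frob2_def sum.lessThan_Suc_shift by (simp add: a_def b_def C_def)
    also have "(\<Sum>i<m. (f (Suc i) 0)\<^sup>2 + (\<Sum>j<m. (C i j - kron i j)\<^sup>2))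
      = (\<Sum>i<m. (b i)\<^sup>2) + frob2 m (\<lambda>i j. C i j - kron i j)"
      unfolding sum.distrib frob2_def b_def
      by (intro arg_cong2[of _ _ _ _ "(+)"] sum.cong refl) (simp add: posdef_sym[OF pd])
    finally show ?thesis unfolding B_def by simp
  qed
  \<comment> \<open>Elimination lowers the trace by B / a, which is worth 5 \<kappa> B / a on the
    Frobenius scale. The extra Frobenius mass costs 2 + 2 + 1 multiples of \<kappa> B / a, one for
    each summand.\<close>
  have key: "2 * B + (2 / a) * (q - B) + B\<^sup>2 / a\<^sup>2 \<le> 5 * \<kappa> * B / a"
  proof -
    have "2 * B \<le> 2 * (\<kappa> * B / a)"
      using mult_right_mono[OF ak B0] a by (simp add: field_simps)
    moreover have "(2 / a) * (q - B) \<le> 2 * (\<kappa> * B / a)"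
    proof -
      have "(2 / a) * (q - B) \<le> (2 / a) * (\<kappa> * B)" using B2 B0 a by (intro mult_left_mono) auto
      then show ?thesis by simp
    qed
    moreover have "B\<^sup>2 / a\<^sup>2 \<le> \<kappa> * B / a"
    proof -
      have "(B\<^sup>2 / a) / a \<le> (\<kappa> * B) / a" using B2 a by (intro divide_right_mono) auto
      then show ?thesis by (simp add: power2_eq_square)
    qed
    ultimately have "2 * B + (2 / a) * (q - B) + B\<^sup>2 / a\<^sup>2
        \<le> 2 * (\<kappa> * B / a) + 2 * (\<kappa> * B / a) + \<kappa> * B / a"
      by (intro add_mono)
    also have "\<dots> = 5 * \<kappa> * B / a" by simp
    finally show ?thesis .
  qed
  have k5: "5 * \<kappa> > 0" using k1 by simp
  have "fdet (Suc m) f = a * fdet m f'"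
    unfolding fdet_schur[OF pd] a_def f'_def ..
  then have "ln (fdet (Suc m) f) = ln a + ln (fdet m f')"
    using a fdet_pos[OF pd'] by (simp add: ln_mult_pos)
  also have "\<dots> \<le> ((a - 1) - (a - 1)\<^sup>2 / (5 * \<kappa>)) + ((trc m f' - real m) - F' / (5 * \<kappa>))"
    using ln_le_quadratic[OF a ak k1] IH by simp
  also have "\<dots> = (trc (Suc m) f - real (Suc m)) - ((a - 1)\<^sup>2 + F' + 5 * \<kappa> * B / a) / (5 * \<kappa>)"
    unfolding tr tr' using k5 a by (simp add: field_simps)
  also have "\<dots> \<le> (trc (Suc m) f - real (Suc m)) - frob2 (Suc m) (\<lambda>i j. f i j - kron i j) / (5 * \<kappa>)"
    unfolding FF F using key k5 by (intro diff_left_mono divide_right_mono) auto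
  finally show ?case .
qed

section \<open>Gram matrices and the log-determinant inequality\<close>

definition gram :: "nat \<Rightarrow> (nat \<Rightarrow> nat \<Rightarrow> real) \<Rightarrow> nat \<Rightarrow> nat \<Rightarrow> real" where
  "gram n V p q = (\<Sum>j<n. V p j * V q j)"

lemma gram_sum:
  fixes a b :: "nat \<Rightarrow> real"
  shows "(\<Sum>j<n. (\<Sum>p<m. a p * V p j) * (\<Sum>r<m. b r * V r j))
    = (\<Sum>p<m. \<Sum>r<m. a p * b r * (\<Sum>j<n. V p j * V r j))"
proof -
  have "(\<Sum>j<n. (\<Sum>p<m. a p * V p j) * (\<Sum>r<m. b r * V r j))
    = (\<Sum>j<n. \<Sum>p<m. \<Sum>r<m. a p * b r * (V p j * V r j))"
    by (simp add: sum_product mult_ac)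
  also have "\<dots> = (\<Sum>p<m. \<Sum>j<n. \<Sum>r<m. a p * b r * (V p j * V r j))" by (rule sum.swap)
  also have "\<dots> = (\<Sum>p<m. \<Sum>r<m. \<Sum>j<n. a p * b r * (V p j * V r j))"
    by (rule sum.cong[OF refl]) (rule sum.swap)
  finally show ?thesis by (simp add: sum_distrib_left)
qed

text \<open>The matrix V^T K V, where \<open>V\<close> has \<open>m\<close> rows; correspondingly
  \<open>gram\<close> is V V^T.\<close>

definition conj_by :: "nat \<Rightarrow> (nat \<Rightarrow> nat \<Rightarrow> real) \<Rightarrow> (nat \<Rightarrow> nat \<Rightarrow> real) \<Rightarrow> nat \<Rightarrow> nat \<Rightarrow> real" where
  "conj_by m V K j k = (\<Sum>p<m. \<Sum>q<m. V p j * K p q * V q k)"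

lemma conj_by_diff: "conj_by m V (\<lambda>p q. K p q - L p q) j k = conj_by m V K j k - conj_by m V L j k"
  by (simp add: conj_by_def algebra_simps sum_subtractf)

lemma conj_by_sym:
  assumes "\<And>p q. p < m \<Longrightarrow> q < m \<Longrightarrow> K p q = K q p"
  shows "conj_by m V K j k = conj_by m V K k j"
proof -
  have "conj_by m V K j k = (\<Sum>q<m. \<Sum>p<m. V p j * K p q * V q k)"
    unfolding conj_by_def by (rule sum.swap)
  also have "\<dots> = conj_by m V K k j" unfolding conj_by_def
    by (intro sum.cong refl) (use assms in auto)
  finally show ?thesis .
qed

lemma trc_conj: "trc n (conj_by m V K) = (\<Sum>p<m. \<Sum>q<m. K p q * gram n V p q)"
proof -
  have "trc n (conj_by m V K) = (\<Sum>p<m. \<Sum>j<n. \<Sum>q<m. V p j * K p q * V q j)"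
    unfolding trc_def conj_by_def by (rule sum.swap)
  also have "\<dots> = (\<Sum>p<m. \<Sum>q<m. \<Sum>j<n. V p j * K p q * V q j)"
    by (rule sum.cong[OF refl]) (rule sum.swap)
  finally show ?thesis by (simp add: gram_def sum_distrib_left mult_ac)
qed

text \<open>The right-hand side sees \<open>V\<close> only through its Gram matrix, as does the one
  of \<open>trc_conj\<close>. This permits replacing a wide \<open>V\<close> by a square factor with
  the same Gram matrix.\<close>

lemma frob2_conj:
  "frob2 n (conj_by m V K) = (\<Sum>p<m. \<Sum>r<m. gram n V p r *
     (\<Sum>q<m. \<Sum>s<m. K p q * K r s * gram n V q s))"
proof -
  define W where "W = (\<lambda>p k. \<Sum>q<m. K p q * V q k)"
  have "conj_by m V K j k = (\<Sum>p<m. W p k * V p j)" for j k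
    unfolding conj_by_def W_def by (simp add: sum_distrib_left sum_distrib_right mult_ac)
  then have "frob2 n (conj_by m V K) = (\<Sum>j<n. \<Sum>k<n. (\<Sum>p<m. W p k * V p j) * (\<Sum>r<m. W r k * V r j))"
    by (simp add: frob2_def power2_eq_square)
  also have "\<dots> = (\<Sum>k<n. \<Sum>j<n. (\<Sum>p<m. W p k * V p j) * (\<Sum>r<m. W r k * V r j))"
    by (rule sum.swap)
  also have "\<dots> = (\<Sum>k<n. \<Sum>p<m. \<Sum>r<m. W p k * W r k * (\<Sum>j<n. V p j * V r j))"
    unfolding gram_sum ..
  also have "\<dots> = (\<Sum>p<m. \<Sum>k<n. \<Sum>r<m. W p k * W r k * (\<Sum>j<n. V p j * V r j))" by (rule sum.swap)
  also have "\<dots> = (\<Sum>p<m. \<Sum>r<m. \<Sum>k<n. W p k * W r k * (\<Sum>j<n. V p j * V r j))"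
    by (rule sum.cong[OF refl]) (rule sum.swap)
  also have "\<dots> = (\<Sum>p<m. \<Sum>r<m. gram n V p r * (\<Sum>k<n. W p k * W r k))"
    by (simp add: gram_def sum_distrib_left mult_ac)
  also have "\<dots> = (\<Sum>p<m. \<Sum>r<m. gram n V p r * (\<Sum>q<m. \<Sum>s<m. K p q * K r s * gram n V q s))"
    unfolding W_def gram_sum gram_def ..
  finally show ?thesis .
qed

lemma qform_conj: "qform {..<n} (conj_by m V K) u = qform {..<m} K (\<lambda>p. \<Sum>j<n. V p j * u j)"
proof -
  have "qform {..<n} (conj_by m V K) u = (\<Sum>j<n. \<Sum>k<n. \<Sum>p<m. \<Sum>q<m. K p q * (V p j * u j) * (V q k * u k))"
    unfolding qform_def conj_by_def by (simp add: sum_distrib_left sum_distrib_right mult_ac)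
  also have "\<dots> = (\<Sum>j<n. \<Sum>p<m. \<Sum>k<n. \<Sum>q<m. K p q * (V p j * u j) * (V q k * u k))"
    by (rule sum.cong[OF refl]) (rule sum.swap)
  also have "\<dots> = (\<Sum>p<m. \<Sum>j<n. \<Sum>k<n. \<Sum>q<m. K p q * (V p j * u j) * (V q k * u k))"
    by (rule sum.swap)
  also have "\<dots> = (\<Sum>p<m. \<Sum>j<n. \<Sum>q<m. \<Sum>k<n. K p q * (V p j * u j) * (V q k * u k))"
    by (rule sum.cong[OF refl], rule sum.cong[OF refl]) (rule sum.swap)
  also have "\<dots> = (\<Sum>p<m. \<Sum>q<m. \<Sum>j<n. \<Sum>k<n. K p q * (V p j * u j) * (V q k * u k))"
    by (rule sum.cong[OF refl]) (rule sum.swap)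
  also have "\<dots> = qform {..<m} K (\<lambda>p. \<Sum>j<n. V p j * u j)"
    unfolding qform_def
    by (intro sum.cong refl) (simp add: sum_product sum_distrib_left mult_ac)
  finally show ?thesis .
qed

lemma sum_mult_transpose:
  fixes z :: "nat \<Rightarrow> real"
  shows "(\<Sum>p<m. (\<Sum>j<n. V p j * u j) * z p) = (\<Sum>j<n. u j * (\<Sum>p<m. z p * V p j))"
proof -
  have "(\<Sum>p<m. (\<Sum>j<n. V p j * u j) * z p) = (\<Sum>p<m. \<Sum>j<n. u j * (z p * V p j))"
    by (simp add: sum_distrib_right sum_distrib_left mult_ac)
  also have "\<dots> = (\<Sum>j<n. \<Sum>p<m. u j * (z p * V p j))" by (rule sum.swap)
  finally show ?thesis by (simp add: sum_distrib_left)
qed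

lemma gram_sym: "gram n V p q = gram n V q p"
  by (simp add: gram_def mult.commute)

lemma qform_gram: "qform {..<m} (gram n V) u = (\<Sum>j<n. (\<Sum>p<m. u p * V p j)\<^sup>2)"
  unfolding power2_eq_square gram_sum qform_def gram_def by (simp add: mult_ac)

section \<open>Inverse Gram matrices and preimages of minimal norm\<close>

text \<open>A relation instead of an inverse operation keeps determinants out of the algebra.
  Symmetry of \<open>B\<close> is bundled in because every matrix inverted here is a Gram
  matrix.\<close>

definition inverse_fun :: "nat \<Rightarrow> (nat \<Rightarrow> nat \<Rightarrow> real) \<Rightarrow> (nat \<Rightarrow> nat \<Rightarrow> real) \<Rightarrow> bool" where
  "inverse_fun m G B \<longleftrightarrow> (\<forall>p<m. \<forall>r<m. (\<Sum>q<m. G p q * B q r) = kron p r) \<and>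
     (\<forall>p<m. \<forall>r<m. (\<Sum>q<m. B p q * G q r) = kron p r) \<and> (\<forall>p<m. \<forall>q<m. B p q = B q p)"

lemma inverse_funD:
  assumes "inverse_fun m G B" "p < m" "r < m"
  shows "(\<Sum>q<m. G p q * B q r) = kron p r" "(\<Sum>q<m. B p q * G q r) = kron p r" "B p r = B r p"
  using assms by (auto simp: inverse_fun_def)

lemma inverse_solve:
  assumes "inverse_fun m G B" "p < m"
  shows "(\<Sum>q<m. G p q * (\<Sum>r<m. B q r * y r)) = y p"
proof -
  have "(\<Sum>q<m. G p q * (\<Sum>r<m. B q r * y r)) = (\<Sum>q<m. \<Sum>r<m. G p q * B q r * y r)"
    by (simp add: sum_distrib_left mult_ac)
  also have "\<dots> = (\<Sum>r<m. (\<Sum>q<m. G p q * B q r) * y r)"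
    by (subst sum.swap) (simp add: sum_distrib_right)
  also have "\<dots> = (\<Sum>r<m. if r = p then y r else 0)"
    by (intro sum.cong refl) (simp add: inverse_funD[OF assms])
  finally show ?thesis using assms by simp
qed

lemma qform_dot: "qform {..<m} G u = (\<Sum>p<m. u p * (\<Sum>q<m. G p q * u q))"
  by (simp add: qform_def sum_distrib_left mult_ac)

lemma qform_inverse:
  assumes "inverse_fun m G B"
  shows "qform {..<m} B y = qform {..<m} G (\<lambda>q. \<Sum>r<m. B q r * y r)"
proof -
  have "qform {..<m} G (\<lambda>q. \<Sum>r<m. B q r * y r) = (\<Sum>p<m. (\<Sum>r<m. B p r * y r) * y p)"
    unfolding qform_dot[of m G] by (intro sum.cong refl) (simp add: inverse_solve[OF assms])
  then show ?thesis unfolding qform_dot[of m B] by (simp add: mult.commute)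
qed

text \<open>The form of (V V^T)^(-1) at y is the least squared norm of a preimage of y under
  \<open>V\<close>. The preimage v = V^T B y attains it, and every other preimage u has the same
  inner product with v as v itself, so |u - v|^2 \<ge> 0 suffices.\<close>

lemma qform_inverse_gram_le:
  assumes inv: "inverse_fun m (gram n V) B"
    and y: "\<And>p. p < m \<Longrightarrow> y p = (\<Sum>j<n. V p j * u j)"
  shows "qform {..<m} B y \<le> (\<Sum>j<n. (u j)\<^sup>2)"
proof -
  define z where "z = (\<lambda>q. \<Sum>r<m. B q r * y r)"
  define v where "v = (\<lambda>j. \<Sum>p<m. z p * V p j)"
  have vv: "qform {..<m} B y = (\<Sum>j<n. (v j)\<^sup>2)"
    unfolding qform_inverse[OF inv] z_def[symmetric] qform_gram v_def ..
  have "qform {..<m} B y = (\<Sum>p<m. y p * z p)" unfolding qform_dot z_def ..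
  also have "\<dots> = (\<Sum>p<m. (\<Sum>j<n. V p j * u j) * z p)" by (simp add: y)
  also have "\<dots> = (\<Sum>j<n. u j * v j)" unfolding v_def by (rule sum_mult_transpose)
  finally have uv: "qform {..<m} B y = (\<Sum>j<n. u j * v j)" .
  have "0 \<le> (\<Sum>j<n. (u j - v j)\<^sup>2)" by (intro sum_nonneg) auto
  also have "\<dots> = (\<Sum>j<n. (u j)\<^sup>2) - 2 * (\<Sum>j<n. u j * v j) + (\<Sum>j<n. (v j)\<^sup>2)"
    by (simp add: power2_diff sum.distrib sum_subtractf sum_distrib_left mult_ac)
  finally show ?thesis using uv vv by linarith
qed

lemma qform_inverse_nonneg:
  assumes "inverse_fun m (gram n V) B" shows "0 \<le> qform {..<m} B y"
  unfolding qform_inverse[OF assms] qform_gram by (intro sum_nonneg) auto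

text \<open>The preimage of minimal norm, V^T B y, for which the preceding inequality is an
  equality.\<close>

lemma inverse_conj_solve:
  assumes inv: "inverse_fun m (gram n V) B"
  obtains v where "\<And>p. p < m \<Longrightarrow> y p = (\<Sum>j<n. V p j * v j)" "(\<Sum>j<n. (v j)\<^sup>2) = qform {..<m} B y"
proof
  define z where "z = (\<lambda>q. \<Sum>r<m. B q r * y r)"
  define v where "v = (\<lambda>j. \<Sum>p<m. z p * V p j)"
  show "(\<Sum>j<n. (\<Sum>p<m. z p * V p j)\<^sup>2) = qform {..<m} B y"
    unfolding qform_inverse[OF inv] z_def[symmetric] qform_gram v_def ..
  fix p assume p: "p < m"
  have "(\<Sum>j<n. V p j * (\<Sum>q<m. z q * V q j)) = (\<Sum>j<n. \<Sum>q<m. (V p j * V q j) * z q)"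
    by (simp add: sum_distrib_left mult_ac)
  also have "\<dots> = (\<Sum>q<m. gram n V p q * z q)"
    by (subst sum.swap) (simp add: gram_def sum_distrib_right)
  also have "\<dots> = y p" unfolding z_def by (rule inverse_solve[OF inv p])
  finally show "y p = (\<Sum>j<n. V p j * (\<Sum>q<m. z q * V q j))" by simp
qed

abbreviation tomat :: "nat \<Rightarrow> (nat \<Rightarrow> nat \<Rightarrow> real) \<Rightarrow> real mat" where
  "tomat m f \<equiv> Matrix.mat m m (\<lambda>(i, j). f i j)"

lemma tomat_mult: "tomat m f * tomat m g = tomat m (\<lambda>i k. \<Sum>j<m. f i j * g j k)"
  by (rule eq_matI) (auto simp: scalar_prod_def atLeast0LessThan intro!: sum.cong)

lemma fdet_mult: "fdet m (\<lambda>i k. \<Sum>j<m. f i j * g j k) = fdet m f * fdet m g"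
  unfolding fdet_def tomat_mult[symmetric] by (rule det_mult) auto

lemma fdet_transpose: "fdet m (\<lambda>i j. f j i) = fdet m f"
proof -
  have "tomat m (\<lambda>i j. f j i) = transpose_mat (tomat m f)" by (rule eq_matI) auto
  then show ?thesis unfolding fdet_def using det_transpose[of "tomat m f" m] by simp
qed

lemma tomat_kron: "tomat m kron = 1\<^sub>m m"
  by (rule eq_matI) auto

lemma fdet_kron: "fdet m kron = 1"
  unfolding fdet_def tomat_kron by simp

lemma left_inverse_fun:
  assumes "\<And>i j. i < m \<Longrightarrow> j < m \<Longrightarrow> (\<Sum>k<m. f i k * g k j) = kron i j" "i < m" "j < m"
  shows "(\<Sum>k<m. g i k * f k j) = kron i j"
proof -
  have "tomat m f * tomat m g = 1\<^sub>m m"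
    unfolding tomat_mult tomat_kron[symmetric] using assms(1) by (intro eq_matI) auto
  then have "tomat m g * tomat m f = 1\<^sub>m m"
    by (rule mat_mult_left_right_inverse[of _ m, rotated 2]) auto
  then have "(tomat m g * tomat m f) $$ (i, j) = kron i j" using assms by simp
  then show ?thesis unfolding tomat_mult using assms by simp
qed

lemma conj_by_alt: "conj_by m R K k l = (\<Sum>p<m. R p k * (\<Sum>q<m. K p q * R q l))"
  by (simp add: conj_by_def sum_distrib_left mult_ac)

text \<open>A Cholesky factor of the Gram matrix of V reduces this to \<open>ln_fdet_le\<close> for the symmetric matrix \<open>R^T B R\<close>.\<close>
lemma ln_fdet_ratio_le:
  fixes V U :: "nat \<Rightarrow> nat \<Rightarrow> real"
  assumes B: "inverse_fun m (gram n U) B" and C: "inverse_fun m (gram n V) C"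
    and pdU: "posdef m (gram n U)" and pdV: "posdef m (gram n V)"
    and k: "1 \<le> \<kappa>" and le: "\<And>u. qform {..<m} (gram n V) u \<le> \<kappa> * qform {..<m} (gram n U) u"
  defines "N \<equiv> conj_by m V (\<lambda>p q. B p q - C p q)"
  shows "ln (fdet m (gram n V)) - ln (fdet m (gram n U)) \<le> trc n N - frob2 n N / (5 * \<kappa>)"
proof -
  obtain R where R: "\<And>i j. i < m \<Longrightarrow> j < m \<Longrightarrow> gram n V i j = (\<Sum>k<m. R i k * R j k)"
    using cholesky[OF pdV] by blast
  have RV: "gram m R p q = gram n V p q" if "p < m" "q < m" for p q
    using R[OF that] by (simp add: gram_def)
  define T where "T = conj_by m R B"
  define Li where "Li = (\<lambda>k q. \<Sum>p<m. R p k * C p q)"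
  have LR: "(\<Sum>q<m. Li k q * R q l) = kron k l" if "k < m" "l < m" for k l
  proof (rule left_inverse_fun[OF _ that])
    fix i j assume ij: "i < m" "j < m"
    have "(\<Sum>k<m. R i k * Li k j) = (\<Sum>p<m. (\<Sum>k<m. R i k * R p k) * C p j)"
      unfolding Li_def sum_distrib_left sum_distrib_right mult.assoc[symmetric] by (rule sum.swap)
    also have "\<dots> = (\<Sum>p<m. gram n V i p * C p j)" using ij by (intro sum.cong refl) (simp add: R)
    also have "\<dots> = kron i j" by (rule inverse_funD(1)[OF C ij])
    finally show "(\<Sum>k<m. R i k * Li k j) = kron i j" .
  qed
  \<comment> \<open>Since \<open>C\<close> inverts R R^T and \<open>R\<close> is square, R^T C R is
    the identity. Subtracting the identity from \<open>T\<close> therefore yields R^T (B - C) R,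
    whose trace and Frobenius norm agree with those of \<open>N\<close>.\<close>
  have CT: "conj_by m R C k l = kron k l" if "k < m" "l < m" for k l
  proof -
    have "conj_by m R C k l = (\<Sum>q<m. \<Sum>p<m. R p k * C p q * R q l)"
      unfolding conj_by_def by (rule sum.swap)
    also have "\<dots> = (\<Sum>q<m. Li k q * R q l)" unfolding Li_def by (simp add: sum_distrib_right)
    finally show ?thesis using LR[OF that] by simp
  qed
  have Tsym: "T i j = T j i" for i j unfolding T_def
    by (rule conj_by_sym) (rule inverse_funD(3)[OF B])
  have Rinj: "\<exists>p<m. (\<Sum>j<m. R p j * u j) \<noteq> 0" if "i < m" "u i \<noteq> 0" for u i
  proof (rule ccontr)
    assume "\<not> ?thesis"
    then have z: "\<And>p. p < m \<Longrightarrow> (\<Sum>j<m. R p j * u j) = 0" by blast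
    have "u i = (\<Sum>l<m. kron i l * u l)" using that by (simp add: if_distrib[of "\<lambda>x. x * _"] cong: if_cong)
    also have "\<dots> = (\<Sum>l<m. (\<Sum>q<m. Li i q * R q l) * u l)" using that by (intro sum.cong refl) (simp add: LR)
    also have "\<dots> = (\<Sum>q<m. Li i q * (\<Sum>l<m. R q l * u l))"
      unfolding sum_distrib_right sum_distrib_left mult.assoc by (rule sum.swap)
    also have "\<dots> = 0" by (simp add: z)
    finally show False using that by simp
  qed
  have Bpos: "0 < qform {..<m} B y" if "i < m" "y i \<noteq> 0" for y i
  proof -
    define z where "z = (\<lambda>q. \<Sum>r<m. B q r * y r)"
    have "\<exists>q<m. z q \<noteq> 0"
    proof (rule ccontr)
      assume "\<not> ?thesis"
      then have "y i = 0" using inverse_solve[OF B that(1), of y] unfolding z_def by simp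
      then show False using that by simp
    qed
    then show ?thesis unfolding qform_inverse[OF B] z_def[symmetric] using posdef_pos[OF pdU] by blast
  qed
  have pdT: "posdef m T"
    unfolding posdef_def
  proof (intro conjI allI impI)
    fix u :: "nat \<Rightarrow> real" assume "\<exists>i<m. u i \<noteq> 0"
    then obtain i where i: "i < m" "u i \<noteq> 0" by blast
    obtain p where "p < m" "(\<Sum>j<m. R p j * u j) \<noteq> 0" using Rinj[of i u] i by blast
    then show "0 < qform {..<m} T u" unfolding T_def qform_conj by (rule Bpos)
  qed (rule Tsym)
  have Tk: "qform {..<m} T u \<le> \<kappa> * (\<Sum>i<m. (u i)\<^sup>2)" for u
  proof -
    define y where "y = (\<lambda>p. \<Sum>j<m. R p j * u j)"
    define z where "z = (\<lambda>q. \<Sum>r<m. B q r * y r)"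
    define v where "v = (\<lambda>j. \<Sum>p<m. z p * R p j)"
    define q where "q = qform {..<m} B y"
    have Tq: "qform {..<m} T u = q" unfolding T_def qform_conj y_def q_def ..
    have q0: "q = qform {..<m} (gram n U) z" unfolding q_def qform_inverse[OF B] z_def ..
    have "q = (\<Sum>p<m. y p * z p)" unfolding q_def qform_dot z_def ..
    also have "\<dots> = (\<Sum>j<m. u j * v j)" unfolding v_def y_def by (rule sum_mult_transpose)
    finally have quv: "q = (\<Sum>j<m. u j * v j)" .
    have vv: "(\<Sum>j<m. (v j)\<^sup>2) \<le> \<kappa> * q"
    proof -
      have "(\<Sum>j<m. (v j)\<^sup>2) = qform {..<m} (gram m R) z" unfolding v_def qform_gram ..
      also have "\<dots> = qform {..<m} (gram n V) z" unfolding qform_def by (intro sum.cong refl) (simp add: RV)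
      also have "\<dots> \<le> \<kappa> * qform {..<m} (gram n U) z" by (rule le)
      finally show ?thesis using q0 by simp
    qed
    \<comment> \<open>With q = <u, v> and |v|^2 \<le> \<kappa> q, this square inverts the order
      relation between the Gram matrices and gives q \<le> \<kappa> |u|^2.\<close>
    have "0 \<le> (\<Sum>j<m. (\<kappa> * u j - v j)\<^sup>2)" by (intro sum_nonneg) auto
    also have "\<dots> = \<kappa>\<^sup>2 * (\<Sum>j<m. (u j)\<^sup>2) - 2 * \<kappa> * (\<Sum>j<m. u j * v j) + (\<Sum>j<m. (v j)\<^sup>2)"
      by (simp add: power2_diff power_mult_distrib sum.distrib sum_subtractf sum_distrib_left mult_ac)
    also have "\<dots> \<le> \<kappa>\<^sup>2 * (\<Sum>j<m. (u j)\<^sup>2) - \<kappa> * q" using vv quv by simp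
    finally have "\<kappa> * q \<le> \<kappa> * (\<kappa> * (\<Sum>j<m. (u j)\<^sup>2))" by (simp add: power2_eq_square)
    then show ?thesis using k Tq by simp
  qed
  have dtV: "fdet m (gram n V) = fdet m R * fdet m R"
  proof -
    have "fdet m (gram n V) = fdet m (\<lambda>i j. \<Sum>k<m. R i k * (\<lambda>a b. R b a) k j)"
      by (intro fdet_cong) (simp add: R)
    then show ?thesis unfolding fdet_mult fdet_transpose[of m R] .
  qed
  have dtB: "fdet m B * fdet m (gram n U) = 1"
  proof -
    have "fdet m B * fdet m (gram n U) = fdet m kron"
      unfolding fdet_mult[symmetric] by (intro fdet_cong) (rule inverse_funD(2)[OF B])
    then show ?thesis by (simp add: fdet_kron)
  qed
  have dtT: "fdet m T = fdet m R * (fdet m B * fdet m R)"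
  proof -
    have "fdet m T = fdet m (\<lambda>k l. \<Sum>p<m. (\<lambda>a b. R b a) k p * (\<lambda>p l. \<Sum>q<m. B p q * R q l) p l)"
      unfolding T_def conj_by_alt ..
    then show ?thesis unfolding fdet_mult fdet_transpose[of m R] .
  qed
  have pU: "fdet m (gram n U) > 0" by (rule fdet_pos[OF pdU])
  have pV: "fdet m (gram n V) > 0" by (rule fdet_pos[OF pdV])
  have "fdet m T * fdet m (gram n U) = fdet m R * fdet m R * (fdet m B * fdet m (gram n U))"
    unfolding dtT by (simp only: mult_ac)
  also have "\<dots> = fdet m (gram n V)" unfolding dtB dtV by simp
  finally have TU: "fdet m (gram n V) = fdet m T * fdet m (gram n U)" by (rule sym)
  have "ln (fdet m (gram n V)) = ln (fdet m T) + ln (fdet m (gram n U))"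
    unfolding TU by (rule ln_mult_pos[OF fdet_pos[OF pdT] pU])
  then have "ln (fdet m (gram n V)) - ln (fdet m (gram n U)) = ln (fdet m T)" by simp
  also have "\<dots> \<le> (trc m T - real m) - frob2 m (\<lambda>i j. T i j - kron i j) / (5 * \<kappa>)"
    by (rule ln_fdet_le[OF pdT k Tk])
  also have "trc m T - real m = trc m (conj_by m R (\<lambda>p q. B p q - C p q))"
    unfolding trc_def by (simp add: conj_by_diff CT T_def sum_subtractf)
  also have "\<dots> = trc n N"
    unfolding N_def trc_conj by (intro sum.cong refl) (simp add: RV)
  also have "frob2 m (\<lambda>i j. T i j - kron i j) = frob2 m (conj_by m R (\<lambda>p q. B p q - C p q))"
    unfolding frob2_def by (simp add: conj_by_diff CT T_def)
  also have "\<dots> = frob2 n N"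
    unfolding N_def frob2_conj
    by (intro sum.cong refl arg_cong2[of _ _ _ _ "(*)"]) (simp_all add: RV)
  finally show ?thesis .
qed

section \<open>Measurability, invertibility and independent blocks of rows\<close>

lemma fdet_expand: "fdet m f = (\<Sum>p\<in>{p. p permutes {0..<m}}. signof p * (\<Prod>i=0..<m. f i (p i)))"
proof -
  have "fdet m f = (\<Sum>p\<in>{p. p permutes {0..<m}}. signof p * (\<Prod>i=0..<m. tomat m f $$ (i, p i)))"
    unfolding fdet_def by (rule det_def') simp
  also have "\<dots> = (\<Sum>p\<in>{p. p permutes {0..<m}}. signof p * (\<Prod>i=0..<m. f i (p i)))"
  proof (intro sum.cong refl arg_cong2[of _ _ _ _ "(*)"] prod.cong)
    fix p i assume p: "p \<in> {p. p permutes {0..<m}}" and i: "i \<in> {0..<m}"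
    then have "p i \<in> {0..<m}" using permutes_in_image[of p "{0..<m}" i] by simp
    then show "tomat m f $$ (i, p i) = f i (p i)" using i by simp
  qed
  finally show ?thesis .
qed

lemma measurable_fdet:
  assumes "\<And>i j. i < m \<Longrightarrow> j < m \<Longrightarrow> (\<lambda>x. f x i j) \<in> borel_measurable M"
  shows "(\<lambda>x. fdet m (f x)) \<in> borel_measurable M"
  unfolding fdet_expand
proof (intro borel_measurable_sum borel_measurable_times borel_measurable_const borel_measurable_prod)
  fix p i assume "p \<in> {p. p permutes {0..<m}}" "i \<in> {0..<m}"
  then have "p i \<in> {0..<m}" "i < m" using permutes_in_image[of p "{0..<m}" i] by auto
  then show "(\<lambda>x. f x i (p i)) \<in> borel_measurable M" using assms by simp
qed

definition inv_fun :: "nat \<Rightarrow> (nat \<Rightarrow> nat \<Rightarrow> real) \<Rightarrow> nat \<Rightarrow> nat \<Rightarrow> real" where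
  "inv_fun m f p q = minv (tomat m f) $$ (p, q)"

text \<open>The inverse in the likelihood is computed by Gauss-Jordan elimination, whose case
  distinctions hide measurability. The adjugate makes the entries rational in those of the matrix,
  and the zero default covers the singular case.\<close>

lemma minv_adj:
  assumes A: "A \<in> carrier_mat m m"
  shows "minv A = (if Determinant.det A = 0 then 0\<^sub>m m m else (1 / Determinant.det A) \<cdot>\<^sub>m adj_mat A)"
proof (cases "mat_inverse A")
  case None
  then have "Determinant.det A = 0"
    using mat_inverse(1)[OF A, where b="()"] det_non_zero_imp_unit[OF A, where b="()"] by blast
  then show ?thesis using None A by (simp add: minv_def)
next
  case (Some B)
  from mat_inverse(2)[OF A Some] have B: "A * B = 1\<^sub>m m" "B * A = 1\<^sub>m m" "B \<in> carrier_mat m m" by auto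
  have "Determinant.det A * Determinant.det B = 1"
    using det_mult[OF A B(3)] B(1) by simp
  then have d: "Determinant.det A \<noteq> 0" by auto
  have "adj_mat A = adj_mat A * (A * B)" unfolding B(1) using adj_mat(1)[OF A] by simp
  also have "\<dots> = (adj_mat A * A) * B" using adj_mat(1)[OF A] A B(3) by (simp add: assoc_mult_mat)
  also have "\<dots> = Determinant.det A \<cdot>\<^sub>m B" unfolding adj_mat(3)[OF A]
    by (simp only: mult_smult_assoc_mat[OF one_carrier_mat B(3)] left_mult_one_mat[OF B(3)])
  finally have "(1 / Determinant.det A) \<cdot>\<^sub>m adj_mat A = B" using d B(3) by (intro eq_matI) auto
  then show ?thesis using Some d by (simp add: minv_def)
qed

lemma cofactor_tomat:
  "cofactor (tomat m f) q p = (-1)^(q + p) *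
     fdet (m - 1) (\<lambda>i j. if i + 1 \<ge> m \<or> j + 1 \<ge> m then 0 else f (if i < q then i else Suc i) (if j < p then j else Suc j))"
proof -
  have "mat_delete (tomat m f) q p = tomat (m - 1) (\<lambda>i j. if i + 1 \<ge> m \<or> j + 1 \<ge> m then 0 else f (if i < q then i else Suc i) (if j < p then j else Suc j))"
    by (rule eq_matI) (auto simp: mat_delete_def)
  then show ?thesis by (simp add: cofactor_def fdet_def)
qed

lemma inv_fun_eq:
  assumes "p < m" "q < m"
  shows "inv_fun m f p q = (if fdet m f = 0 then 0 else cofactor (tomat m f) q p / fdet m f)"
  unfolding inv_fun_def minv_adj[of "tomat m f" m, simplified] fdet_def[symmetric]
  using assms by (simp add: adj_mat_def)

lemma measurable_inv_fun:
  assumes f: "\<And>i j. i < m \<Longrightarrow> j < m \<Longrightarrow> (\<lambda>x. f x i j) \<in> borel_measurable M" and "p < m" "q < m"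
  shows "(\<lambda>x. inv_fun m (f x) p q) \<in> borel_measurable M"
proof -
  have [measurable]: "(\<lambda>x. fdet m (f x)) \<in> borel_measurable M" by (rule measurable_fdet[OF f])
  have [measurable]: "(\<lambda>x. cofactor (tomat m (f x)) q p) \<in> borel_measurable M"
    unfolding cofactor_tomat
    by (intro borel_measurable_times borel_measurable_const measurable_fdet)
       (auto intro!: f simp: less_diff_conv)
  show ?thesis unfolding inv_fun_eq[OF assms(2,3)] by measurable
qed

lemma inv_fun_right:
  assumes d: "fdet m f \<noteq> 0" and pr: "p < m" "r < m"
  shows "(\<Sum>q<m. f p q * inv_fun m f q r) = kron p r"
proof -
  have c: "tomat m f \<in> carrier_mat m m" by simp
  have "minv (tomat m f) = (1 / fdet m f) \<cdot>\<^sub>m adj_mat (tomat m f)"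
    using minv_adj[OF c] d unfolding fdet_def by simp
  then have "tomat m f * minv (tomat m f) = (1 / fdet m f) \<cdot>\<^sub>m (tomat m f * adj_mat (tomat m f))"
    by (simp add: mult_smult_distrib[OF c adj_mat(1)[OF c]])
  also have "\<dots> = 1\<^sub>m m" unfolding adj_mat(2)[OF c] fdet_def[symmetric] using d by (intro eq_matI) auto
  finally have e: "tomat m f * minv (tomat m f) = 1\<^sub>m m" .
  have m: "minv (tomat m f) \<in> carrier_mat m m" unfolding minv_adj[OF c] using adj_mat(1)[OF c] by simp
  have "(tomat m f * minv (tomat m f)) $$ (p, r) = (\<Sum>q<m. f p q * inv_fun m f q r)"
    using pr m by (auto simp: scalar_prod_def inv_fun_def atLeast0LessThan intro!: sum.cong)
  then show ?thesis unfolding e using pr by simp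
qed

lemma inverse_fun_inv_fun:
  assumes d: "fdet m f \<noteq> 0" and sym: "\<And>p q. p < m \<Longrightarrow> q < m \<Longrightarrow> f p q = f q p"
  shows "inverse_fun m f (inv_fun m f)"
proof -
  define B where "B = inv_fun m f"
  have r: "(\<Sum>q<m. f p q * B q r) = kron p r" if "p < m" "r < m" for p r
    unfolding B_def by (rule inv_fun_right[OF d that])
  have l: "(\<Sum>q<m. B p q * f q r) = kron p r" if "p < m" "r < m" for p r
    by (rule left_inverse_fun[OF r that])
  have "B p s = B s p" if "p < m" "s < m" for p s
  proof -
    have "B s p = (\<Sum>r<m. kron p r * B s r)" using that by (simp add: if_distrib[of "\<lambda>x. x * _"] cong: if_cong)
    also have "\<dots> = (\<Sum>r<m. (\<Sum>q<m. B p q * f q r) * B s r)" using that by (intro sum.cong refl) (simp add: l)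
    also have "\<dots> = (\<Sum>q<m. B p q * (\<Sum>r<m. f q r * B s r))"
      unfolding sum_distrib_left sum_distrib_right mult.assoc by (rule sum.swap)
    also have "\<dots> = (\<Sum>q<m. B p q * (\<Sum>r<m. B s r * f r q))"
    proof (rule sum.cong[OF refl])
      fix q assume "q \<in> {..<m}"
      then have "(\<Sum>r<m. f q r * B s r) = (\<Sum>r<m. B s r * f r q)"
        by (intro sum.cong refl) (use sym in auto)
      then show "B p q * (\<Sum>r<m. f q r * B s r) = B p q * (\<Sum>r<m. B s r * f r q)" by simp
    qed
    also have "\<dots> = (\<Sum>q<m. B p q * kron s q)" using that by (intro sum.cong refl) (simp add: l)
    also have "\<dots> = B p s" using that by (simp add: if_distrib[of "\<lambda>x. _ * x"] cong: if_cong)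
    finally show ?thesis by simp
  qed
  then show ?thesis using r l unfolding inverse_fun_def B_def by simp
qed

section \<open>Almost sure full rank\<close>

text \<open>In the expansion along the last row no cofactor contains the corner entry, and the
  cofactor of the corner is the leading minor.\<close>

lemma fdet_Suc_affine:
  "\<exists>r. \<forall>y. fdet (Suc s) (\<lambda>i j. if i = s \<and> j = s then y else f i j) = y * fdet s f + r"
proof -
  define g where "g = (\<lambda>y i j. if i = s \<and> j = s then y else f i j)"
  define r where "r = (\<Sum>j<s. f s j * cofactor (tomat (Suc s) f) s j)"
  have "fdet (Suc s) (g y) = y * fdet s f + r" for y
  proof -
    have c: "cofactor (tomat (Suc s) (g y)) s j = cofactor (tomat (Suc s) f) s j" if "j < Suc s" for j
    proof -
      have "mat_delete (tomat (Suc s) (g y)) s j = mat_delete (tomat (Suc s) f) s j"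
        by (rule eq_matI) (auto simp: mat_delete_def g_def)
      then show ?thesis by (simp add: cofactor_def)
    qed
    have cs: "cofactor (tomat (Suc s) f) s s = fdet s f"
    proof -
      have "mat_delete (tomat (Suc s) f) s s = tomat s f"
        by (rule eq_matI) (auto simp: mat_delete_def)
      then show ?thesis by (simp add: cofactor_def fdet_def)
    qed
    have "fdet (Suc s) (g y) = (\<Sum>j<Suc s. tomat (Suc s) (g y) $$ (s, j) * cofactor (tomat (Suc s) (g y)) s j)"
      unfolding fdet_def by (rule laplace_expansion_row) auto
    also have "\<dots> = (\<Sum>j<Suc s. g y s j * cofactor (tomat (Suc s) f) s j)"
      by (intro sum.cong refl) (simp add: c)
    also have "\<dots> = (\<Sum>j<s. g y s j * cofactor (tomat (Suc s) f) s j) + y * fdet s f"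
      by (simp add: cs) (simp add: g_def)
    also have "(\<Sum>j<s. g y s j * cofactor (tomat (Suc s) f) s j) = r"
      unfolding r_def by (intro sum.cong refl) (simp add: g_def)
    finally show ?thesis by simp
  qed
  then show ?thesis unfolding g_def by blast
qed

lemma gaussian_singleton: "emeasure (gaussian s) {y} = 0"
proof -
  have "{y} \<in> null_sets lborel" by (intro finite_imp_null_set_lborel) simp
  then have "AE x in lborel. x \<noteq> y" using AE_not_in by force
  then have "(\<integral>\<^sup>+x. ennreal (normal_density 0 s x) * indicator {y} x \<partial>lborel) = 0"
    by (subst nn_integral_0_iff_AE) (auto elim!: eventually_mono)
  then show ?thesis by (simp add: emeasure_density)
qed

text \<open>Fubini in the corner entry: once the smaller minor is nonzero, the determinant is a
  nonconstant affine function of that entry and vanishes at a single point, a null set. The index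
  set need only contain the square, so the induction hypothesis applies to it with the corner
  removed.\<close>

lemma AE_minor_nonzero:
  assumes s: "s > 0"
  shows "finite I \<Longrightarrow> {..<k} \<times> {..<k} \<subseteq> I \<Longrightarrow> AE a in PiM I (\<lambda>_. gaussian s). fdet k (\<lambda>i j. a (i, j)) \<noteq> 0"
proof (induction k arbitrary: I)
  case 0
  then show ?case by simp
next
  case (Suc k)
  interpret P: prob_space "gaussian s" by (rule prob_space_normal_density[OF s])
  interpret PP: product_sigma_finite "\<lambda>_. gaussian s" by standard
  define I' where "I' = I - {(k, k)}"
  have I: "I = insert (k, k) I'" "(k, k) \<notin> I'" "finite I'" "{..<k} \<times> {..<k} \<subseteq> I'"
    using Suc.prems by (auto simp: I'_def lessThan_Suc)
  have sub: "{..<Suc k} \<times> {..<Suc k} \<subseteq> I" by fact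
  have [measurable]: "(\<lambda>a. fdet (Suc k) (\<lambda>i j. a (i, j))) \<in> borel_measurable (PiM I (\<lambda>_. gaussian s))"
  proof (rule measurable_fdet)
    fix i j assume "i < Suc k" "j < Suc k"
    then have "(i, j) \<in> I" using sub by auto
    then show "(\<lambda>a. a (i, j)) \<in> borel_measurable (PiM I (\<lambda>_. gaussian s))" by measurable
  qed
  define N where "N = {a \<in> space (PiM I (\<lambda>_. gaussian s)). fdet (Suc k) (\<lambda>i j. a (i, j)) = 0}"
  have Nm: "N \<in> sets (PiM I (\<lambda>_. gaussian s))" unfolding N_def by measurable
  have "emeasure (PiM I (\<lambda>_. gaussian s)) N = (\<integral>\<^sup>+a. indicator N a \<partial>PiM (insert (k, k) I') (\<lambda>_. gaussian s))"
    using Nm by (simp add: I(1)[symmetric])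
  also have "\<dots> = (\<integral>\<^sup>+x. \<integral>\<^sup>+y. indicator N (x((k, k) := y)) \<partial>gaussian s \<partial>PiM I' (\<lambda>_. gaussian s))"
    using Nm by (intro PP.product_nn_integral_insert I) (simp add: I(1)[symmetric])
  also have "\<dots> = (\<integral>\<^sup>+x. 0 \<partial>PiM I' (\<lambda>_. gaussian s))"
  proof (intro nn_integral_cong_AE, use Suc.IH[OF I(3,4)] in eventually_elim)
    case (elim x)
    define d where "d = fdet k (\<lambda>i j. x (i, j))"
    obtain r where r: "\<And>y. fdet (Suc k) (\<lambda>i j. if i = k \<and> j = k then y else x (i, j)) = y * d + r"
      using fdet_Suc_affine[of k "\<lambda>i j. x (i, j)"] unfolding d_def by blast
    have "indicator N (x((k, k) := y)) \<le> (indicator {- r / d} y :: ennreal)" for y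
    proof -
      have "y = - r / d" if "x((k, k) := y) \<in> N"
      proof -
        have "fdet (Suc k) (\<lambda>i j. (x((k, k) := y)) (i, j)) = 0" using that by (simp add: N_def)
        moreover have "(\<lambda>i j. (x((k, k) := y)) (i, j)) = (\<lambda>i j. if i = k \<and> j = k then y else x (i, j))"
          by auto
        ultimately have "y * d + r = 0" using r by simp
        then show ?thesis using elim by (simp add: d_def field_simps)
      qed
      then show ?thesis by (auto simp: indicator_def)
    qed
    then have "(\<integral>\<^sup>+y. indicator N (x((k, k) := y)) \<partial>gaussian s) \<le> (\<integral>\<^sup>+y. indicator {- r / d} y \<partial>gaussian s)"
      by (intro nn_integral_mono)
    also have "\<dots> = 0" by (subst nn_integral_indicator) (auto simp: gaussian_singleton)
    finally show ?case by simp
  qed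
  finally have "emeasure (PiM I (\<lambda>_. gaussian s)) N = 0" by simp
  then have "N \<in> null_sets (PiM I (\<lambda>_. gaussian s))" using Nm by auto
  then have "AE a in PiM I (\<lambda>_. gaussian s). a \<notin> N" by (rule AE_not_in)
  then show ?case by (rule AE_mp) (auto simp: N_def intro!: AE_I2)
qed

section \<open>Moment bounds for blocks of rows\<close>

lemma measurable_coord: "i \<in> I \<Longrightarrow> (\<lambda>w. w i) \<in> borel_measurable (PiM I (\<lambda>_. gaussian s))"
  by measurable

lemma mgf_block:
  fixes G :: "nat \<Rightarrow> nat \<Rightarrow> real" and P :: "'p set"
  assumes fin: "finite P" and s: "s > 0"
    and sym: "\<And>j k. j < n \<Longrightarrow> k < n \<Longrightarrow> G j k = G k j"
    and le: "\<And>u. s\<^sup>2 * qform {..<n} G u \<le> (\<Sum>j<n. (u j)\<^sup>2) / 8"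
    and c: "c + real (card P) * (s\<^sup>2 * trc n G + 2 * s^4 * frob2 n G) \<le> 0"
  shows "(\<integral>\<^sup>+w. ennreal (exp ((\<Sum>p\<in>P. qform {..<n} G (\<lambda>j. w (p, j))) + c)) \<partial>PiM (P \<times> {..<n}) (\<lambda>_. gaussian s)) \<le> 1"
proof -
  have [measurable]: "(\<lambda>w. qform {..<n} G (\<lambda>j. w (p, j))) \<in> borel_measurable (PiM (P \<times> {..<n}) (\<lambda>_. gaussian s))" if "p \<in> P" for p
    unfolding qform_def using that
    by (intro borel_measurable_sum borel_measurable_times borel_measurable_const measurable_coord) auto
  have "(\<integral>\<^sup>+w. ennreal (exp ((\<Sum>p\<in>P. qform {..<n} G (\<lambda>j. w (p, j))) + c)) \<partial>PiM (P \<times> {..<n}) (\<lambda>_. gaussian s))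
    = (\<integral>\<^sup>+w. ennreal (exp c) * ennreal (exp (\<Sum>p\<in>P. qform {..<n} G (\<lambda>j. w (p, j)))) \<partial>PiM (P \<times> {..<n}) (\<lambda>_. gaussian s))"
    by (intro nn_integral_cong) (simp add: exp_add ennreal_mult[symmetric] mult.commute)
  also have "\<dots> = ennreal (exp c) * (\<integral>\<^sup>+w. ennreal (exp (\<Sum>p\<in>P. qform {..<n} G (\<lambda>j. w (p, j)))) \<partial>PiM (P \<times> {..<n}) (\<lambda>_. gaussian s))"
    by (rule nn_integral_cmult) measurable
  also have "\<dots> \<le> ennreal (exp c) * ennreal (exp (real (card P) * (s\<^sup>2 * trc n G + 2 * s^4 * frob2 n G)))"
    by (intro mult_left_mono chaos_mgf_block assms) auto
  also have "\<dots> = ennreal (exp (c + real (card P) * (s\<^sup>2 * trc n G + 2 * s^4 * frob2 n G)))"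
    by (simp add: ennreal_mult[symmetric] exp_add)
  also have "\<dots> \<le> 1" using c by (simp flip: ennreal_1 add: ennreal_leI)
  finally show ?thesis .
qed

text \<open>Fubini: for fixed rows in \<open>Q\<close> the matrix \<open>G a\<close> is constant,
  and the rows in \<open>P\<close> are independent of it. The compensator depends on the
  \<open>Q\<close> rows as well, so it must stay inside the exponential for the conditional bound 1
  to survive the outer integration.\<close>

lemma mgf_decoupled:
  fixes G :: "('p \<times> nat \<Rightarrow> real) \<Rightarrow> nat \<Rightarrow> nat \<Rightarrow> real" and P Q :: "'p set"
  assumes fin: "finite P" "finite Q" and disj: "P \<inter> Q = {}" and s: "s > 0"
    and meas [measurable]: "\<And>j k. j < n \<Longrightarrow> k < n \<Longrightarrow> (\<lambda>a. G a j k) \<in> borel_measurable (PiM ((Q \<union> P) \<times> {..<n}) (\<lambda>_. gaussian s))"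
    and dep: "\<And>a b j k. (\<And>i. i \<in> Q \<times> {..<n} \<Longrightarrow> a i = b i) \<Longrightarrow> j < n \<Longrightarrow> k < n \<Longrightarrow> G a j k = G b j k"
    and sym: "\<And>a j k. j < n \<Longrightarrow> k < n \<Longrightarrow> G a j k = G a k j"
    and le: "\<And>a u. s\<^sup>2 * qform {..<n} (G a) u \<le> (\<Sum>j<n. (u j)\<^sup>2) / 8"
  shows "(\<integral>\<^sup>+a. ennreal (exp ((\<Sum>p\<in>P. qform {..<n} (G a) (\<lambda>j. a (p, j)))
      + - (real (card P) * (s\<^sup>2 * trc n (G a) + 2 * s^4 * frob2 n (G a)))))
      \<partial>PiM ((Q \<union> P) \<times> {..<n}) (\<lambda>_. gaussian s)) \<le> 1"
proof -
  interpret N: prob_space "gaussian s" by (rule prob_space_normal_density[OF s])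
  interpret PP: product_sigma_finite "\<lambda>_. gaussian s" by standard
  interpret PQ: prob_space "PiM (Q \<times> {..<n}) (\<lambda>_. gaussian s)" by (intro prob_space_PiM) (rule prob_space_normal_density[OF s])
  let ?Y = "\<lambda>a. (\<Sum>p\<in>P. qform {..<n} (G a) (\<lambda>j. a (p, j))) + - (real (card P) * (s\<^sup>2 * trc n (G a) + 2 * s^4 * frob2 n (G a)))"
  have un: "(Q \<union> P) \<times> {..<n} = Q \<times> {..<n} \<union> P \<times> {..<n}" by auto
  have [measurable]: "?Y \<in> borel_measurable (PiM ((Q \<union> P) \<times> {..<n}) (\<lambda>_. gaussian s))"
    unfolding qform_def trc_def frob2_def
    by (intro borel_measurable_add borel_measurable_uminus borel_measurable_sum borel_measurable_times
        borel_measurable_const measurable_coord meas borel_measurable_power) auto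
  have "(\<integral>\<^sup>+a. ennreal (exp (?Y a)) \<partial>PiM ((Q \<union> P) \<times> {..<n}) (\<lambda>_. gaussian s))
    = (\<integral>\<^sup>+x. \<integral>\<^sup>+y. ennreal (exp (?Y (merge (Q \<times> {..<n}) (P \<times> {..<n}) (x, y)))) \<partial>PiM (P \<times> {..<n}) (\<lambda>_. gaussian s) \<partial>PiM (Q \<times> {..<n}) (\<lambda>_. gaussian s))"
    unfolding un
  proof (rule PP.product_nn_integral_fold)
    show "Q \<times> {..<n} \<inter> P \<times> {..<n} = {}" using disj by auto
    show "finite (Q \<times> {..<n})" "finite (P \<times> {..<n})" using fin by auto
    show "(\<lambda>a. ennreal (exp (?Y a))) \<in> borel_measurable (PiM (Q \<times> {..<n} \<union> P \<times> {..<n}) (\<lambda>_. gaussian s))"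
      unfolding un[symmetric] by measurable
  qed
  also have "\<dots> \<le> (\<integral>\<^sup>+x. 1 \<partial>PiM (Q \<times> {..<n}) (\<lambda>_. gaussian s))"
  proof (rule nn_integral_mono)
    fix x :: "'p \<times> nat \<Rightarrow> real"
    have e: "?Y (merge (Q \<times> {..<n}) (P \<times> {..<n}) (x, y)) = (\<Sum>p\<in>P. qform {..<n} (G x) (\<lambda>j. y (p, j)))
       + - (real (card P) * (s\<^sup>2 * trc n (G x) + 2 * s^4 * frob2 n (G x)))" for y
    proof -
      let ?m = "merge (Q \<times> {..<n}) (P \<times> {..<n}) (x, y)"
      have G: "G ?m j k = G x j k" if "j < n" "k < n" for j k
        by (rule dep[OF _ that]) (auto simp: merge_def)
      have "qform {..<n} (G ?m) (\<lambda>j. ?m (p, j)) = qform {..<n} (G x) (\<lambda>j. y (p, j))" if "p \<in> P" for p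
      proof -
        have "?m (p, j) = y (p, j)" if "j < n" for j
          using that \<open>p \<in> P\<close> disj by (auto simp: merge_def)
        then show ?thesis unfolding qform_def by (simp add: G)
      qed
      moreover have "trc n (G ?m) = trc n (G x)" "frob2 n (G ?m) = frob2 n (G x)"
        by (simp_all add: trc_def frob2_def G)
      ultimately show ?thesis by simp
    qed
    show "(\<integral>\<^sup>+y. ennreal (exp (?Y (merge (Q \<times> {..<n}) (P \<times> {..<n}) (x, y)))) \<partial>PiM (P \<times> {..<n}) (\<lambda>_. gaussian s)) \<le> 1"
      unfolding e by (rule mgf_block[OF fin(1) s sym le]) auto
  qed
  also have "\<dots> = 1" by (simp add: PQ.emeasure_space_1)
  finally show ?thesis .
qed

section \<open>The likelihood in terms of the weighted sensing matrix\<close>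

definition wmat :: "real \<Rightarrow> (nat \<Rightarrow> real) \<Rightarrow> (nat \<times> nat \<Rightarrow> real) \<Rightarrow> nat \<Rightarrow> nat \<Rightarrow> real" where
  "wmat \<sigma> x a p j = \<sigma> * x j * a (p, j)"

definition cov :: "nat \<Rightarrow> real \<Rightarrow> (nat \<Rightarrow> real) \<Rightarrow> (nat \<times> nat \<Rightarrow> real) \<Rightarrow> nat \<Rightarrow> nat \<Rightarrow> real" where
  "cov n \<sigma> x a = gram n (wmat \<sigma> x a)"

definition prec :: "nat \<Rightarrow> nat \<Rightarrow> real \<Rightarrow> (nat \<Rightarrow> real) \<Rightarrow> (nat \<times> nat \<Rightarrow> real) \<Rightarrow> nat \<Rightarrow> nat \<Rightarrow> real" where
  "prec m n \<sigma> x a = inv_fun m (cov n \<sigma> x a)"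

text \<open>Dividing the speckle by \<open>\<sigma>\<close> offsets the factor in
  \<open>wmat\<close>, so this is A Xo w_l, now visibly in the range of the matrix whose Gram matrix
  is the true covariance.\<close>

definition obs :: "nat \<Rightarrow> real \<Rightarrow> (nat \<Rightarrow> real) \<Rightarrow> (nat \<times> nat \<Rightarrow> real) \<Rightarrow> (nat \<times> nat \<Rightarrow> real) \<Rightarrow> nat \<Rightarrow> nat \<Rightarrow> real" where
  "obs n \<sigma> xo a w l p = (\<Sum>j<n. wmat \<sigma> xo a p j * (w (l, j) / \<sigma>))"

definition nll_fun :: "nat \<Rightarrow> nat \<Rightarrow> nat \<Rightarrow> real \<Rightarrow> (nat \<Rightarrow> real) \<Rightarrow> (nat \<times> nat \<Rightarrow> real) \<Rightarrow> (nat \<times> nat \<Rightarrow> real) \<Rightarrow> (nat \<Rightarrow> real) \<Rightarrow> real" where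
  "nll_fun m n L \<sigma> xo a w x = ln (fdet m (cov n \<sigma> x a))
     + (1 / real L) * (\<Sum>l<L. qform {..<m} (prec m n \<sigma> x a) (obs n \<sigma> xo a w l))"

text \<open>\<open>wmat\<close> is \<open>\<sigma> A diag x\<close>. The next matrix is \<open>\<sigma>^2 Xo A^T (\<Sigma>(x)^(-1) - \<Sigma>(xo)^(-1)) A Xo\<close>, so that the
  log-likelihoods of x and xo differ by log-determinants and a quadratic form in the speckle.\<close>
definition precision_dev :: "nat \<Rightarrow> nat \<Rightarrow> real \<Rightarrow> (nat \<Rightarrow> real) \<Rightarrow> (nat \<Rightarrow> real) \<Rightarrow> (nat \<times> nat \<Rightarrow> real) \<Rightarrow> nat \<Rightarrow> nat \<Rightarrow> real" where
  "precision_dev m n \<sigma> xo x a = conj_by m (wmat \<sigma> xo a) (\<lambda>p q. prec m n \<sigma> x a p q - prec m n \<sigma> xo a p q)"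

lemma mult_mat_vec_sum:
  assumes "A \<in> carrier_mat r c" "v \<in> carrier_vec c" "i < r"
  shows "(A *\<^sub>v v) $ i = (\<Sum>j<c. A $$ (i, j) * v $ j)"
  using assms by (auto simp: scalar_prod_def atLeast0LessThan intro!: sum.cong)

lemma covm_eq:
  assumes "dim_vec x = n"
  shows "covm \<sigma> (sensA m n a) x = tomat m (cov n \<sigma> (\<lambda>j. x $ j) a)"
proof (rule eq_matI)
  have d: "diagm x \<in> carrier_mat n n" using assms by (simp add: diagm_def)
  have s: "sensA m n a \<in> carrier_mat m n" by (simp add: sensA_def)
  have dd: "diagm x * diagm x = Matrix.mat n n (\<lambda>(i, j). if i = j then (x $ i)\<^sup>2 else 0)"
  proof (rule eq_matI)
    fix i j assume ij: "i < dim_row (Matrix.mat n n (\<lambda>(i, j). if i = j then (x $ i)\<^sup>2 else 0))"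
      "j < dim_col (Matrix.mat n n (\<lambda>(i, j). if i = j then (x $ i)\<^sup>2 else 0))"
    then have "(diagm x * diagm x) $$ (i, j) = (\<Sum>k\<in>{0..<n}. (if i = k then x $ i else 0) * (if k = j then x $ k else 0))"
      using assms by (auto simp: scalar_prod_def diagm_def intro!: sum.cong)
    also have "\<dots> = (\<Sum>k\<in>{0..<n}. if i = k then (if i = j then x $ i * x $ i else 0) else 0)"
      by (intro sum.cong) auto
    also have "\<dots> = (if i = j then (x $ i)\<^sup>2 else 0)" using ij by (simp add: power2_eq_square)
    finally show "(diagm x * diagm x) $$ (i, j) = Matrix.mat n n (\<lambda>(i, j). if i = j then (x $ i)\<^sup>2 else 0) $$ (i, j)"
      using ij by simp
  qed (use assms in \<open>auto simp: diagm_def\<close>)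
  have sd: "sensA m n a * (diagm x * diagm x) = Matrix.mat m n (\<lambda>(p, j). a (p, j) * (x $ j)\<^sup>2)"
  proof (rule eq_matI)
    fix p j assume pj: "p < dim_row (Matrix.mat m n (\<lambda>(p, j). a (p, j) * (x $ j)\<^sup>2))"
      "j < dim_col (Matrix.mat m n (\<lambda>(p, j). a (p, j) * (x $ j)\<^sup>2))"
    then have "(sensA m n a * (diagm x * diagm x)) $$ (p, j) = (\<Sum>k\<in>{0..<n}. a (p, k) * (if k = j then (x $ k)\<^sup>2 else 0))"
      unfolding dd by (auto simp: scalar_prod_def sensA_def intro!: sum.cong)
    also have "\<dots> = (\<Sum>k\<in>{0..<n}. if k = j then a (p, j) * (x $ j)\<^sup>2 else 0)"
      by (intro sum.cong) auto
    also have "\<dots> = a (p, j) * (x $ j)\<^sup>2" using pj by simp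
    finally show "(sensA m n a * (diagm x * diagm x)) $$ (p, j) = Matrix.mat m n (\<lambda>(p, j). a (p, j) * (x $ j)\<^sup>2) $$ (p, j)"
      using pj by simp
  qed (use assms in \<open>auto simp: sensA_def diagm_def\<close>)
  fix p q assume pq: "p < dim_row (tomat m (cov n \<sigma> (\<lambda>j. x $ j) a))" "q < dim_col (tomat m (cov n \<sigma> (\<lambda>j. x $ j) a))"
  then have "covm \<sigma> (sensA m n a) x $$ (p, q) = \<sigma>\<^sup>2 * (\<Sum>j\<in>{0..<n}. a (p, j) * (x $ j)\<^sup>2 * a (q, j))"
    unfolding covm_def sd by (auto simp: scalar_prod_def sensA_def intro!: sum.cong)
  also have "\<dots> = cov n \<sigma> (\<lambda>j. x $ j) a p q"
    unfolding cov_def gram_def wmat_def by (simp add: sum_distrib_left atLeast0LessThan power2_eq_square mult_ac)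
  finally show "covm \<sigma> (sensA m n a) x $$ (p, q) = tomat m (cov n \<sigma> (\<lambda>j. x $ j) a) $$ (p, q)"
    using pq by simp
qed (auto simp: covm_def sensA_def)

lemma minv_carrier: "A \<in> carrier_mat m m \<Longrightarrow> minv A \<in> carrier_mat m m"
  using adj_mat(1)[of A m] by (simp add: minv_adj)

lemma nll_eq:
  assumes \<sigma>: "\<sigma> \<noteq> 0" and x: "dim_vec x = n" and xo: "dim_vec xo = n"
  shows "nll \<sigma> (sensA m n a) L (\<lambda>l. sensA m n a *\<^sub>v (diagm xo *\<^sub>v speckle n w l)) x
    = nll_fun m n L \<sigma> (\<lambda>j. xo $ j) a w (\<lambda>j. x $ j)"
proof -
  let ?C = "tomat m (cov n \<sigma> (\<lambda>j. x $ j) a)"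
  have c0: "diagm xo \<in> carrier_mat n n" using xo by (simp add: diagm_def)
  have c1: "sensA m n a \<in> carrier_mat m n" by (simp add: sensA_def)
  have c2: "diagm xo *\<^sub>v speckle n w l \<in> carrier_vec n" for l
    by (rule mult_mat_vec_carrier[OF c0]) (simp add: speckle_def)
  have y: "(sensA m n a *\<^sub>v (diagm xo *\<^sub>v speckle n w l)) $ p = obs n \<sigma> (\<lambda>j. xo $ j) a w l p" if "p < m" for p l
  proof -
    have d: "(diagm xo *\<^sub>v speckle n w l) $ j = xo $ j * w (l, j)" if "j < n" for j
    proof -
      have "(diagm xo *\<^sub>v speckle n w l) $ j = (\<Sum>k<n. diagm xo $$ (j, k) * speckle n w l $ k)"
        by (rule mult_mat_vec_sum[of _ n]) (use xo that in \<open>simp_all add: diagm_def speckle_def\<close>)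
      also have "\<dots> = (\<Sum>k<n. if k = j then xo $ j * w (l, j) else 0)"
        using that xo by (intro sum.cong) (auto simp: diagm_def speckle_def)
      finally show ?thesis using that by simp
    qed
    have "(sensA m n a *\<^sub>v (diagm xo *\<^sub>v speckle n w l)) $ p = (\<Sum>j<n. sensA m n a $$ (p, j) * (diagm xo *\<^sub>v speckle n w l) $ j)"
      by (rule mult_mat_vec_sum[OF c1 c2 that])
    also have "\<dots> = (\<Sum>j<n. wmat \<sigma> (\<lambda>j. xo $ j) a p j * (w (l, j) / \<sigma>))"
    proof (rule sum.cong[OF refl])
      fix j assume "j \<in> {..<n}"
      then have "j < n" by simp
      show "sensA m n a $$ (p, j) * (diagm xo *\<^sub>v speckle n w l) $ j = wmat \<sigma> (\<lambda>j. xo $ j) a p j * (w (l, j) / \<sigma>)"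
        unfolding d[OF \<open>j < n\<close>] using that \<open>j < n\<close> \<sigma> by (simp add: sensA_def wmat_def)
    qed
    finally show ?thesis unfolding obs_def .
  qed
  have q: "scalar_prod v (minv ?C *\<^sub>v v) = qform {..<m} (prec m n \<sigma> (\<lambda>j. x $ j) a) (\<lambda>p. v $ p)"
    if v: "v \<in> carrier_vec m" for v
  proof -
    have c: "minv ?C \<in> carrier_mat m m" by (rule minv_carrier) simp
    have "scalar_prod v (minv ?C *\<^sub>v v) = (\<Sum>p<m. v $ p * (minv ?C *\<^sub>v v) $ p)"
      using c by (auto simp: scalar_prod_def atLeast0LessThan)
    also have "\<dots> = (\<Sum>p<m. v $ p * (\<Sum>q<m. minv ?C $$ (p, q) * v $ q))"
      by (intro sum.cong refl) (simp add: mult_mat_vec_sum[OF c v])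
    finally show ?thesis unfolding qform_dot prec_def inv_fun_def .
  qed
  have "scalar_prod (sensA m n a *\<^sub>v (diagm xo *\<^sub>v speckle n w l)) (minv ?C *\<^sub>v (sensA m n a *\<^sub>v (diagm xo *\<^sub>v speckle n w l)))
    = qform {..<m} (prec m n \<sigma> (\<lambda>j. x $ j) a) (obs n \<sigma> (\<lambda>j. xo $ j) a w l)" for l
  proof -
    have "sensA m n a *\<^sub>v (diagm xo *\<^sub>v speckle n w l) \<in> carrier_vec m"
      by (rule mult_mat_vec_carrier[OF c1 c2])
    then show ?thesis by (subst q) (auto intro!: qform_cong simp: y)
  qed
  then show ?thesis unfolding nll_def nll_fun_def covm_eq[OF x] fdet_def by simp
qed

definition boxed :: "nat \<Rightarrow> real \<Rightarrow> real \<Rightarrow> (nat \<Rightarrow> real) \<Rightarrow> bool" where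
  "boxed n lo hi x \<longleftrightarrow> (\<forall>j<n. lo \<le> x j \<and> x j \<le> hi)"

lemma box_pos: "0 < lo \<Longrightarrow> boxed n lo hi x \<Longrightarrow> j < n \<Longrightarrow> 0 < x j"
  by (force simp: boxed_def)

lemma box_ratio:
  assumes lo: "0 < lo" "lo \<le> hi" and x: "boxed n lo hi x" "boxed n lo hi x'" and j: "j < n"
  shows "0 < x j / x' j" "x j / x' j \<le> hi / lo" "(x j / x' j)\<^sup>2 \<le> (hi / lo)\<^sup>2"
proof -
  show a: "0 < x j / x' j" using box_pos[OF lo(1) x(1) j] box_pos[OF lo(1) x(2) j] by simp
  show b: "x j / x' j \<le> hi / lo"
    using x j lo box_pos[OF lo(1) x(1) j] by (intro frac_le) (auto simp: boxed_def)
  show "(x j / x' j)\<^sup>2 \<le> (hi / lo)\<^sup>2" using a b by (intro power_mono) auto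
qed

text \<open>The ratio is squared because covariances depend on the squares of the signal; this is
  the relative condition number of any two admissible covariances.\<close>

definition kap :: "real \<Rightarrow> real \<Rightarrow> real" where
  "kap lo hi = (hi / lo)\<^sup>2"

lemma kap_ge1: "0 < lo \<Longrightarrow> lo \<le> hi \<Longrightarrow> 1 \<le> kap lo hi"
  by (simp add: kap_def)

section \<open>Likelihood estimates for a fixed A of full rank\<close>

context
  fixes m n :: nat and \<sigma> lo hi :: real and a :: "nat \<times> nat \<Rightarrow> real"
  assumes mn: "m \<le> n" and \<sigma>: "\<sigma> > 0" and lo: "0 < lo" "lo \<le> hi"
    and rank: "fdet m (\<lambda>i j. a (i, j)) \<noteq> 0"
begin

text \<open>If a combination of the weighted rows vanishes, the positive column weights can be
  divided out, and the invertible leading m by m block of A forces all coefficients to be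
  zero.\<close>

lemma posdef_cov: assumes x: "boxed n lo hi x" shows "posdef m (cov n \<sigma> x a)"
  unfolding posdef_def cov_def
proof (intro conjI allI impI)
  fix u :: "nat \<Rightarrow> real" assume "\<exists>i<m. u i \<noteq> 0"
  then obtain r where r: "r < m" "u r \<noteq> 0" by blast
  have nn: "0 \<le> (\<Sum>j<n. (\<Sum>p<m. u p * wmat \<sigma> x a p j)\<^sup>2)" by (intro sum_nonneg) auto
  have "(\<Sum>j<n. (\<Sum>p<m. u p * wmat \<sigma> x a p j)\<^sup>2) \<noteq> 0"
  proof
    assume "(\<Sum>j<n. (\<Sum>p<m. u p * wmat \<sigma> x a p j)\<^sup>2) = 0"
    then have z: "(\<Sum>p<m. u p * wmat \<sigma> x a p j) = 0" if "j < n" for j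
      using that by (subst (asm) sum_nonneg_eq_0_iff) auto
    have z': "(\<Sum>p<m. u p * a (p, j)) = 0" if "j < n" for j
    proof -
      have "(\<Sum>p<m. u p * wmat \<sigma> x a p j) = \<sigma> * x j * (\<Sum>p<m. u p * a (p, j))"
        by (simp add: wmat_def sum_distrib_left mult_ac)
      then show ?thesis using z[OF that] \<sigma> box_pos[OF lo(1) x that] by simp
    qed
    have "u r = (\<Sum>p<m. u p * kron p r)" using r by (simp add: if_distrib[of "\<lambda>x. _ * x"] cong: if_cong)
    also have "\<dots> = (\<Sum>p<m. u p * (\<Sum>j<m. a (p, j) * inv_fun m (\<lambda>i j. a (i, j)) j r))"
      using r by (intro sum.cong refl) (simp add: inv_fun_right[OF rank])
    also have "\<dots> = (\<Sum>j<m. (\<Sum>p<m. u p * a (p, j)) * inv_fun m (\<lambda>i j. a (i, j)) j r)"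
      unfolding sum_distrib_left sum_distrib_right mult.assoc by (rule sum.swap)
    also have "\<dots> = 0" using z' mn by simp
    finally show False using r by simp
  qed
  then show "0 < qform {..<m} (gram n (wmat \<sigma> x a)) u" unfolding qform_gram using nn by linarith
qed (rule gram_sym)

lemma inverse_cov: assumes x: "boxed n lo hi x" shows "inverse_fun m (cov n \<sigma> x a) (prec m n \<sigma> x a)"
  unfolding prec_def
proof (rule inverse_fun_inv_fun)
  show "fdet m (cov n \<sigma> x a) \<noteq> 0" using fdet_pos[OF posdef_cov[OF x]] by simp
qed (simp add: cov_def gram_sym)

lemma wmat_scale: assumes x: "boxed n lo hi x" "boxed n lo hi x'" and j: "j < n"
  shows "wmat \<sigma> x a p j = wmat \<sigma> x' a p j * (x j / x' j)"
  using box_pos[OF lo(1) x(2) j] by (simp add: wmat_def)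

text \<open>The two matrices differ only in their column weights, so the forms compare column by
  column with ratio (x_j / x'_j)^2, whatever A is.\<close>

lemma cov_le: assumes x: "boxed n lo hi x" "boxed n lo hi x'"
  shows "qform {..<m} (cov n \<sigma> x a) u \<le> kap lo hi * qform {..<m} (cov n \<sigma> x' a) u"
proof -
  have "(\<Sum>p<m. u p * wmat \<sigma> x a p j)\<^sup>2 \<le> kap lo hi * (\<Sum>p<m. u p * wmat \<sigma> x' a p j)\<^sup>2" if j: "j < n" for j
  proof -
    have "(\<Sum>p<m. u p * wmat \<sigma> x a p j) = (x j / x' j) * (\<Sum>p<m. u p * wmat \<sigma> x' a p j)"
      by (simp add: wmat_scale[OF x j] sum_distrib_left mult_ac)
    then have "(\<Sum>p<m. u p * wmat \<sigma> x a p j)\<^sup>2 = (x j / x' j)\<^sup>2 * (\<Sum>p<m. u p * wmat \<sigma> x' a p j)\<^sup>2"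
      by (simp only: power_mult_distrib)
    also have "\<dots> \<le> kap lo hi * (\<Sum>p<m. u p * wmat \<sigma> x' a p j)\<^sup>2"
      unfolding kap_def using box_ratio(3)[OF lo x j] by (intro mult_right_mono) auto
    finally show ?thesis .
  qed
  then show ?thesis unfolding cov_def qform_gram sum_distrib_left by (intro sum_mono) auto
qed

lemma ln_fdet_cov_le: assumes x: "boxed n lo hi x" "boxed n lo hi xo"
  shows "ln (fdet m (cov n \<sigma> xo a)) - ln (fdet m (cov n \<sigma> x a))
    \<le> trc n (precision_dev m n \<sigma> xo x a) - frob2 n (precision_dev m n \<sigma> xo x a) / (5 * kap lo hi)"
  unfolding precision_dev_def
  using ln_fdet_ratio_le[OF inverse_cov[OF x(1), unfolded cov_def] inverse_cov[OF x(2), unfolded cov_def]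
      posdef_cov[OF x(1), unfolded cov_def] posdef_cov[OF x(2), unfolded cov_def] kap_ge1[OF lo]
      cov_le[OF x(2,1), unfolded cov_def]]
  unfolding cov_def .

text \<open>The \<open>x\<close> part is positive semidefinite and the subtracted \<open>xo\<close>
  part is an orthogonal projection. The likelihood enters the exponential moment with a negative
  factor, so this lower bound is the side that the chaos bound needs.\<close>

lemma qform_precision_dev_ge: assumes x: "boxed n lo hi x" "boxed n lo hi xo"
  shows "- (\<Sum>j<n. (u j)\<^sup>2) \<le> qform {..<n} (precision_dev m n \<sigma> xo x a) u"
proof -
  define y where "y = (\<lambda>p. \<Sum>j<n. wmat \<sigma> xo a p j * u j)"
  have "qform {..<n} (precision_dev m n \<sigma> xo x a) u = qform {..<m} (prec m n \<sigma> x a) y - qform {..<m} (prec m n \<sigma> xo a) y"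
    unfolding precision_dev_def qform_conj qform_diff y_def ..
  moreover have "0 \<le> qform {..<m} (prec m n \<sigma> x a) y"
    by (rule qform_inverse_nonneg) (rule inverse_cov[OF x(1), unfolded cov_def])
  moreover have "qform {..<m} (prec m n \<sigma> xo a) y \<le> (\<Sum>j<n. (u j)\<^sup>2)"
    by (rule qform_inverse_gram_le[OF inverse_cov[OF x(2), unfolded cov_def]]) (simp add: y_def)
  ultimately show ?thesis by linarith
qed

lemma precision_dev_sym: assumes x: "boxed n lo hi x" "boxed n lo hi xo" shows "precision_dev m n \<sigma> xo x a j k = precision_dev m n \<sigma> xo x a k j"
  unfolding precision_dev_def
  by (rule conj_by_sym) (use inverse_funD(3)[OF inverse_cov[OF x(1)]] inverse_funD(3)[OF inverse_cov[OF x(2)]] in simp)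

lemma nll_fun_diff:
  "nll_fun m n L \<sigma> xo a w x - nll_fun m n L \<sigma> xo a w xo = ln (fdet m (cov n \<sigma> x a)) - ln (fdet m (cov n \<sigma> xo a))
     + (1 / real L) * (\<Sum>l<L. qform {..<n} (precision_dev m n \<sigma> xo x a) (\<lambda>j. w (l, j) / \<sigma>))"
  unfolding nll_fun_def precision_dev_def qform_conj qform_diff obs_def[abs_def] sum_subtractf
  by (simp add: algebra_simps)

text \<open>The trace of N cancels between the log-determinant and the Gaussian mean. What remains
  is a gain c |N|_F^2 from the log-determinant against the second-order term of the chaos
  bound.\<close>

lemma lik_mgf_cond:
  assumes x: "boxed n lo hi x" "boxed n lo hi xo" and L: "L \<ge> 1"
  defines "c \<equiv> 1 / (5 * kap lo hi)"
  shows "(\<integral>\<^sup>+w. ennreal (exp (- (c / 4 * real L) * (nll_fun m n L \<sigma> xo a w x - nll_fun m n L \<sigma> xo a w xo)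
      + c / 4 * real L * (c / 2) * frob2 n (precision_dev m n \<sigma> xo x a)))
     \<partial>PiM ({..<L} \<times> {..<n}) (\<lambda>_. gaussian \<sigma>)) \<le> 1"
proof -
  \<comment> \<open>The exponent solves - l c + l c/2 + 2 l^2 = 0: gain, the half of it kept in the
    conclusion, and second-order cost. As \<kappa> \<ge> 1, it is at most 1/20, within the range 1/8
    of the chaos bound.\<close>
  define l where "l = c / 4"
  define N where "N = precision_dev m n \<sigma> xo x a"
  define G where "G = (\<lambda>j k. - (l / \<sigma>\<^sup>2) * N j k)"
  define F where "F = frob2 n N"
  define D where "D = ln (fdet m (cov n \<sigma> xo a)) - ln (fdet m (cov n \<sigma> x a))"
  define b where "b = real L * l * D + l * real L * (c / 2) * F"
  have k: "kap lo hi > 0" "c > 0" "c \<le> 1/5" using kap_ge1[OF lo] by (auto simp: c_def field_simps)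
  have l: "l > 0" "l \<le> 1/8" using k by (auto simp: l_def)
  have qG: "qform {..<n} G u = - l * qform {..<n} N (\<lambda>j. u j / \<sigma>)" for u
    unfolding qform_def G_def sum_distrib_left by (intro sum.cong refl) (simp add: power2_eq_square)
  have "- l * real L * (nll_fun m n L \<sigma> xo a w x - nll_fun m n L \<sigma> xo a w xo) + l * real L * (c / 2) * F
    = (\<Sum>i<L. qform {..<n} G (\<lambda>j. w (i, j))) + b" for w
    unfolding nll_fun_diff qG N_def[symmetric] b_def D_def using L by (simp add: sum_distrib_left[symmetric] sum_negf algebra_simps)
  then have e: "- (c / 4 * real L) * (nll_fun m n L \<sigma> xo a w x - nll_fun m n L \<sigma> xo a w xo)
      + c / 4 * real L * (c / 2) * frob2 n (precision_dev m n \<sigma> xo x a) = (\<Sum>i<L. qform {..<n} G (\<lambda>j. w (i, j))) + b" for w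
    unfolding l_def F_def N_def by simp
  show ?thesis unfolding e
  proof (rule mgf_block[OF _ \<sigma>])
    show "G j k = G k j" for j k unfolding G_def N_def by (simp add: precision_dev_sym[OF x])
    show "\<sigma>\<^sup>2 * qform {..<n} G u \<le> (\<Sum>j<n. (u j)\<^sup>2) / 8" for u
    proof -
      have "qform {..<n} G u \<le> l * (\<Sum>j<n. (u j / \<sigma>)\<^sup>2)"
        using mult_left_mono[OF qform_precision_dev_ge[OF x, of "\<lambda>j. u j / \<sigma>"], of l] l unfolding qG N_def by simp
      then have "\<sigma>\<^sup>2 * qform {..<n} G u \<le> \<sigma>\<^sup>2 * (l * (\<Sum>j<n. (u j / \<sigma>)\<^sup>2))"
        by (intro mult_left_mono) auto
      also have "\<dots> = l * (\<Sum>j<n. (u j)\<^sup>2)"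
        using \<sigma> by (simp add: power_divide sum_divide_distrib[symmetric])
      also have "\<dots> \<le> 1/8 * (\<Sum>j<n. (u j)\<^sup>2)" using l by (intro mult_right_mono sum_nonneg) auto
      finally show ?thesis by simp
    qed
    have tG: "\<sigma>\<^sup>2 * trc n G = - l * trc n N"
      unfolding trc_def G_def using \<sigma> by (simp add: sum_distrib_left)
    have fG: "2 * \<sigma>^4 * frob2 n G = 2 * l\<^sup>2 * F"
      unfolding frob2_def G_def F_def using \<sigma>
      by (simp add: power_mult_distrib power_divide sum_distrib_left[symmetric] sum_divide_distrib[symmetric])
    have "D \<le> trc n N - c * F"
      using ln_fdet_cov_le[OF x] unfolding D_def N_def F_def c_def by simp
    then have "real L * l * D \<le> real L * l * (trc n N - c * F)" using l by (intro mult_left_mono) auto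
    then have "b + real L * (\<sigma>\<^sup>2 * trc n G + 2 * \<sigma>^4 * frob2 n G)
       \<le> real L * l * (trc n N - c * F) + l * real L * (c / 2) * F + real L * (- l * trc n N + 2 * l\<^sup>2 * F)"
      unfolding b_def tG fG by simp
    also have "\<dots> = 0" unfolding l_def by (simp add: field_simps power2_eq_square)
    finally show "b + real (card {..<L}) * (\<sigma>\<^sup>2 * trc n G + 2 * \<sigma>^4 * frob2 n G) \<le> 0" by simp
  qed simp
qed

text \<open>V^T (V V^T)^(-1) V is the orthogonal projection onto the row space, which has dimension
  \<open>m\<close>.\<close>

lemma trc_inverse: assumes "inverse_fun m (gram n V) B" shows "trc n (conj_by m V B) = real m"
proof -
  have "trc n (conj_by m V B) = (\<Sum>p<m. \<Sum>q<m. B p q * gram n V q p)"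
    unfolding trc_conj by (simp add: gram_sym)
  also have "\<dots> = (\<Sum>p<m. 1)" by (intro sum.cong refl) (simp add: inverse_funD(2)[OF assms])
  finally show ?thesis by simp
qed

text \<open>Both parts of the likelihood are compared relatively, through ratios of coordinates and
  properties of projections, so the Lipschitz-type bound does not involve the conditioning of
  A.\<close>

lemma nll_fun_close:
  assumes x: "boxed n lo hi x" "boxed n lo hi x'" "boxed n lo hi xo" and L: "L \<ge> 1"
    and \<eta>: "\<eta> \<ge> 0" "\<And>j. j < n \<Longrightarrow> (x j / x' j)\<^sup>2 \<le> 1 + \<eta>" "\<And>j. j < n \<Longrightarrow> (x' j / x j)\<^sup>2 \<le> 1 + \<eta>"
  shows "nll_fun m n L \<sigma> xo a w x \<le> nll_fun m n L \<sigma> xo a w x'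
    + \<eta> * (real n + kap lo hi / \<sigma>\<^sup>2 * ((\<Sum>l<L. \<Sum>j<n. (w (l, j))\<^sup>2) / real L))"
proof -
  note inv' = inverse_cov[OF x(2), unfolded cov_def] and inv = inverse_cov[OF x(1), unfolded cov_def]
  have "ln (fdet m (cov n \<sigma> x a)) - ln (fdet m (cov n \<sigma> x' a)) \<le> trc n (precision_dev m n \<sigma> x x' a)"
    using ln_fdet_cov_le[OF x(2,1)] frob2_nonneg[of n "precision_dev m n \<sigma> x x' a"] kap_ge1[OF lo]
    by (smt (verit) divide_nonneg_pos)
  also have "trc n (precision_dev m n \<sigma> x x' a) = trc n (conj_by m (wmat \<sigma> x a) (prec m n \<sigma> x' a)) - trc n (conj_by m (wmat \<sigma> x a) (prec m n \<sigma> x a))"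
    unfolding trc_def precision_dev_def conj_by_diff sum_subtractf ..
  \<comment> \<open>Both subtracted matrices are projections of trace \<open>m\<close>, so one may
    be exchanged for the other; now only the column weights differ.\<close>
  also have "\<dots> = trc n (conj_by m (wmat \<sigma> x a) (prec m n \<sigma> x' a)) - trc n (conj_by m (wmat \<sigma> x' a) (prec m n \<sigma> x' a))"
    unfolding trc_inverse[OF inv] trc_inverse[OF inv'] ..
  also have "\<dots> = (\<Sum>j<n. ((x j / x' j)\<^sup>2 - 1) * conj_by m (wmat \<sigma> x' a) (prec m n \<sigma> x' a) j j)"
  proof -
    have "conj_by m (wmat \<sigma> x a) (prec m n \<sigma> x' a) j j = (x j / x' j)\<^sup>2 * conj_by m (wmat \<sigma> x' a) (prec m n \<sigma> x' a) j j" if j: "j < n" for j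
      unfolding conj_by_def sum_distrib_left wmat_scale[OF x(1,2) j]
      by (intro sum.cong refl) (simp add: power2_eq_square)
    then show ?thesis unfolding trc_def by (simp add: sum_subtractf[symmetric] left_diff_distrib)
  qed
  \<comment> \<open>Diagonal entries of an orthogonal projection lie between 0 and 1; the upper
    bound is the minimal-norm property tested with the j-th unit vector.\<close>
  also have "\<dots> \<le> (\<Sum>j<n. \<eta>)"
  proof (rule sum_mono)
    fix j assume "j \<in> {..<n}"
    then have j: "j < n" by simp
    define y where "y = (\<lambda>p. wmat \<sigma> x' a p j)"
    have c: "conj_by m (wmat \<sigma> x' a) (prec m n \<sigma> x' a) j j = qform {..<m} (prec m n \<sigma> x' a) y"
      unfolding conj_by_def qform_def y_def by (simp add: mult_ac)
    have 0: "0 \<le> qform {..<m} (prec m n \<sigma> x' a) y" by (rule qform_inverse_nonneg[OF inv'])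
    have "qform {..<m} (prec m n \<sigma> x' a) y \<le> (\<Sum>i<n. (kron i j)\<^sup>2)"
      by (rule qform_inverse_gram_le[OF inv'])
         (use j in \<open>simp add: y_def if_distrib[of "\<lambda>x. _ * x"] cong: if_cong\<close>)
    also have "\<dots> = 1" using j by (simp add: if_distrib[of "\<lambda>x. x\<^sup>2"] cong: if_cong)
    finally have 1: "qform {..<m} (prec m n \<sigma> x' a) y \<le> 1" .
    have "((x j / x' j)\<^sup>2 - 1) * qform {..<m} (prec m n \<sigma> x' a) y \<le> \<eta> * qform {..<m} (prec m n \<sigma> x' a) y"
      using \<eta>(2)[OF j] 0 by (intro mult_right_mono) auto
    also have "\<dots> \<le> \<eta> * 1" using \<eta>(1) 1 by (intro mult_left_mono) auto
    finally show "((x j / x' j)\<^sup>2 - 1) * conj_by m (wmat \<sigma> x' a) (prec m n \<sigma> x' a) j j \<le> \<eta>" unfolding c by simp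
  qed
  finally have ln: "ln (fdet m (cov n \<sigma> x a)) - ln (fdet m (cov n \<sigma> x' a)) \<le> \<eta> * real n" by (simp add: mult.commute)
  have q: "qform {..<m} (prec m n \<sigma> x a) (obs n \<sigma> xo a w l)
     \<le> qform {..<m} (prec m n \<sigma> x' a) (obs n \<sigma> xo a w l) + \<eta> * (kap lo hi / \<sigma>\<^sup>2 * (\<Sum>j<n. (w (l, j))\<^sup>2))" for l
  proof -
    define y where "y = obs n \<sigma> xo a w l"
    obtain v where v: "\<And>p. p < m \<Longrightarrow> y p = (\<Sum>j<n. wmat \<sigma> x' a p j * v j)"
      "(\<Sum>j<n. (v j)\<^sup>2) = qform {..<m} (prec m n \<sigma> x' a) y"
      using inverse_conj_solve[OF inv'] by metis
    \<comment> \<open>Rescaling the minimal preimage for \<open>x'\<close> coordinatewise gives a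
      preimage for \<open>x\<close>, whose norm bounds the form from above.\<close>
    have "qform {..<m} (prec m n \<sigma> x a) y \<le> (\<Sum>j<n. (x' j / x j * v j)\<^sup>2)"
    proof (rule qform_inverse_gram_le[OF inv])
      fix p assume "p < m"
      then show "y p = (\<Sum>j<n. wmat \<sigma> x a p j * (x' j / x j * v j))"
        unfolding v(1)[OF \<open>p < m\<close>] by (intro sum.cong refl) (simp add: wmat_scale[OF x(2,1)])
    qed
    also have "\<dots> \<le> (\<Sum>j<n. (1 + \<eta>) * (v j)\<^sup>2)"
      unfolding power_mult_distrib using \<eta>(3) by (intro sum_mono mult_right_mono) auto
    also have "\<dots> = (1 + \<eta>) * qform {..<m} (prec m n \<sigma> x' a) y" by (simp add: sum_distrib_left[symmetric] v(2))
    finally have 1: "qform {..<m} (prec m n \<sigma> x a) y \<le> (1 + \<eta>) * qform {..<m} (prec m n \<sigma> x' a) y" .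
    have "qform {..<m} (prec m n \<sigma> x' a) y \<le> (\<Sum>j<n. (xo j / x' j * (w (l, j) / \<sigma>))\<^sup>2)"
    proof (rule qform_inverse_gram_le[OF inv'])
      fix p assume "p < m"
      then show "y p = (\<Sum>j<n. wmat \<sigma> x' a p j * (xo j / x' j * (w (l, j) / \<sigma>)))"
        unfolding y_def obs_def by (intro sum.cong refl) (simp add: wmat_scale[OF x(3,2)])
    qed
    also have "\<dots> \<le> (\<Sum>j<n. kap lo hi * (w (l, j) / \<sigma>)\<^sup>2)"
      unfolding power_mult_distrib[of "_ / _"] kap_def using box_ratio(3)[OF lo x(3,2)]
      by (intro sum_mono mult_right_mono) auto
    also have "\<dots> = kap lo hi / \<sigma>\<^sup>2 * (\<Sum>j<n. (w (l, j))\<^sup>2)"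
      by (simp add: power_divide sum_distrib_left)
    finally have 2: "qform {..<m} (prec m n \<sigma> x' a) y \<le> kap lo hi / \<sigma>\<^sup>2 * (\<Sum>j<n. (w (l, j))\<^sup>2)" .
    show ?thesis using 1 mult_left_mono[OF 2 \<eta>(1)] unfolding y_def by (simp add: distrib_right)
  qed
  have "(\<Sum>l<L. qform {..<m} (prec m n \<sigma> x a) (obs n \<sigma> xo a w l))
    \<le> (\<Sum>l<L. qform {..<m} (prec m n \<sigma> x' a) (obs n \<sigma> xo a w l) + \<eta> * (kap lo hi / \<sigma>\<^sup>2 * (\<Sum>j<n. (w (l, j))\<^sup>2)))"
    by (intro sum_mono q)
  also have "\<dots> = (\<Sum>l<L. qform {..<m} (prec m n \<sigma> x' a) (obs n \<sigma> xo a w l)) + \<eta> * (kap lo hi / \<sigma>\<^sup>2 * (\<Sum>l<L. \<Sum>j<n. (w (l, j))\<^sup>2))"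
    by (simp add: sum.distrib sum_distrib_left)
  finally have "(1 / real L) * (\<Sum>l<L. qform {..<m} (prec m n \<sigma> x a) (obs n \<sigma> xo a w l))
    \<le> (1 / real L) * ((\<Sum>l<L. qform {..<m} (prec m n \<sigma> x' a) (obs n \<sigma> xo a w l)) + \<eta> * (kap lo hi / \<sigma>\<^sup>2 * (\<Sum>l<L. \<Sum>j<n. (w (l, j))\<^sup>2)))"
    by (intro mult_left_mono) auto
  then show ?thesis using ln unfolding nll_fun_def by (simp add: algebra_simps)
qed

end

section \<open>Energy of the signal difference\<close>

lemma conj_by_bilinear:
  "(\<Sum>j<n. U j * (\<Sum>k<n. conj_by m V K j k * W k))
    = (\<Sum>r<m. (\<Sum>j<n. U j * V r j) * (\<Sum>s<m. K r s * (\<Sum>k<n. V s k * W k)))"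
proof -
  define Z where "Z = (\<lambda>r. \<Sum>s<m. K r s * (\<Sum>k<n. V s k * W k))"
  have 1: "(\<Sum>k<n. conj_by m V K j k * W k) = (\<Sum>r<m. Z r * V r j)" for j
  proof -
    have "(\<Sum>k<n. conj_by m V K j k * W k) = (\<Sum>k<n. \<Sum>r<m. \<Sum>s<m. V r j * K r s * V s k * W k)"
      unfolding conj_by_def sum_distrib_right ..
    also have "\<dots> = (\<Sum>r<m. \<Sum>k<n. \<Sum>s<m. V r j * K r s * V s k * W k)" by (rule sum.swap)
    also have "\<dots> = (\<Sum>r<m. \<Sum>s<m. \<Sum>k<n. V r j * K r s * V s k * W k)"
      by (rule sum.cong[OF refl]) (rule sum.swap)
    finally show ?thesis unfolding Z_def by (simp add: sum_distrib_left sum_distrib_right mult_ac)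
  qed
  have "(\<Sum>j<n. U j * (\<Sum>r<m. Z r * V r j)) = (\<Sum>r<m. (\<Sum>j<n. V r j * U j) * Z r)"
    by (rule sum_mult_transpose[symmetric])
  then show ?thesis unfolding 1 by (simp add: Z_def mult.commute)
qed

section \<open>Operator norms and the energy of a diagonal difference\<close>

text \<open>Note the scale: \<open>c\<close> bounds the square of the operator norm.\<close>

definition op_bound :: "nat \<Rightarrow> nat \<Rightarrow> (nat \<times> nat \<Rightarrow> real) \<Rightarrow> real \<Rightarrow> bool" where
  "op_bound m n a c \<longleftrightarrow> (\<forall>u. (\<Sum>p<m. (\<Sum>j<n. a (p, j) * u j)\<^sup>2) \<le> c * (\<Sum>j<n. (u j)\<^sup>2))"

lemma op_boundD: "op_bound m n a c \<Longrightarrow> (\<Sum>p<m. (\<Sum>j<n. a (p, j) * u j)\<^sup>2) \<le> c * (\<Sum>j<n. (u j)\<^sup>2)"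
  by (simp add: op_bound_def)

lemma op_bound_weighted:
  assumes op: "op_bound m n a c" and c: "c \<ge> 0" and b: "\<And>j. j < n \<Longrightarrow> (v j)\<^sup>2 \<le> b"
  shows "(\<Sum>p<m. (\<Sum>j<n. (a (p, j) * v j) * u j)\<^sup>2) \<le> c * b * (\<Sum>j<n. (u j)\<^sup>2)"
proof -
  have "(\<Sum>p<m. (\<Sum>j<n. (a (p, j) * v j) * u j)\<^sup>2) \<le> c * (\<Sum>j<n. (v j * u j)\<^sup>2)"
    using op_boundD[OF op, of "\<lambda>j. v j * u j"] by (simp add: mult.assoc)
  also have "\<dots> \<le> c * (\<Sum>j<n. b * (u j)\<^sup>2)"
    unfolding power_mult_distrib using b c by (intro mult_left_mono sum_mono mult_right_mono) auto
  finally show ?thesis by (simp add: sum_distrib_left mult.assoc)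
qed

text \<open>The Frobenius norm of U N W^T: \<open>U\<close> acts on each column of N W^T, then
  \<open>W\<close> on each row of N.\<close>

lemma frob_sandwich_le:
  fixes N :: "nat \<Rightarrow> nat \<Rightarrow> real"
  assumes U: "\<And>u. (\<Sum>p<m. (\<Sum>j<n. U p j * u j)\<^sup>2) \<le> c * (\<Sum>j<n. (u j)\<^sup>2)"
    and W: "\<And>u. (\<Sum>p<m. (\<Sum>j<n. W p j * u j)\<^sup>2) \<le> d * (\<Sum>j<n. (u j)\<^sup>2)" and c: "c \<ge> 0"
  shows "(\<Sum>p<m. \<Sum>q<m. (\<Sum>j<n. U p j * (\<Sum>k<n. N j k * W q k))\<^sup>2) \<le> c * d * frob2 n N"
proof -
  have "(\<Sum>p<m. \<Sum>q<m. (\<Sum>j<n. U p j * (\<Sum>k<n. N j k * W q k))\<^sup>2)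
    = (\<Sum>q<m. \<Sum>p<m. (\<Sum>j<n. U p j * (\<Sum>k<n. N j k * W q k))\<^sup>2)" by (rule sum.swap)
  also have "\<dots> \<le> (\<Sum>q<m. c * (\<Sum>j<n. (\<Sum>k<n. N j k * W q k)\<^sup>2))" by (intro sum_mono U)
  also have "\<dots> = c * (\<Sum>q<m. \<Sum>j<n. (\<Sum>k<n. N j k * W q k)\<^sup>2)" by (simp add: sum_distrib_left)
  also have "(\<Sum>q<m. \<Sum>j<n. (\<Sum>k<n. N j k * W q k)\<^sup>2) = (\<Sum>j<n. \<Sum>q<m. (\<Sum>k<n. W q k * N j k)\<^sup>2)"
    by (subst sum.swap) (simp add: mult.commute)
  also have "c * \<dots> \<le> c * (\<Sum>j<n. d * (\<Sum>k<n. (N j k)\<^sup>2))"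
    using c by (intro mult_left_mono sum_mono W)
  finally show ?thesis by (simp add: frob2_def sum_distrib_left mult.assoc)
qed

text \<open>The squared Frobenius norm of A diag(d) A^T.\<close>

definition energy :: "nat \<Rightarrow> nat \<Rightarrow> (nat \<times> nat \<Rightarrow> real) \<Rightarrow> (nat \<Rightarrow> real) \<Rightarrow> real" where
  "energy m n a d = (\<Sum>p<m. \<Sum>q<m. (\<Sum>j<n. d j * a (p, j) * a (q, j))\<^sup>2)"

lemma energy_le:
  assumes mn: "m \<le> n" and \<sigma>: "\<sigma> > 0" and lo: "0 < lo" "lo \<le> hi" and rank: "fdet m (\<lambda>i j. a (i, j)) \<noteq> 0"
    and x: "boxed n lo hi x" "boxed n lo hi xo" and op: "op_bound m n a c" and c: "c \<ge> 0"
  shows "energy m n a (\<lambda>j. (x j)\<^sup>2 - (xo j)\<^sup>2) \<le> c\<^sup>2 * (hi^6 / lo\<^sup>2) * frob2 n (precision_dev m n \<sigma> xo x a)"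
proof -
  note inv = inverse_cov[OF mn \<sigma> lo rank x(1)] and invo = inverse_cov[OF mn \<sigma> lo rank x(2)]
  have pos: "0 < x j" "0 < xo j" if "j < n" for j
    using box_pos[OF lo(1) x(1) that] box_pos[OF lo(1) x(2) that] by auto
  have bnd: "lo \<le> x j" "x j \<le> hi" "lo \<le> xo j" "xo j \<le> hi" if "j < n" for j
    using x that by (auto simp: boxed_def)
  define K where "K = (\<lambda>p q. prec m n \<sigma> x a p q - prec m n \<sigma> xo a p q)"
  define N where "N = precision_dev m n \<sigma> xo x a"
  define U where "U = (\<lambda>p j. a (p, j) * (\<sigma> * (x j)\<^sup>2 / xo j))"
  define W where "W = (\<lambda>p j. a (p, j) * (\<sigma> * xo j))"
  have W: "wmat \<sigma> xo a p j = W p j" for p j by (simp add: wmat_def W_def mult_ac)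
  \<comment> \<open>The weights in \<open>U\<close> are chosen so that U W^T is the covariance of
    \<open>x\<close>; then \<Sigma>(x) (\<Sigma>(x)^(-1) - \<Sigma>(xo)^(-1)) \<Sigma>(xo) collapses
    to \<Sigma>(xo) - \<Sigma>(x).\<close>
  have id: "(\<Sum>j<n. U p j * (\<Sum>k<n. N j k * W q k)) = cov n \<sigma> xo a p q - cov n \<sigma> x a p q"
    if pq: "p < m" "q < m" for p q
  proof -
    have "(\<Sum>j<n. U p j * (\<Sum>k<n. N j k * W q k))
      = (\<Sum>r<m. (\<Sum>j<n. U p j * W r j) * (\<Sum>s<m. K r s * (\<Sum>k<n. W s k * W q k)))"
      unfolding N_def precision_dev_def K_def[symmetric] conj_by_bilinear W ..
    also have "\<dots> = (\<Sum>r<m. cov n \<sigma> x a p r * (\<Sum>s<m. K r s * cov n \<sigma> xo a s q))"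
    proof -
      have "(\<Sum>j<n. U p j * W r j) = cov n \<sigma> x a p r" for r
        unfolding cov_def gram_def U_def W_def wmat_def
      proof (rule sum.cong[OF refl])
        fix j assume "j \<in> {..<n}"
        then have "xo j \<noteq> 0" using pos[of j] by auto
        then show "a (p, j) * (\<sigma> * (x j)\<^sup>2 / xo j) * (a (r, j) * (\<sigma> * xo j)) = \<sigma> * x j * a (p, j) * (\<sigma> * x j * a (r, j))"
          by (simp add: power2_eq_square)
      qed
      moreover have "(\<Sum>k<n. W s k * W q k) = cov n \<sigma> xo a s q" for s
        unfolding cov_def gram_def W ..
      ultimately show ?thesis by simp
    qed
    also have "\<dots> = (\<Sum>r<m. cov n \<sigma> x a p r * ((\<Sum>s<m. prec m n \<sigma> x a r s * cov n \<sigma> xo a s q) - kron r q))"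
    proof (rule sum.cong[OF refl])
      fix r assume "r \<in> {..<m}"
      then have "(\<Sum>s<m. prec m n \<sigma> xo a r s * cov n \<sigma> xo a s q) = kron r q"
        using inverse_funD(2)[OF invo] pq by simp
      then show "cov n \<sigma> x a p r * (\<Sum>s<m. K r s * cov n \<sigma> xo a s q)
        = cov n \<sigma> x a p r * ((\<Sum>s<m. prec m n \<sigma> x a r s * cov n \<sigma> xo a s q) - kron r q)"
        unfolding K_def by (simp add: left_diff_distrib sum_subtractf)
    qed
    also have "\<dots> = (\<Sum>r<m. cov n \<sigma> x a p r * (\<Sum>s<m. prec m n \<sigma> x a r s * cov n \<sigma> xo a s q)) - (\<Sum>r<m. cov n \<sigma> x a p r * kron r q)"
      by (simp only: right_diff_distrib sum_subtractf)
    also have "(\<Sum>r<m. cov n \<sigma> x a p r * (\<Sum>s<m. prec m n \<sigma> x a r s * cov n \<sigma> xo a s q)) = cov n \<sigma> xo a p q"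
      by (rule inverse_solve[OF inv pq(1)])
    also have "(\<Sum>r<m. cov n \<sigma> x a p r * kron r q) = cov n \<sigma> x a p q"
      using pq by (simp add: if_distrib[of "\<lambda>x. _ * x"] cong: if_cong)
    finally show ?thesis .
  qed
  have cd: "cov n \<sigma> xo a p q - cov n \<sigma> x a p q = - \<sigma>\<^sup>2 * (\<Sum>j<n. ((x j)\<^sup>2 - (xo j)\<^sup>2) * a (p, j) * a (q, j))" for p q
    unfolding cov_def gram_def wmat_def sum_subtractf[symmetric] sum_distrib_left
    by (intro sum.cong refl) (simp add: power2_eq_square algebra_simps)
  have "\<sigma>^4 * energy m n a (\<lambda>j. (x j)\<^sup>2 - (xo j)\<^sup>2) = (\<Sum>p<m. \<Sum>q<m. (\<Sum>j<n. U p j * (\<Sum>k<n. N j k * W q k))\<^sup>2)"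
    unfolding energy_def sum_distrib_left
    by (intro sum.cong refl) (simp add: id cd power_mult_distrib flip: sum_distrib_left)
  also have "\<dots> \<le> (c * (\<sigma>\<^sup>2 * (hi^4 / lo\<^sup>2))) * (c * (\<sigma>\<^sup>2 * hi\<^sup>2)) * frob2 n N"
  proof (rule frob_sandwich_le)
    show "(\<Sum>p<m. (\<Sum>j<n. U p j * u j)\<^sup>2) \<le> c * (\<sigma>\<^sup>2 * (hi^4 / lo\<^sup>2)) * (\<Sum>j<n. (u j)\<^sup>2)" for u
      unfolding U_def
    proof (rule op_bound_weighted[OF op c])
      fix j assume j: "j < n"
      have "(x j)\<^sup>2 / xo j \<le> hi\<^sup>2 / lo" using bnd[OF j] pos[OF j] lo by (intro frac_le power_mono) auto
      then have "\<sigma> * (x j)\<^sup>2 / xo j \<le> \<sigma> * (hi\<^sup>2 / lo)"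
        using mult_left_mono[of "(x j)\<^sup>2 / xo j" "hi\<^sup>2 / lo" \<sigma>] \<sigma> by simp
      moreover have "0 \<le> \<sigma> * (x j)\<^sup>2 / xo j" using \<sigma> pos[OF j] by simp
      ultimately have "(\<sigma> * (x j)\<^sup>2 / xo j)\<^sup>2 \<le> (\<sigma> * (hi\<^sup>2 / lo))\<^sup>2" by (rule power_mono)
      also have "\<dots> = \<sigma>\<^sup>2 * (hi^4 / lo\<^sup>2)" by (simp add: power_mult_distrib power_divide)
      finally show "(\<sigma> * (x j)\<^sup>2 / xo j)\<^sup>2 \<le> \<sigma>\<^sup>2 * (hi^4 / lo\<^sup>2)" .
    qed
    show "(\<Sum>p<m. (\<Sum>j<n. W p j * u j)\<^sup>2) \<le> c * (\<sigma>\<^sup>2 * hi\<^sup>2) * (\<Sum>j<n. (u j)\<^sup>2)" for u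
      unfolding W_def
    proof (rule op_bound_weighted[OF op c])
      fix j assume j: "j < n"
      have "(xo j)\<^sup>2 \<le> hi\<^sup>2" using bnd[OF j] pos[OF j] by (intro power_mono) auto
      then show "(\<sigma> * xo j)\<^sup>2 \<le> \<sigma>\<^sup>2 * hi\<^sup>2" unfolding power_mult_distrib by (intro mult_left_mono) auto
    qed
    show "0 \<le> c * (\<sigma>\<^sup>2 * (hi^4 / lo\<^sup>2))" using c by simp
  qed
  also have "\<dots> = \<sigma>^4 * (c\<^sup>2 * (hi^6 / lo\<^sup>2) * frob2 n N)"
    by (simp add: field_simps power2_eq_square eval_nat_numeral)
  finally show ?thesis unfolding N_def by (rule mult_left_le_imp_le) (use \<sigma> in simp)
qed

text \<open>Applying A to its own row q produces the squared row norm S as one coordinate, hence S^2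
  \<le> c S.\<close>

lemma op_bound_row:
  assumes op: "op_bound m n a c" and q: "q < m" and c: "c \<ge> 0"
  shows "(\<Sum>j<n. (a (q, j))\<^sup>2) \<le> c"
proof -
  define S where "S = (\<Sum>j<n. (a (q, j))\<^sup>2)"
  have S0: "S \<ge> 0" unfolding S_def by (intro sum_nonneg) auto
  have "S\<^sup>2 = (\<Sum>j<n. a (q, j) * a (q, j))\<^sup>2" by (simp add: S_def power2_eq_square)
  also have "\<dots> \<le> (\<Sum>p<m. (\<Sum>j<n. a (p, j) * a (q, j))\<^sup>2)"
    using q by (intro member_le_sum) auto
  also have "\<dots> \<le> c * S" unfolding S_def by (rule op_boundD[OF op])
  finally have "S * S \<le> c * S" by (simp add: power2_eq_square)
  then show ?thesis using S0 c unfolding S_def[symmetric] by (cases "S = 0") auto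
qed

text \<open>The positive semidefinite matrix D A_Q^T A_Q D. Its form at a row a_p is the energy of
  the pairs (p, q) with q in \<open>Q\<close>, quadratic in a_p once the rows in \<open>Q\<close>
  are frozen.\<close>

definition rowcov :: "nat set \<Rightarrow> (nat \<times> nat \<Rightarrow> real) \<Rightarrow> (nat \<Rightarrow> real) \<Rightarrow> nat \<Rightarrow> nat \<Rightarrow> real" where
  "rowcov Q a d j k = (\<Sum>q\<in>Q. (d j * a (q, j)) * (d k * a (q, k)))"

lemma qform_rowcov: "qform {..<n} (rowcov Q a d) u = (\<Sum>q\<in>Q. (\<Sum>j<n. d j * a (q, j) * u j)\<^sup>2)"
proof -
  have "qform {..<n} (rowcov Q a d) u = (\<Sum>j<n. \<Sum>k<n. \<Sum>q\<in>Q. (d j * a (q, j) * u j) * (d k * a (q, k) * u k))"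
    unfolding qform_def rowcov_def by (simp add: sum_distrib_left sum_distrib_right mult_ac)
  also have "\<dots> = (\<Sum>j<n. \<Sum>q\<in>Q. \<Sum>k<n. (d j * a (q, j) * u j) * (d k * a (q, k) * u k))"
    by (rule sum.cong[OF refl]) (rule sum.swap)
  also have "\<dots> = (\<Sum>q\<in>Q. \<Sum>j<n. \<Sum>k<n. (d j * a (q, j) * u j) * (d k * a (q, k) * u k))"
    by (rule sum.swap)
  finally show ?thesis by (simp add: power2_eq_square sum_product)
qed

lemma frob2_rowcov: "frob2 n (rowcov Q a d) = (\<Sum>q\<in>Q. \<Sum>r\<in>Q. (\<Sum>j<n. (d j)\<^sup>2 * a (q, j) * a (r, j))\<^sup>2)"
proof -
  define b where "b = (\<lambda>q j. d j * a (q, j))"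
  have "frob2 n (rowcov Q a d) = (\<Sum>j<n. \<Sum>k<n. \<Sum>q\<in>Q. \<Sum>r\<in>Q. (b q j * b q k) * (b r j * b r k))"
    unfolding frob2_def rowcov_def b_def power2_eq_square sum_product ..
  also have "\<dots> = (\<Sum>j<n. \<Sum>q\<in>Q. \<Sum>k<n. \<Sum>r\<in>Q. (b q j * b q k) * (b r j * b r k))"
    by (rule sum.cong[OF refl]) (rule sum.swap)
  also have "\<dots> = (\<Sum>j<n. \<Sum>q\<in>Q. \<Sum>r\<in>Q. \<Sum>k<n. (b q j * b q k) * (b r j * b r k))"
    by (rule sum.cong[OF refl], rule sum.cong[OF refl]) (rule sum.swap)
  also have "\<dots> = (\<Sum>q\<in>Q. \<Sum>j<n. \<Sum>r\<in>Q. \<Sum>k<n. (b q j * b q k) * (b r j * b r k))"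
    by (rule sum.swap)
  also have "\<dots> = (\<Sum>q\<in>Q. \<Sum>r\<in>Q. \<Sum>j<n. \<Sum>k<n. (b q j * b q k) * (b r j * b r k))"
    by (rule sum.cong[OF refl]) (rule sum.swap)
  also have "\<dots> = (\<Sum>q\<in>Q. \<Sum>r\<in>Q. (\<Sum>j<n. b q j * b r j)\<^sup>2)"
    unfolding power2_eq_square sum_product
    by (intro sum.cong refl) (simp add: mult_ac)
  finally show ?thesis by (simp add: b_def power2_eq_square mult_ac)
qed

text \<open>For each row a_q the inner sum is at most |A D^2 a_q|^2, bounded by c times
  \<open>D\<close> (the bound on the fourth powers) times |a_q|^2, and the row norm is again
  controlled by the operator norm.\<close>

lemma frob2_rowcov_le:
  assumes op: "op_bound m n a c" and c: "c \<ge> 0" and Q: "Q \<subseteq> {..<m}" and D: "D \<ge> 0"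
    and d: "\<And>j. j < n \<Longrightarrow> (d j)^4 \<le> D"
  shows "frob2 n (rowcov Q a d) \<le> real m * (c\<^sup>2 * D)"
proof -
  have "frob2 n (rowcov Q a d) \<le> (\<Sum>q\<in>Q. c\<^sup>2 * D)"
    unfolding frob2_rowcov
  proof (rule sum_mono)
    fix q assume "q \<in> Q"
    then have q: "q < m" using Q by auto
    have "(\<Sum>r\<in>Q. (\<Sum>j<n. (d j)\<^sup>2 * a (q, j) * a (r, j))\<^sup>2) \<le> (\<Sum>r<m. (\<Sum>j<n. (d j)\<^sup>2 * a (q, j) * a (r, j))\<^sup>2)"
      using Q by (intro sum_mono2) auto
    also have "\<dots> = (\<Sum>r<m. (\<Sum>j<n. a (r, j) * (d j)\<^sup>2 * a (q, j))\<^sup>2)"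
      by (simp add: mult_ac)
    also have "\<dots> \<le> c * D * (\<Sum>j<n. (a (q, j))\<^sup>2)"
      by (rule op_bound_weighted[OF op c]) (use d in simp)
    also have "\<dots> \<le> c\<^sup>2 * D"
    proof -
      have "c * D * (\<Sum>j<n. (a (q, j))\<^sup>2) \<le> c * D * c"
        using D c op_bound_row[OF op q c] by (intro mult_left_mono) auto
      then show ?thesis by (simp add: power2_eq_square mult_ac)
    qed
    finally show "(\<Sum>r\<in>Q. (\<Sum>j<n. (d j)\<^sup>2 * a (q, j) * a (r, j))\<^sup>2) \<le> c\<^sup>2 * D" .
  qed
  also have "\<dots> = real (card Q) * (c\<^sup>2 * D)" by simp
  also have "\<dots> \<le> real m * (c\<^sup>2 * D)"
    using D card_mono[OF _ Q] by (intro mult_right_mono) auto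
  finally show ?thesis .
qed

lemma energy_ge_rows:
  assumes P: "P \<subseteq> {..<m}" and Q: "Q \<subseteq> {..<m}"
  shows "(\<Sum>p\<in>P. qform {..<n} (rowcov Q a d) (\<lambda>j. a (p, j))) \<le> energy m n a d"
proof -
  have "(\<Sum>p\<in>P. qform {..<n} (rowcov Q a d) (\<lambda>j. a (p, j))) = (\<Sum>p\<in>P. \<Sum>q\<in>Q. (\<Sum>j<n. d j * a (p, j) * a (q, j))\<^sup>2)"
    unfolding qform_rowcov by (simp add: mult_ac)
  also have "\<dots> \<le> (\<Sum>p\<in>P. \<Sum>q<m. (\<Sum>j<n. d j * a (p, j) * a (q, j))\<^sup>2)"
    using Q by (intro sum_mono sum_mono2) auto
  also have "\<dots> \<le> energy m n a d" unfolding energy_def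
    using P by (intro sum_mono2 sum_nonneg) auto
  finally show ?thesis .
qed

lemma trc_rowcov: "trc n (rowcov Q a d) = (\<Sum>q\<in>Q. \<Sum>j<n. (d j)\<^sup>2 * (a (q, j))\<^sup>2)"
  unfolding trc_def rowcov_def by (subst sum.swap) (simp add: power2_eq_square mult_ac)

section \<open>Nets\<close>

text \<open>Since exp (-z^2) \<le> 2^(-|z|), the sum is dominated by a two-sided geometric series
  with limit 3.\<close>

lemma sum_exp_int_le: "(\<Sum>z\<in>{- int b..int b}. exp (- (real_of_int z)\<^sup>2)) \<le> 3 - 2 * (1/2)^b"
proof (induction b)
  case 0
  then show ?case by simp
next
  case (Suc b)
  have e: "exp (- (real (Suc b))\<^sup>2) \<le> (1/2)^Suc b"
  proof -
    have "exp (- (real (Suc b))\<^sup>2) \<le> exp (- real (Suc b))"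
      by (simp add: power2_eq_square del: of_nat_Suc)
    also have "\<dots> = exp (-1) ^ Suc b" using exp_of_nat_mult[of "Suc b" "-1::real"] by simp
    also have "\<dots> \<le> (1/2)^Suc b"
    proof (rule power_mono)
      have "2 \<le> exp (1::real)" using exp_ge_add_one_self[of 1] by simp
      then show "exp (-1) \<le> (1/2::real)" by (simp add: exp_minus field_simps)
    qed simp
    finally show ?thesis .
  qed
  have "{- int (Suc b)..int (Suc b)} = insert (- int (Suc b)) (insert (int (Suc b)) {- int b..int b})" by auto
  then have "(\<Sum>z\<in>{- int (Suc b)..int (Suc b)}. exp (- (real_of_int z)\<^sup>2))
    = 2 * exp (- (real (Suc b))\<^sup>2) + (\<Sum>z\<in>{- int b..int b}. exp (- (real_of_int z)\<^sup>2))"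
    by (simp add: power2_eq_square algebra_simps)
  also have "\<dots> \<le> 2 * (1/2)^Suc b + (3 - 2 * (1/2)^b)" using e Suc.IH by linarith
  finally show ?case by simp
qed

text \<open>Divided by 2 sqrt n these are lattice points of the unit ball with mesh 1 / (2 sqrt n).
  The coordinate range follows from the norm bound and makes finiteness immediate.\<close>

definition lattice_ball :: "nat \<Rightarrow> (nat \<Rightarrow> int) set" where
  "lattice_ball n = {z \<in> {..<n} \<rightarrow>\<^sub>E {- int (2 * n)..int (2 * n)}. (\<Sum>j<n. (real_of_int (z j))\<^sup>2) \<le> 4 * real n}"

lemma finite_lattice_ball: "finite (lattice_ball n)"
  unfolding lattice_ball_def by (rule finite_subset[OF _ finite_PiE[of "{..<n}" "\<lambda>_. {- int (2 * n)..int (2 * n)}"]]) auto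

text \<open>Each point is counted with weight exp (4 n - |z|^2) \<ge> 1. The sum then factorises
  over the coordinates, each factor being at most 3 \<le> exp 2.\<close>

lemma card_lattice_ball: "real (card (lattice_ball n)) \<le> exp (6 * real n)"
proof -
  let ?B = "{- int (2 * n)..int (2 * n)}"
  have "real (card (lattice_ball n)) = (\<Sum>z\<in>lattice_ball n. 1)" by simp
  also have "\<dots> \<le> (\<Sum>z\<in>lattice_ball n. exp (4 * real n) * (\<Prod>j<n. exp (- (real_of_int (z j))\<^sup>2)))"
  proof (rule sum_mono)
    fix z assume "z \<in> lattice_ball n"
    then have "0 \<le> 4 * real n - (\<Sum>j<n. (real_of_int (z j))\<^sup>2)" by (simp add: lattice_ball_def)
    then have "1 \<le> exp (4 * real n - (\<Sum>j<n. (real_of_int (z j))\<^sup>2))" by simp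
    also have "\<dots> = exp (4 * real n) * (\<Prod>j<n. exp (- (real_of_int (z j))\<^sup>2))"
      by (simp add: exp_diff exp_sum[symmetric] exp_minus[symmetric] sum_negf divide_inverse)
    finally show "1 \<le> exp (4 * real n) * (\<Prod>j<n. exp (- (real_of_int (z j))\<^sup>2))" .
  qed
  also have "\<dots> \<le> (\<Sum>z\<in>{..<n} \<rightarrow>\<^sub>E ?B. exp (4 * real n) * (\<Prod>j<n. exp (- (real_of_int (z j))\<^sup>2)))"
  proof (rule sum_mono2)
    show "finite ({..<n} \<rightarrow>\<^sub>E ?B)" by (rule finite_PiE) simp_all
    show "lattice_ball n \<subseteq> {..<n} \<rightarrow>\<^sub>E ?B" unfolding lattice_ball_def by blast
  qed (intro mult_nonneg_nonneg prod_nonneg; simp)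
  also have "\<dots> = exp (4 * real n) * (\<Prod>j<n. \<Sum>z\<in>?B. exp (- (real_of_int z)\<^sup>2))"
    unfolding sum_distrib_left[symmetric] by (subst prod_sum_PiE) simp_all
  also have "\<dots> = exp (4 * real n) * (\<Sum>z\<in>?B. exp (- (real_of_int z)\<^sup>2)) ^ n" by (simp only: prod_constant card_lessThan)
  also have "\<dots> \<le> exp (4 * real n) * exp 2 ^ n"
  proof (intro mult_left_mono power_mono)
    have "(\<Sum>z\<in>?B. exp (- (real_of_int z)\<^sup>2)) \<le> 3"
    proof -
      have "0 \<le> 2 * (1/2::real)^(2 * n)" by simp
      then show ?thesis using sum_exp_int_le[of "2 * n"] by linarith
    qed
    also have "3 \<le> exp (2::real)" using exp_ge_add_one_self[of 2] by simp
    finally show "(\<Sum>z\<in>?B. exp (- (real_of_int z)\<^sup>2)) \<le> exp 2" .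
  qed (auto intro: sum_nonneg)
  also have "\<dots> = exp (6 * real n)" by (simp add: exp_of_nat_mult[symmetric] exp_add[symmetric] mult.commute)
  finally show ?thesis .
qed

lemma lattice_rounding:
  assumes n: "n > 0" and u: "(\<Sum>j<n. (u j)\<^sup>2) \<le> 1"
  obtains z where "z \<in> lattice_ball n" "(\<Sum>j<n. (u j - real_of_int (z j) / (2 * sqrt (real n)))\<^sup>2) \<le> 1/4"
proof
  define s where "s = 2 * sqrt (real n)"
  have s: "s > 0" "s\<^sup>2 = 4 * real n" using n by (auto simp: s_def power_mult_distrib)
  \<comment> \<open>Truncation towards zero instead of the floor: it never increases the absolute
    value, so the rounded vector stays in the ball.\<close>
  define t where "t = (\<lambda>x::real. if x \<ge> 0 then \<lfloor>x\<rfloor> else - \<lfloor>- x\<rfloor>)"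
  have t: "(real_of_int (t x))\<^sup>2 \<le> x\<^sup>2" "(x - real_of_int (t x))\<^sup>2 \<le> 1" for x
  proof -
    have fl: "0 \<le> y \<Longrightarrow> \<bar>real_of_int \<lfloor>y\<rfloor>\<bar> \<le> y \<and> \<bar>y - real_of_int \<lfloor>y\<rfloor>\<bar> \<le> 1" for y :: real
    proof -
      assume "0 \<le> y"
      then have "0 \<le> real_of_int \<lfloor>y\<rfloor>" by simp
      then show ?thesis using floor_correct[of y] unfolding abs_le_iff by linarith
    qed
    have "\<bar>real_of_int (t x)\<bar> \<le> \<bar>x\<bar>" using fl[of x] fl[of "- x"] by (cases "x \<ge> 0") (auto simp: t_def)
    then show "(real_of_int (t x))\<^sup>2 \<le> x\<^sup>2" by (simp add: abs_le_square_iff)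
    have "\<bar>x - real_of_int (t x)\<bar> \<le> \<bar>1\<bar>"
      using fl[of x] fl[of "- x"] of_int_floor_le[of "- x"] unfolding t_def
      by (cases "x \<ge> 0"; simp; linarith)
    then show "(x - real_of_int (t x))\<^sup>2 \<le> 1" unfolding abs_le_square_iff by simp
  qed
  define z where "z = (\<lambda>j\<in>{..<n}. t (s * u j))"
  have zs: "(\<Sum>j<n. (real_of_int (z j))\<^sup>2) \<le> 4 * real n"
  proof -
    have "(\<Sum>j<n. (real_of_int (z j))\<^sup>2) \<le> (\<Sum>j<n. (s * u j)\<^sup>2)"
      by (intro sum_mono) (simp add: z_def t)
    also have "\<dots> = s\<^sup>2 * (\<Sum>j<n. (u j)\<^sup>2)" by (simp add: power_mult_distrib sum_distrib_left)
    also have "\<dots> \<le> s\<^sup>2 * 1" using u by (intro mult_left_mono) auto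
    finally show ?thesis using s by simp
  qed
  show "(\<lambda>j\<in>{..<n}. t (s * u j)) \<in> lattice_ball n"
    unfolding lattice_ball_def z_def[symmetric]
  proof (intro CollectI conjI zs PiE_I)
    fix j assume j: "j \<in> {..<n}"
    have "(real_of_int (z j))\<^sup>2 \<le> 4 * real n"
      using member_le_sum[of j "{..<n}" "\<lambda>j. (real_of_int (z j))\<^sup>2"] j zs by simp
    also have "\<dots> \<le> (2 * real n)\<^sup>2" using n by (simp add: power2_eq_square)
    finally have "\<bar>real_of_int (z j)\<bar> \<le> \<bar>2 * real n\<bar>" unfolding abs_le_square_iff .
    then show "z j \<in> {- int (2 * n)..int (2 * n)}" by auto
  qed (simp add: z_def)
  have "(\<Sum>j<n. (u j - real_of_int (z j) / s)\<^sup>2) \<le> (\<Sum>j<n. 1 / s\<^sup>2)"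
  proof (rule sum_mono)
    fix j assume j: "j \<in> {..<n}"
    have "u j - real_of_int (z j) / s = (s * u j - real_of_int (t (s * u j))) / s"
      using s j by (simp add: z_def field_simps)
    then have "(u j - real_of_int (z j) / s)\<^sup>2 = (s * u j - real_of_int (t (s * u j)))\<^sup>2 / s\<^sup>2"
      by (simp add: power_divide)
    also have "\<dots> \<le> 1 / s\<^sup>2" by (intro divide_right_mono t) auto
    finally show "(u j - real_of_int (z j) / s)\<^sup>2 \<le> 1 / s\<^sup>2" .
  qed
  also have "\<dots> \<le> 1/4" using s n by simp
  finally show "(\<Sum>j<n. (u j - real_of_int ((\<lambda>j\<in>{..<n}. t (s * u j)) j) / (2 * sqrt (real n)))\<^sup>2) \<le> 1/4"
    unfolding z_def s_def .
qed

text \<open>Rounding a unit vector to the lattice leaves a remainder of length at most 1/2, so the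
  operator norm is at most its lattice version plus half of itself.\<close>
lemma op_bound_lattice:
  assumes n: "n > 0" and c: "c \<ge> 0"
    and z: "\<And>z. z \<in> lattice_ball n \<Longrightarrow> (\<Sum>p<m. (\<Sum>j<n. a (p, j) * real_of_int (z j))\<^sup>2) \<le> c * (real n)\<^sup>2"
  shows "op_bound m n a (c * real n)"
proof -
  define NA where "NA = (\<lambda>u. L2_set (\<lambda>p. \<Sum>j<n. a (p, j) * u j) {..<m})"
  define B where "B = {u :: nat \<Rightarrow> real. L2_set u {..<n} \<le> 1}"
  define M where "M = Sup (NA ` B)"
  have add: "NA (\<lambda>j. u j + v j) \<le> NA u + NA v" for u v
    unfolding NA_def using L2_set_triangle_ineq[of "\<lambda>p. \<Sum>j<n. a (p, j) * u j" "\<lambda>p. \<Sum>j<n. a (p, j) * v j" "{..<m}"]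
    by (simp add: distrib_left sum.distrib)
  have scale: "NA (\<lambda>j. r * u j) = r * NA u" if "r \<ge> 0" for r u
  proof -
    have "NA (\<lambda>j. r * u j) = L2_set (\<lambda>p. r * (\<Sum>j<n. a (p, j) * u j)) {..<m}"
      unfolding NA_def by (simp add: sum_distrib_left mult_ac)
    then show ?thesis unfolding NA_def by (simp add: L2_set_right_distrib[OF that])
  qed
  \<comment> \<open>Absorbing M/2 into the left-hand side requires the supremum to be finite
    beforehand; a crude bound by the row norms is enough.\<close>
  have bdd: "bdd_above (NA ` B)"
  proof (rule bdd_aboveI2)
    fix u assume u: "u \<in> B"
    have "\<bar>\<Sum>j<n. a (p, j) * u j\<bar> \<le> L2_set (\<lambda>j. a (p, j)) {..<n}" for p
    proof -
      have "\<bar>\<Sum>j<n. a (p, j) * u j\<bar> \<le> (\<Sum>j<n. \<bar>a (p, j)\<bar> * \<bar>u j\<bar>)"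
        using sum_abs[of "\<lambda>j. a (p, j) * u j" "{..<n}"] by (simp add: abs_mult)
      also have "\<dots> \<le> L2_set (\<lambda>j. a (p, j)) {..<n} * L2_set u {..<n}" by (rule L2_set_mult_ineq)
      also have "\<dots> \<le> L2_set (\<lambda>j. a (p, j)) {..<n} * 1"
        using u by (intro mult_left_mono) (auto simp: B_def)
      finally show ?thesis by simp
    qed
    then show "NA u \<le> (\<Sum>p<m. L2_set (\<lambda>j. a (p, j)) {..<n})"
      unfolding NA_def by (intro order_trans[OF L2_set_le_sum_abs] sum_mono)
  qed
  have B0: "(\<lambda>_. 0) \<in> B" by (simp add: B_def L2_set_def)
  have M: "NA u \<le> M" if "u \<in> B" for u
    unfolding M_def using that by (intro cSup_upper bdd) auto
  have M0: "M \<ge> 0" using M[OF B0] unfolding NA_def by (meson L2_set_nonneg order_trans)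
  have "M \<le> sqrt (c * real n) / 2 + M / 2"
    unfolding M_def
  proof (rule cSup_least)
    show "NA ` B \<noteq> {}" using B0 by auto
    fix y assume "y \<in> NA ` B"
    then obtain u where u: "u \<in> B" "y = NA u" by auto
    have u1: "(\<Sum>j<n. (u j)\<^sup>2) \<le> 1" using u(1) by (simp add: B_def L2_set_def)
    obtain k where k: "k \<in> lattice_ball n" "(\<Sum>j<n. (u j - real_of_int (k j) / (2 * sqrt (real n)))\<^sup>2) \<le> 1/4"
      using lattice_rounding[OF n u1] by blast
    define v where "v = (\<lambda>j. real_of_int (k j))"
    define r where "r = (\<lambda>j. 2 * (u j - v j / (2 * sqrt (real n))))"
    have "u j = 1 / (2 * sqrt (real n)) * v j + 1/2 * r j" for j
      by (simp add: r_def field_simps)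
    then have "NA u = NA (\<lambda>j. 1 / (2 * sqrt (real n)) * v j + 1/2 * r j)" by (metis (no_types, lifting) ext)
    also have "\<dots> \<le> NA (\<lambda>j. 1 / (2 * sqrt (real n)) * v j) + NA (\<lambda>j. 1/2 * r j)" by (rule add)
    also have "\<dots> = 1 / (2 * sqrt (real n)) * NA v + 1/2 * NA r"
      by (subst (1 2) scale) auto
    also have "\<dots> \<le> sqrt (c * real n) / 2 + M / 2"
    proof (rule add_mono)
      have "NA v \<le> sqrt (c * (real n)\<^sup>2)"
        unfolding NA_def L2_set_def v_def by (intro real_sqrt_le_mono z k)
      also have "\<dots> = sqrt (c * real n) * sqrt (real n)" by (simp add: real_sqrt_mult power2_eq_square)
      finally have "1 / (2 * sqrt (real n)) * NA v \<le> 1 / (2 * sqrt (real n)) * (sqrt (c * real n) * sqrt (real n))"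
        by (intro mult_left_mono) auto
      then show "1 / (2 * sqrt (real n)) * NA v \<le> sqrt (c * real n) / 2" using n by simp
      have "(\<Sum>j<n. (r j)\<^sup>2) = 4 * (\<Sum>j<n. (u j - real_of_int (k j) / (2 * sqrt (real n)))\<^sup>2)"
        unfolding r_def v_def power_mult_distrib sum_distrib_left by simp
      then have "(\<Sum>j<n. (r j)\<^sup>2) \<le> 1" using k(2) by simp
      then have "r \<in> B" by (simp add: B_def L2_set_def)
      then show "1/2 * NA r \<le> M / 2" using M by simp
    qed
    finally show "y \<le> sqrt (c * real n) / 2 + Sup (NA ` B) / 2" unfolding u(2) M_def .
  qed
  then have Ms: "M \<le> sqrt (c * real n)" by simp
  show ?thesis unfolding op_bound_def
  proof
    fix u :: "nat \<Rightarrow> real"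
    define l where "l = L2_set u {..<n}"
    have l0: "l \<ge> 0" by (simp add: l_def)
    have l2: "l\<^sup>2 = (\<Sum>j<n. (u j)\<^sup>2)" unfolding l_def L2_set_def by (simp add: sum_nonneg)
    have "NA u \<le> M * l"
    proof (cases "l = 0")
      case True
      then have "u j = 0" if "j < n" for j using that l2 by (auto simp: sum_nonneg_eq_0_iff)
      then have "NA u = 0" unfolding NA_def L2_set_def by simp
      then show ?thesis using True by simp
    next
      case False
      have "L2_set (\<lambda>j. 1 / l * u j) {..<n} = 1 / l * l"
        unfolding l_def by (rule L2_set_right_distrib[symmetric]) auto
      then have "(\<lambda>j. 1 / l * u j) \<in> B" using False by (simp add: B_def)
      from M[OF this] have "1 / l * NA u \<le> M" using scale[of "1 / l" u] l0 by simp
      then show ?thesis using False l0 by (simp add: field_simps)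
    qed
    also have "\<dots> \<le> sqrt (c * real n) * l" using Ms l0 by (intro mult_right_mono)
    finally have "(NA u)\<^sup>2 \<le> (sqrt (c * real n) * l)\<^sup>2"
      by (intro power_mono) (simp_all add: NA_def)
    moreover have "(NA u)\<^sup>2 = (\<Sum>p<m. (\<Sum>j<n. a (p, j) * u j)\<^sup>2)"
      unfolding NA_def L2_set_def by (simp add: sum_nonneg)
    ultimately show "(\<Sum>p<m. (\<Sum>j<n. a (p, j) * u j)\<^sup>2) \<le> c * real n * (\<Sum>j<n. (u j)\<^sup>2)"
      using c by (simp add: power_mult_distrib l2)
  qed
qed

section \<open>A net inside the signal set\<close>

lemma l2norm_eq: "l2norm v = L2_set (\<lambda>i. v $ i) {..<dim_vec v}"
  by (simp add: l2norm_def L2_set_def scalar_prod_def power2_eq_square atLeast0LessThan)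

lemma l2norm_diff_sq:
  assumes "dim_vec v = n" "dim_vec u = n"
  shows "(l2norm (u - v))\<^sup>2 = (\<Sum>i<n. (u $ i - v $ i)\<^sup>2)"
proof -
  have "l2norm (u - v) = L2_set (\<lambda>i. u $ i - v $ i) {..<n}"
    unfolding l2norm_eq using assms by (intro L2_set_cong) auto
  then show ?thesis by (simp add: L2_set_def sum_nonneg)
qed

text \<open>Two points of the image are close as soon as their parameters lie in a common cell of a
  cubic grid; one point of the set is picked per occupied cell.\<close>
lemma lipschitz_net:
  fixes g :: "real Matrix.vec \<Rightarrow> real Matrix.vec"
  assumes k: "k \<ge> 1" and \<delta>: "\<delta> > 0" and \<rho>: "\<rho> \<ge> 0"
    and lip: "\<And>\<theta> \<theta>'. dim_vec \<theta> = k \<Longrightarrow> l2norm \<theta> \<le> \<rho> \<Longrightarrow> dim_vec \<theta>' = k \<Longrightarrow> l2norm \<theta>' \<le> \<rho> \<Longrightarrow>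
       l2norm (g \<theta> - g \<theta>') \<le> l2norm (\<theta> - \<theta>')"
    and C: "C \<subseteq> g ` {\<theta>. dim_vec \<theta> = k \<and> l2norm \<theta> \<le> \<rho>}"
  obtains F where "finite F" "F \<subseteq> C" "\<And>x. x \<in> C \<Longrightarrow> \<exists>x'\<in>F. l2norm (x - x') \<le> \<delta>"
    "real (card F) \<le> (2 * (\<rho> * sqrt (real k) / \<delta>) + 3) ^ k"
proof -
  define h where "h = \<delta> / sqrt (real k)"
  have h: "h > 0" using \<delta> k by (simp add: h_def)
  \<comment> \<open>Cells have side h = \<delta> / sqrt k, hence diameter at most \<delta>. Rounding
    up gives 2 N + 1 \<le> 2 \<rho> / h + 3 cells per axis, which is the 3 in the cardinality
    bound.\<close>
  define N where "N = nat \<lceil>\<rho> / h\<rceil>"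
  have \<rho>h: "\<rho> / h \<ge> 0" using \<rho> h by simp
  have N: "\<rho> / h \<le> real N" "real N \<le> \<rho> / h + 1" unfolding N_def using \<rho>h by linarith+
  have "\<forall>x\<in>C. \<exists>\<theta>. dim_vec \<theta> = k \<and> l2norm \<theta> \<le> \<rho> \<and> g \<theta> = x" using C by auto
  then obtain \<Theta> where \<Theta>: "\<And>x. x \<in> C \<Longrightarrow> dim_vec (\<Theta> x) = k" "\<And>x. x \<in> C \<Longrightarrow> l2norm (\<Theta> x) \<le> \<rho>"
    "\<And>x. x \<in> C \<Longrightarrow> g (\<Theta> x) = x" by metis
  define cell where "cell = (\<lambda>x. \<lambda>i\<in>{..<k}. \<lfloor>\<Theta> x $ i / h\<rfloor>)"
  have cells: "cell ` C \<subseteq> {..<k} \<rightarrow>\<^sub>E {- int N..int N}"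
  proof (intro image_subsetI PiE_I)
    fix x i assume x: "x \<in> C" and i: "i \<in> {..<k}"
    have "\<bar>\<Theta> x $ i\<bar> \<le> l2norm (\<Theta> x)"
      unfolding l2norm_eq using member_le_L2_set[of "{..<dim_vec (\<Theta> x)}" i "\<lambda>i. \<bar>\<Theta> x $ i\<bar>"] i \<Theta>(1)[OF x]
      by (simp add: L2_set_def)
    also have "\<dots> \<le> \<rho>" by (rule \<Theta>(2)[OF x])
    finally have "\<bar>\<Theta> x $ i / h\<bar> \<le> \<rho> / h" using h by (simp add: divide_right_mono)
    then have "\<bar>\<Theta> x $ i / h\<bar> \<le> real N" using N(1) by linarith
    then have "- int N \<le> \<lfloor>\<Theta> x $ i / h\<rfloor>" "\<lfloor>\<Theta> x $ i / h\<rfloor> \<le> int N" by linarith+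
    then show "cell x i \<in> {- int N..int N}" using i by (simp add: cell_def)
  qed (simp add: cell_def)
  have fin: "finite ({..<k} \<rightarrow>\<^sub>E {- int N..int N})" by (intro finite_PiE) auto
  \<comment> \<open>Choosing points of \<open>C\<close> rather than images of grid points keeps the
    net inside the box of admissible signals.\<close>
  define F where "F = (\<lambda>c. SOME x. x \<in> C \<and> cell x = c) ` (cell ` C)"
  have pick: "(SOME y. y \<in> C \<and> cell y = cell x) \<in> C \<and> cell (SOME y. y \<in> C \<and> cell y = cell x) = cell x" if "x \<in> C" for x
    by (rule someI[of _ x]) (use that in simp)
  show ?thesis
  proof
    show "finite F" unfolding F_def using finite_subset[OF cells fin] by simp
    show "F \<subseteq> C" unfolding F_def using pick by auto
    have "card F \<le> card (cell ` C)" unfolding F_def by (rule card_image_le) (rule finite_subset[OF cells fin])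
    also have "\<dots> \<le> card ({..<k} \<rightarrow>\<^sub>E {- int N..int N})" by (rule card_mono[OF fin cells])
    also have "\<dots> = (2 * N + 1) ^ k" by (simp add: card_PiE nat_add_distrib nat_mult_distrib)
    finally have "real (card F) \<le> real ((2 * N + 1) ^ k)" by (simp only: of_nat_le_iff)
    also have "\<dots> = (2 * real N + 1) ^ k" by (simp add: add.commute)
    also have "\<dots> \<le> (2 * (\<rho> * sqrt (real k) / \<delta>) + 3) ^ k"
      using N(2) by (intro power_mono) (simp_all add: h_def)
    finally show "real (card F) \<le> (2 * (\<rho> * sqrt (real k) / \<delta>) + 3) ^ k" .
    fix x assume x: "x \<in> C"
    define y where "y = (SOME y. y \<in> C \<and> cell y = cell x)"
    have y: "y \<in> C" "cell y = cell x" using pick[OF x] by (auto simp: y_def)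
    have "y \<in> F" unfolding F_def y_def using x by blast
    moreover have "l2norm (x - y) \<le> \<delta>"
    proof -
      have "l2norm (x - y) \<le> l2norm (\<Theta> x - \<Theta> y)"
        using lip[OF \<Theta>(1,2)[OF x] \<Theta>(1,2)[OF y(1)]] \<Theta>(3)[OF x] \<Theta>(3)[OF y(1)] by simp
      also have "\<dots> \<le> \<delta>"
      proof (rule power2_le_imp_le)
        have "(l2norm (\<Theta> x - \<Theta> y))\<^sup>2 = (\<Sum>i<k. (\<Theta> x $ i - \<Theta> y $ i)\<^sup>2)"
          by (rule l2norm_diff_sq[OF \<Theta>(1)[OF y(1)] \<Theta>(1)[OF x]])
        also have "\<dots> \<le> (\<Sum>i<k. h\<^sup>2)"
        proof (rule sum_mono)
          fix i assume i: "i \<in> {..<k}"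
          have "\<lfloor>\<Theta> y $ i / h\<rfloor> = \<lfloor>\<Theta> x $ i / h\<rfloor>" using fun_cong[OF y(2), of i] i by (simp add: cell_def)
          then have "\<bar>\<Theta> x $ i / h - \<Theta> y $ i / h\<bar> \<le> 1" by linarith
          then have "\<bar>\<Theta> x $ i - \<Theta> y $ i\<bar> \<le> \<bar>h\<bar>" using h by (simp add: diff_divide_distrib[symmetric] field_simps)
          then show "(\<Theta> x $ i - \<Theta> y $ i)\<^sup>2 \<le> h\<^sup>2" unfolding abs_le_square_iff .
        qed
        also have "\<dots> = \<delta>\<^sup>2" using k by (simp add: h_def power_divide)
        finally show "(l2norm (\<Theta> x - \<Theta> y))\<^sup>2 \<le> \<delta>\<^sup>2" .
      qed (use \<delta> in simp)
      finally show ?thesis .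
    qed
    ultimately show "\<exists>x'\<in>F. l2norm (x - x') \<le> \<delta>" by blast
  qed
qed

section \<open>Exponential moments\<close>

lemma (in prob_space) union_exp_markov:
  fixes Y :: "'i \<Rightarrow> 'a \<Rightarrow> real"
  assumes fin: "finite I" and Y: "\<And>i. i \<in> I \<Longrightarrow> Y i \<in> borel_measurable M"
    and le: "\<And>i. i \<in> I \<Longrightarrow> (\<integral>\<^sup>+x. ennreal (exp (Y i x)) \<partial>M) \<le> 1"
  shows "{x \<in> space M. \<exists>i\<in>I. t \<le> Y i x} \<in> sets M"
    "prob {x \<in> space M. \<exists>i\<in>I. t \<le> Y i x} \<le> real (card I) * exp (- t)"
proof -
  have m: "{x \<in> space M. t \<le> Y i x} \<in> sets M" if "i \<in> I" for i
    using Y[OF that] by measurable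
  have eq: "{x \<in> space M. \<exists>i\<in>I. t \<le> Y i x} = (\<Union>i\<in>I. {x \<in> space M. t \<le> Y i x})" by auto
  show "{x \<in> space M. \<exists>i\<in>I. t \<le> Y i x} \<in> sets M" unfolding eq using fin m by auto
  have "prob {x \<in> space M. \<exists>i\<in>I. t \<le> Y i x} \<le> (\<Sum>i\<in>I. prob {x \<in> space M. t \<le> Y i x})"
    unfolding eq by (rule finite_measure_subadditive_finite[OF fin]) (use m in auto)
  also have "\<dots> \<le> (\<Sum>i\<in>I. exp (- t))" by (intro sum_mono exp_markov Y le)
  finally show "prob {x \<in> space M. \<exists>i\<in>I. t \<le> Y i x} \<le> real (card I) * exp (- t)" by simp
qed

abbreviation MA :: "nat \<Rightarrow> nat \<Rightarrow> (nat \<times> nat \<Rightarrow> real) measure" where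
  "MA m n \<equiv> PiM ({..<m} \<times> {..<n}) (\<lambda>_. gaussian 1)"

abbreviation MW :: "nat \<Rightarrow> nat \<Rightarrow> real \<Rightarrow> (nat \<times> nat \<Rightarrow> real) measure" where
  "MW L n \<sigma> \<equiv> PiM ({..<L} \<times> {..<n}) (\<lambda>_. gaussian \<sigma>)"

lemma speckle_space_eq: "speckle_space m n L \<sigma> = MA m n \<Otimes>\<^sub>M MW L n \<sigma>"
  by (simp add: speckle_space_def)

lemma prob_space_gaussian_PiM: "\<sigma> > 0 \<Longrightarrow> prob_space (PiM I (\<lambda>_. gaussian \<sigma>))"
  by (intro prob_space_PiM prob_space_normal_density)

lemma prob_space_speckle: "\<sigma> > 0 \<Longrightarrow> prob_space (speckle_space m n L \<sigma>)"
  unfolding speckle_space_eq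
  by (intro prob_space_pair prob_space_gaussian_PiM) auto

text \<open>The conditional bound is asked only for almost every \<open>a\<close>, because the
  likelihood estimate needs A to have full rank.\<close>

lemma nn_integral_pair_le_1:
  assumes A: "prob_space A" and B: "prob_space B" and f [measurable]: "f \<in> borel_measurable (A \<Otimes>\<^sub>M B)"
    and le: "AE a in A. (\<integral>\<^sup>+w. f (a, w) \<partial>B) \<le> 1"
  shows "(\<integral>\<^sup>+\<omega>. f \<omega> \<partial>(A \<Otimes>\<^sub>M B)) \<le> 1"
proof -
  interpret A: prob_space A by fact
  interpret B: prob_space B by fact
  have "(\<integral>\<^sup>+\<omega>. f \<omega> \<partial>(A \<Otimes>\<^sub>M B)) = (\<integral>\<^sup>+a. \<integral>\<^sup>+w. f (a, w) \<partial>B \<partial>A)"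
    by (rule B.nn_integral_fst[symmetric]) fact
  also have "\<dots> \<le> (\<integral>\<^sup>+a. 1 \<partial>A)" by (rule nn_integral_mono_AE[OF le])
  finally show ?thesis by (simp add: A.emeasure_space_1)
qed

lemma nn_integral_fst_le_1:
  assumes A: "prob_space A" and B: "prob_space B" and f [measurable]: "f \<in> borel_measurable A"
    and le: "(\<integral>\<^sup>+a. f a \<partial>A) \<le> 1"
  shows "(\<integral>\<^sup>+\<omega>. f (fst \<omega>) \<partial>(A \<Otimes>\<^sub>M B)) \<le> 1"
proof -
  interpret B: prob_space B by fact
  have "(\<integral>\<^sup>+\<omega>. f (fst \<omega>) \<partial>(A \<Otimes>\<^sub>M B)) = (\<integral>\<^sup>+a. \<integral>\<^sup>+w. f (fst (a, w)) \<partial>B \<partial>A)"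
    by (rule B.nn_integral_fst[symmetric]) measurable
  then show ?thesis using le by (simp add: B.emeasure_space_1)
qed

lemma qform_diag:
  fixes n :: nat
  shows "qform {..<n} (\<lambda>j k. if j = k then v j else 0) u = (\<Sum>j<n. v j * (u j)\<^sup>2)"
proof -
  have "(\<Sum>k<n. (if j = k then v j else 0) * u j * u k) = v j * (u j)\<^sup>2" if "j < n" for j
  proof -
    have "(\<Sum>k<n. (if j = k then v j else 0) * u j * u k) = (\<Sum>k<n. if j = k then v j * (u j)\<^sup>2 else 0)"
      by (intro sum.cong refl) (auto simp: power2_eq_square)
    also have "\<dots> = v j * (u j)\<^sup>2" using that by (subst sum.delta') auto
    finally show ?thesis .
  qed
  then show ?thesis by (simp add: qform_def)
qed

lemma trc_diag: "trc n (\<lambda>j k. if j = k then v j else 0) = (\<Sum>j<n. v j)"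
  by (simp add: trc_def)

lemma frob2_diag: "frob2 n (\<lambda>j k. if j = k then v j else 0) = (\<Sum>j<n. (v j)\<^sup>2)"
proof -
  have "(\<Sum>k<n. (if j = k then v j else 0)\<^sup>2) = (v j)\<^sup>2" if "j < n" for j
  proof -
    have "(\<Sum>k<n. (if j = k then v j else 0)\<^sup>2) = (\<Sum>k<n. if j = k then (v j)\<^sup>2 else 0)"
      by (intro sum.cong refl) auto
    also have "\<dots> = (v j)\<^sup>2" using that by (subst sum.delta') auto
    finally show ?thesis .
  qed
  then show ?thesis by (simp add: frob2_def)
qed

lemma qform_outer: "qform {..<n} (\<lambda>j k. s * z j * z k) u = s * (\<Sum>j<n. u j * z j)\<^sup>2"
  using qform_rank1[where I = "{..<n}" and Q = "\<lambda>_ _. 0" and c = s and b = z and u = u] by (simp add: qform_def mult.commute)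

lemma frob2_outer: "frob2 n (\<lambda>j k. s * z j * z k) = s\<^sup>2 * (\<Sum>j<n. (z j)\<^sup>2)\<^sup>2"
  using frob_rank1[where I = "{..<n}" and Q = "\<lambda>_ _. 0" and c = s and b = z] by (simp add: frob2_def qform_def)

text \<open>The random variables \<open>Y\<dots>\<close> of this section all satisfy E exp Y \<open>\<le>\<close> 1, so exponential Markov applies uniformly.\<close>
definition Yop :: "nat \<Rightarrow> nat \<Rightarrow> (nat \<Rightarrow> int) \<Rightarrow> (nat \<times> nat \<Rightarrow> real) \<Rightarrow> real" where
  "Yop m n z a = (\<Sum>p<m. (\<Sum>j<n. a (p, j) * real_of_int (z j))\<^sup>2) / (32 * real n) + - (real m * (5/32))"

text \<open>As |z|^2 \<le> 4 n, the factor 1 / (32 n) puts the rank-one matrix exactly within the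
  admissible bound 1/8. Its trace and second-order term then cost at most 1/8 + 2/64 = 5/32 per
  row.\<close>

lemma Yop_mgf:
  assumes n: "n > 0" and z: "z \<in> lattice_ball n"
  shows "(\<integral>\<^sup>+a. ennreal (exp (Yop m n z a)) \<partial>MA m n) \<le> 1"
proof -
  define y where "y = (\<lambda>j. real_of_int (z j))"
  define s where "s = 1 / (32 * real n)"
  have s: "s > 0" using n by (simp add: s_def)
  define S where "S = (\<Sum>j<n. (y j)\<^sup>2)"
  have S: "0 \<le> S" "S \<le> 4 * real n" using z by (auto simp: S_def y_def lattice_ball_def sum_nonneg)
  have sS: "s * S \<le> 1/8" using S n by (simp add: s_def field_simps)
  have e: "Yop m n z a = (\<Sum>p\<in>{..<m}. qform {..<n} (\<lambda>j k. s * y j * y k) (\<lambda>j. a (p, j))) + - (real m * (5/32))" for a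
    unfolding Yop_def qform_outer y_def s_def by (simp add: sum_divide_distrib)
  show ?thesis unfolding e
  proof (rule mgf_block)
    fix u :: "nat \<Rightarrow> real"
    have "(\<Sum>j<n. u j * y j)\<^sup>2 \<le> (\<Sum>j<n. (u j)\<^sup>2) * S" unfolding S_def by (rule Cauchy_Schwarz_ineq_sum)
    then have "s * (\<Sum>j<n. u j * y j)\<^sup>2 \<le> s * ((\<Sum>j<n. (u j)\<^sup>2) * S)" using s by (intro mult_left_mono) auto
    also have "\<dots> = (s * S) * (\<Sum>j<n. (u j)\<^sup>2)" by simp
    also have "\<dots> \<le> 1/8 * (\<Sum>j<n. (u j)\<^sup>2)" using sS by (intro mult_right_mono sum_nonneg) auto
    finally show "1\<^sup>2 * qform {..<n} (\<lambda>j k. s * y j * y k) u \<le> (\<Sum>j<n. (u j)\<^sup>2) / 8"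
      unfolding qform_outer by simp
  next
    have t: "trc n (\<lambda>j k. s * y j * y k) = s * S"
      by (simp add: trc_def S_def sum_distrib_left power2_eq_square mult.assoc)
    have "(s * S)\<^sup>2 \<le> (1/8)\<^sup>2" using sS s S by (intro power_mono) auto
    then have "frob2 n (\<lambda>j k. s * y j * y k) \<le> 1/64" unfolding frob2_outer S_def[symmetric]
      unfolding power_mult_distrib by (simp add: power_divide)
    then have "1\<^sup>2 * trc n (\<lambda>j k. s * y j * y k) + 2 * 1^4 * frob2 n (\<lambda>j k. s * y j * y k) \<le> 5/32"
      using sS unfolding t by simp
    then have "real m * (1\<^sup>2 * trc n (\<lambda>j k. s * y j * y k) + 2 * 1^4 * frob2 n (\<lambda>j k. s * y j * y k)) \<le> real m * (5/32)"
      by (intro mult_left_mono) auto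
    then show "- (real m * (5/32)) + real (card {..<m}) * (1\<^sup>2 * trc n (\<lambda>j k. s * y j * y k) + 2 * 1^4 * frob2 n (\<lambda>j k. s * y j * y k)) \<le> 0"
      by simp
  qed (simp_all add: mult_ac)
qed

text \<open>The threshold 7 n exceeds the log-cardinality 6 n of the lattice ball, leaving
  probability exp (-n). Then 7 n + 5 m / 32 \<le> 8 n, and 8 * 32 = 256.\<close>

lemma Yop_op_bound:
  assumes n: "n > 0" and mn: "m \<le> n" and Y: "\<And>z. z \<in> lattice_ball n \<Longrightarrow> Yop m n z a < 7 * real n"
  shows "op_bound m n a (256 * real n)"
proof (rule op_bound_lattice[OF n])
  fix z assume "z \<in> lattice_ball n"
  from Y[OF this] have "(\<Sum>p<m. (\<Sum>j<n. a (p, j) * real_of_int (z j))\<^sup>2) / (32 * real n) < 7 * real n + real m * (5/32)"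
    by (simp add: Yop_def)
  also have "\<dots> \<le> 8 * real n" using mn by simp
  finally show "(\<Sum>p<m. (\<Sum>j<n. a (p, j) * real_of_int (z j))\<^sup>2) \<le> 256 * (real n)\<^sup>2"
    using n by (simp add: field_simps power2_eq_square)
qed simp

text \<open>\<open>Ydiag\<close> controls the lower tail of the trace of the random matrix \<open>rowcov\<close> of the rows in Q,
  \<open>Yen\<close> the energy of the rows in P conditionally on those in Q.\<close>
definition Ydiag :: "nat set \<Rightarrow> nat \<Rightarrow> real \<Rightarrow> (nat \<Rightarrow> real) \<Rightarrow> (nat \<times> nat \<Rightarrow> real) \<Rightarrow> real" where
  "Ydiag Q n s d a = - s * trc n (rowcov Q a d) + real (card Q) * (s * (\<Sum>j<n. (d j)\<^sup>2) - 2 * s\<^sup>2 * (\<Sum>j<n. (d j)^4))"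

text \<open>The matrix diag(- s d^2) is deterministic and negative semidefinite, so no upper limit
  on \<open>s\<close> arises. The decoupled bound is used with the two blocks exchanged, which also
  integrates out the rows in \<open>P\<close>.\<close>

lemma Ydiag_mgf:
  assumes m: "P \<inter> Q = {}" "Q \<union> P = {..<m}" and s: "s \<ge> 0"
  shows "(\<integral>\<^sup>+a. ennreal (exp (Ydiag Q n s d a)) \<partial>MA m n) \<le> 1"
proof -
  define G :: "(nat \<times> nat \<Rightarrow> real) \<Rightarrow> nat \<Rightarrow> nat \<Rightarrow> real" where "G = (\<lambda>a j k. if j = k then - s * (d j)\<^sup>2 else 0)"
  have e: "Ydiag Q n s d a = (\<Sum>q\<in>Q. qform {..<n} (G a) (\<lambda>j. a (q, j)))
      + - (real (card Q) * (1\<^sup>2 * trc n (G a) + 2 * 1^4 * frob2 n (G a)))" for a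
    unfolding Ydiag_def trc_rowcov G_def qform_diag trc_diag frob2_diag
    by (simp add: sum_negf sum_distrib_left power_mult_distrib power_mult[symmetric] mult_ac)
       (simp add: algebra_simps)
  have f: "finite P" "finite Q" using m by (metis finite_Un finite_lessThan)+
  have "(\<integral>\<^sup>+a. ennreal (exp ((\<Sum>q\<in>Q. qform {..<n} (G a) (\<lambda>j. a (q, j)))
      + - (real (card Q) * (1\<^sup>2 * trc n (G a) + 2 * 1^4 * frob2 n (G a))))) \<partial>PiM ((P \<union> Q) \<times> {..<n}) (\<lambda>_. gaussian 1)) \<le> 1"
  proof (rule mgf_decoupled)
    fix a :: "nat \<times> nat \<Rightarrow> real" and u :: "nat \<Rightarrow> real"
    have e': "qform {..<n} (G a) u = - (s * (\<Sum>j<n. (d j)\<^sup>2 * (u j)\<^sup>2))"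
      unfolding G_def qform_diag by (simp add: sum_negf sum_distrib_left mult_ac)
    have "0 \<le> s * (\<Sum>j<n. (d j)\<^sup>2 * (u j)\<^sup>2)" using s by (intro mult_nonneg_nonneg sum_nonneg) auto
    moreover have "0 \<le> (\<Sum>j<n. (u j)\<^sup>2)" by (intro sum_nonneg) auto
    ultimately show "1\<^sup>2 * qform {..<n} (G a) u \<le> (\<Sum>j<n. (u j)\<^sup>2) / 8"
      unfolding e' by simp
  qed (use m f in \<open>auto simp: G_def\<close>)
  moreover have "P \<union> Q = {..<m}" using m by auto
  ultimately show ?thesis unfolding e by simp
qed

definition Yen :: "nat set \<Rightarrow> nat set \<Rightarrow> nat \<Rightarrow> real \<Rightarrow> (nat \<Rightarrow> real) \<Rightarrow> (nat \<times> nat \<Rightarrow> real) \<Rightarrow> real" where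
  "Yen P Q n s d a = - s * (\<Sum>p\<in>P. qform {..<n} (rowcov Q a d) (\<lambda>j. a (p, j)))
     + real (card P) * (s * trc n (rowcov Q a d) - 2 * s\<^sup>2 * frob2 n (rowcov Q a d))"

lemma rowcov_nonneg: "0 \<le> qform {..<n} (rowcov Q a d) u"
  unfolding qform_rowcov by (intro sum_nonneg) auto

lemma measurable_rowcov:
  assumes "finite Q" "Q \<times> {..<n} \<subseteq> I" "j < n" "k < n"
  shows "(\<lambda>a. rowcov Q a d j k) \<in> borel_measurable (PiM I (\<lambda>_. gaussian \<sigma>))"
  unfolding rowcov_def using assms
  by (intro borel_measurable_sum borel_measurable_times borel_measurable_const measurable_coord) auto

text \<open>The matrix - s D A_Q^T A_Q D is negative semidefinite for every A and depends on the
  rows in \<open>Q\<close> alone, which is what decoupling requires.\<close>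

lemma Yen_mgf:
  assumes m: "P \<inter> Q = {}" "Q \<union> P = {..<m}" and s: "s \<ge> 0"
  shows "(\<integral>\<^sup>+a. ennreal (exp (Yen P Q n s d a)) \<partial>MA m n) \<le> 1"
proof -
  define G where "G = (\<lambda>a j k. - s * rowcov Q a d j k)"
  have qG: "qform {..<n} (G a) u = - s * qform {..<n} (rowcov Q a d) u" for a u
    unfolding qform_def G_def by (simp add: sum_distrib_left mult.assoc)
  have e: "Yen P Q n s d a = (\<Sum>p\<in>P. qform {..<n} (G a) (\<lambda>j. a (p, j)))
      + - (real (card P) * (1\<^sup>2 * trc n (G a) + 2 * 1^4 * frob2 n (G a)))" for a
  proof -
    have "trc n (G a) = - s * trc n (rowcov Q a d)" "frob2 n (G a) = s\<^sup>2 * frob2 n (rowcov Q a d)"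
      by (simp_all add: trc_def frob2_def G_def sum_distrib_left power_mult_distrib sum_negf)
    then show ?thesis unfolding Yen_def qG by (simp add: sum_negf sum_distrib_left algebra_simps)
  qed
  have f: "finite P" "finite Q" using m by (metis finite_Un finite_lessThan)+
  have "(\<integral>\<^sup>+a. ennreal (exp ((\<Sum>p\<in>P. qform {..<n} (G a) (\<lambda>j. a (p, j)))
      + - (real (card P) * (1\<^sup>2 * trc n (G a) + 2 * 1^4 * frob2 n (G a))))) \<partial>PiM ((Q \<union> P) \<times> {..<n}) (\<lambda>_. gaussian 1)) \<le> 1"
  proof (rule mgf_decoupled[OF f m(1)])
    fix a :: "nat \<times> nat \<Rightarrow> real" and u :: "nat \<Rightarrow> real"
    have "0 \<le> s * qform {..<n} (rowcov Q a d) u" using s rowcov_nonneg by (intro mult_nonneg_nonneg) auto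
    moreover have "0 \<le> (\<Sum>j<n. (u j)\<^sup>2)" by (intro sum_nonneg) auto
    ultimately show "1\<^sup>2 * qform {..<n} (G a) u \<le> (\<Sum>j<n. (u j)\<^sup>2) / 8" unfolding qG by simp
  next
    fix j k assume "j < n" "k < n"
    then show "(\<lambda>a. G a j k) \<in> borel_measurable (PiM ((Q \<union> P) \<times> {..<n}) (\<lambda>_. gaussian 1))"
      unfolding G_def using f by (intro borel_measurable_times borel_measurable_const measurable_rowcov) auto
  next
    fix a b :: "nat \<times> nat \<Rightarrow> real" and j k
    assume ab: "\<And>i. i \<in> Q \<times> {..<n} \<Longrightarrow> a i = b i" and jk: "j < n" "k < n"
    have "rowcov Q a d j k = rowcov Q b d j k"
      unfolding rowcov_def using jk by (intro sum.cong refl) (simp add: ab)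
    then show "G a j k = G b j k" by (simp add: G_def)
  next
    show "G a j k = G a k j" for a j k unfolding G_def rowcov_def by (simp add: mult.commute)
  qed simp
  then show ?thesis unfolding e m(2) .
qed

text \<open>The factor 1 / (8 \<sigma>^2) is the largest one the chaos bound admits; each entry is
  compensated by 1/8 + 2/64 = 5/32.\<close>

definition Yw :: "nat \<Rightarrow> nat \<Rightarrow> real \<Rightarrow> (nat \<times> nat \<Rightarrow> real) \<Rightarrow> real" where
  "Yw L n \<sigma> w = (\<Sum>l<L. \<Sum>j<n. (w (l, j))\<^sup>2) / (8 * \<sigma>\<^sup>2) + - (real L * (real n * (5/32)))"

lemma Yw_mgf:
  assumes \<sigma>: "\<sigma> > 0"
  shows "(\<integral>\<^sup>+w. ennreal (exp (Yw L n \<sigma> w)) \<partial>MW L n \<sigma>) \<le> 1"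
proof -
  define G :: "nat \<Rightarrow> nat \<Rightarrow> real" where "G = (\<lambda>j k. if j = k then 1 / (8 * \<sigma>\<^sup>2) else 0)"
  have qG: "qform {..<n} G u = (\<Sum>j<n. (u j)\<^sup>2) / (8 * \<sigma>\<^sup>2)" for u
    unfolding G_def qform_diag by (simp add: sum_divide_distrib)
  have e: "Yw L n \<sigma> w = (\<Sum>l\<in>{..<L}. qform {..<n} G (\<lambda>j. w (l, j))) + - (real L * (real n * (5/32)))" for w
    unfolding Yw_def qG by (simp add: sum_divide_distrib)
  show ?thesis unfolding e
  proof (rule mgf_block[OF _ \<sigma>])
    show "\<sigma>\<^sup>2 * qform {..<n} G u \<le> (\<Sum>j<n. (u j)\<^sup>2) / 8" for u unfolding qG using \<sigma> by simp
    have tf: "\<sigma>\<^sup>2 * trc n G + 2 * \<sigma>^4 * frob2 n G = real n * (5/32)"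
      unfolding G_def trc_diag frob2_diag using \<sigma> by (simp add: field_simps power2_eq_square eval_nat_numeral)
    show "- (real L * (real n * (5/32))) + real (card {..<L}) * (\<sigma>\<^sup>2 * trc n G + 2 * \<sigma>^4 * frob2 n G) \<le> 0"
      unfolding tf by simp
  qed (simp_all add: G_def)
qed

definition Ylik :: "nat \<Rightarrow> nat \<Rightarrow> nat \<Rightarrow> real \<Rightarrow> real \<Rightarrow> (nat \<Rightarrow> real) \<Rightarrow> (nat \<Rightarrow> real) \<Rightarrow> (nat \<times> nat \<Rightarrow> real) \<times> (nat \<times> nat \<Rightarrow> real) \<Rightarrow> real" where
  "Ylik m n L \<sigma> c xo x = (\<lambda>(a, w). - (c / 4 * real L) * (nll_fun m n L \<sigma> xo a w x - nll_fun m n L \<sigma> xo a w xo)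
      + c / 4 * real L * (c / 2) * frob2 n (precision_dev m n \<sigma> xo x a))"

lemma measurable_fst_coord:
  "i \<in> I \<Longrightarrow> (\<lambda>\<omega>. fst \<omega> i) \<in> borel_measurable (PiM I (\<lambda>_. gaussian s) \<Otimes>\<^sub>M B)"
  by (rule measurable_compose[OF measurable_fst measurable_coord])

lemma measurable_snd_coord:
  "i \<in> I \<Longrightarrow> (\<lambda>\<omega>. snd \<omega> i) \<in> borel_measurable (B \<Otimes>\<^sub>M PiM I (\<lambda>_. gaussian s))"
  by (rule measurable_compose[OF measurable_snd measurable_coord])

lemma measurable_cov:
  assumes "p < m" "q < m"
  shows "(\<lambda>\<omega>. cov n \<sigma> x (fst \<omega>) p q) \<in> borel_measurable (MA m n \<Otimes>\<^sub>M MW L n \<sigma>)"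
  unfolding cov_def gram_def wmat_def using assms
  by (intro borel_measurable_sum borel_measurable_times borel_measurable_const measurable_fst_coord) auto

lemma measurable_prec:
  assumes "p < m" "q < m"
  shows "(\<lambda>\<omega>. prec m n \<sigma> x (fst \<omega>) p q) \<in> borel_measurable (MA m n \<Otimes>\<^sub>M MW L n \<sigma>)"
  unfolding prec_def by (rule measurable_inv_fun[OF measurable_cov assms])

lemma measurable_nll_fun: "(\<lambda>\<omega>. nll_fun m n L \<sigma> xo (fst \<omega>) (snd \<omega>) x) \<in> borel_measurable (MA m n \<Otimes>\<^sub>M MW L n \<sigma>)"
proof -
  have m1: "(\<lambda>\<omega>. fdet m (cov n \<sigma> x (fst \<omega>))) \<in> borel_measurable (MA m n \<Otimes>\<^sub>M MW L n \<sigma>)"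
    by (intro measurable_fdet measurable_cov)
  have m2: "(\<lambda>\<omega>. qform {..<m} (prec m n \<sigma> x (fst \<omega>)) (obs n \<sigma> xo (fst \<omega>) (snd \<omega>) l))
    \<in> borel_measurable (MA m n \<Otimes>\<^sub>M MW L n \<sigma>)" if "l < L" for l
    unfolding qform_def obs_def wmat_def using that
    by (intro borel_measurable_sum borel_measurable_times borel_measurable_divide borel_measurable_const
        measurable_fst_coord measurable_snd_coord measurable_prec) auto
  show ?thesis unfolding nll_fun_def
    by (intro borel_measurable_add borel_measurable_times borel_measurable_const borel_measurable_sum borel_measurable_ln m1 m2) auto
qed

lemma measurable_precision_dev_frob: "(\<lambda>\<omega>. frob2 n (precision_dev m n \<sigma> xo x (fst \<omega>))) \<in> borel_measurable (MA m n \<Otimes>\<^sub>M MW L n \<sigma>)"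
  unfolding frob2_def precision_dev_def conj_by_def wmat_def
  by (intro borel_measurable_sum borel_measurable_power borel_measurable_times borel_measurable_diff borel_measurable_const
        measurable_fst_coord measurable_prec) auto

lemma measurable_Ylik: "Ylik m n L \<sigma> c xo x \<in> borel_measurable (MA m n \<Otimes>\<^sub>M MW L n \<sigma>)"
  unfolding Ylik_def case_prod_beta
  by (intro borel_measurable_add borel_measurable_times borel_measurable_const borel_measurable_diff
      measurable_nll_fun measurable_precision_dev_frob)

text \<open>The conditional bound given A holds on the full-rank event, hence almost surely, and
  integrates over A.\<close>

lemma Ylik_mgf:
  assumes mn: "m \<le> n" and \<sigma>: "\<sigma> > 0" and lo: "0 < lo" "lo \<le> hi"
    and x: "boxed n lo hi x" "boxed n lo hi xo" and L: "L \<ge> 1"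
  shows "(\<integral>\<^sup>+\<omega>. ennreal (exp (Ylik m n L \<sigma> (1 / (5 * kap lo hi)) xo x \<omega>)) \<partial>(MA m n \<Otimes>\<^sub>M MW L n \<sigma>)) \<le> 1"
proof (rule nn_integral_pair_le_1)
  show "prob_space (MA m n)" "prob_space (MW L n \<sigma>)" by (intro prob_space_gaussian_PiM; simp add: \<sigma>)+
  show "(\<lambda>\<omega>. ennreal (exp (Ylik m n L \<sigma> (1 / (5 * kap lo hi)) xo x \<omega>))) \<in> borel_measurable (MA m n \<Otimes>\<^sub>M MW L n \<sigma>)"
    using measurable_Ylik by measurable
  have "AE a in MA m n. fdet m (\<lambda>i j. a (i, j)) \<noteq> 0"
    by (rule AE_minor_nonzero) (use mn in auto)
  then show "AE a in MA m n. (\<integral>\<^sup>+w. ennreal (exp (Ylik m n L \<sigma> (1 / (5 * kap lo hi)) xo x (a, w))) \<partial>MW L n \<sigma>) \<le> 1"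
    by (rule eventually_mono) (unfold Ylik_def prod.case, rule lik_mgf_cond[OF mn \<sigma> lo _ x L])
qed

section \<open>The error bound on the good event\<close>

text \<open>Dividing by \<open>s\<close> leaves the errors T / s and 2 s p Fr. With s = sqrt T / N
  both are of order sqrt T * N, contributing the 1 and the 2 D.\<close>

lemma chernoff_solve:
  fixes X :: real
  assumes Y: "- s * X + p * (s * t - 2 * s\<^sup>2 * Fr) < T" and T: "T > 0" and N: "N > 0" and s: "s = sqrt T / N"
    and pF: "p * Fr \<le> N\<^sup>2 * D"
  shows "p * t - (2 * D + 1) * (sqrt T * N) \<le> X"
proof -
  have s0: "s > 0" using T N s by simp
  have Ts: "T = s * (sqrt T * N)" using N T by (simp add: s)
  have "s * s * (p * Fr) \<le> s * s * (N\<^sup>2 * D)" using pF s0 by (intro mult_left_mono) auto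
  also have "\<dots> = s * (sqrt T * N * D)" using N by (simp add: s power2_eq_square)
  finally have "s * (p * t - 2 * (sqrt T * N * D) - sqrt T * N) \<le> - s * X + s * X + p * (s * t - 2 * s\<^sup>2 * Fr) - T"
    using Ts by (simp add: algebra_simps power2_eq_square)
  also have "\<dots> \<le> s * X" using Y by simp
  finally have "p * t - 2 * (sqrt T * N * D) - sqrt T * N \<le> X" using s0 by simp
  then show ?thesis by (simp add: algebra_simps)
qed

lemma half_product: "2 \<le> m \<Longrightarrow> (real m)\<^sup>2 / 6 \<le> real (m div 2) * real (m - m div 2)"
proof -
  assume m: "2 \<le> m"
  define h where "h = m div 2"
  have h: "h \<ge> 1" using m by (simp add: h_def)
  consider "m = 2 * h" | "m = 2 * h + 1" unfolding h_def by linarith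
  then show ?thesis
  proof cases
    case 1
    then have "m div 2 = h" "m - m div 2 = h" by auto
    then show ?thesis using 1 by (simp add: power2_eq_square)
  next
    case 2
    then have e: "m div 2 = h" "m - m div 2 = h + 1" by auto
    have "1 \<le> real h * real h" using h by (metis mult_mono' of_nat_1 of_nat_mono mult_1 zero_le_one)
    then show ?thesis unfolding e using 2 h by (simp add: power2_eq_square algebra_simps)
  qed
qed

text \<open>Two lower tails are chained: the energy is at least card P times the trace of
  \<open>rowcov\<close>, and that trace at least card Q times |d|^2, each up to a deviation. The
  product of the block sizes is at least m^2 / 6.\<close>

lemma signal_energy_bound:
  assumes mn: "2 \<le> m" "m < n" and T: "T > 0" and hi: "\<And>j. j < n \<Longrightarrow> \<bar>d j\<bar> \<le> hi\<^sup>2"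
    and op: "op_bound m n a (256 * real n)"
    and Y1: "Ydiag {m div 2..<m} n (sqrt T / real n) d a < T"
    and Y2: "Yen {..<m div 2} {m div 2..<m} n (sqrt T / (real m * real n)) d a < T"
  shows "(real m)\<^sup>2 / 6 * (\<Sum>j<n. (d j)\<^sup>2) \<le> energy m n a d + (131074 * hi^8 + 2) * (sqrt T * real m * real n)"
proof -
  define P where "P = {..<m div 2}"
  define Q where "Q = {m div 2..<m}"
  define S where "S = (\<Sum>j<n. (d j)\<^sup>2)"
  define t where "t = trc n (rowcov Q a d)"
  define X where "X = (\<Sum>p\<in>P. qform {..<n} (rowcov Q a d) (\<lambda>j. a (p, j)))"
  define H where "H = hi^8"
  have H: "H \<ge> 0" by (simp add: H_def)
  have PQ: "P \<subseteq> {..<m}" "Q \<subseteq> {..<m}" "card P = m div 2" "card Q = m - m div 2" by (auto simp: P_def Q_def)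
  have n: "real n > 0" "real m > 0" using mn by auto
  have d4: "(d j)^4 \<le> H" if "j < n" for j
  proof -
    have "\<bar>d j\<bar>^4 \<le> (hi\<^sup>2)^4" by (rule power_mono[OF hi[OF that]]) simp
    then show ?thesis by (simp add: H_def power_mult[symmetric])
  qed
  have S4: "(\<Sum>j<n. (d j)^4) \<le> real n * H"
    using sum_bounded_above[of "{..<n}" "\<lambda>j. (d j)^4" H] d4 by simp
  have t: "real (card Q) * S - (2 * H + 1) * (sqrt T * real n) \<le> t"
  proof (rule chernoff_solve[OF _ T n(1) refl])
    show "- (sqrt T / real n) * t + real (card Q) * (sqrt T / real n * S - 2 * (sqrt T / real n)\<^sup>2 * (\<Sum>j<n. (d j)^4)) < T"
      using Y1 unfolding Ydiag_def Q_def[symmetric] t_def S_def .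
    have "real (card Q) * (\<Sum>j<n. (d j)^4) \<le> real n * (real n * H)"
      using S4 PQ mn by (intro mult_mono sum_nonneg) auto
    then show "real (card Q) * (\<Sum>j<n. (d j)^4) \<le> (real n)\<^sup>2 * H" by (simp add: power2_eq_square)
  qed
  \<comment> \<open>The natural scale is now m n, since card P times the Frobenius term is at most
    m^2 (256 n)^2 H, and 256^2 = 65536.\<close>
  have X: "real (card P) * t - (2 * (65536 * H) + 1) * (sqrt T * (real m * real n)) \<le> X"
  proof (rule chernoff_solve[OF _ T _ refl])
    show "- (sqrt T / (real m * real n)) * X + real (card P) * (sqrt T / (real m * real n) * t - 2 * (sqrt T / (real m * real n))\<^sup>2 * frob2 n (rowcov Q a d)) < T"
      using Y2 unfolding Yen_def P_def[symmetric] Q_def[symmetric] t_def X_def .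
    show "0 < real m * real n" using n by simp
    have "frob2 n (rowcov Q a d) \<le> real m * ((256 * real n)\<^sup>2 * H)"
      by (rule frob2_rowcov_le[OF op _ PQ(2) H d4]) auto
    then have "real (card P) * frob2 n (rowcov Q a d) \<le> real m * (real m * ((256 * real n)\<^sup>2 * H))"
      using PQ frob2_nonneg by (intro mult_mono) auto
    then show "real (card P) * frob2 n (rowcov Q a d) \<le> (real m * real n)\<^sup>2 * (65536 * H)"
      by (simp add: power2_eq_square mult_ac)
  qed
  have S0: "S \<ge> 0" unfolding S_def by (intro sum_nonneg) auto
  have "(real m)\<^sup>2 / 6 * S \<le> real (card P) * (real (card Q) * S)"
    using mult_right_mono[OF half_product[OF mn(1)] S0] unfolding PQ(3,4) by (simp add: mult.assoc)
  also have "\<dots> \<le> real (card P) * (t + (2 * H + 1) * (sqrt T * real n))"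
    using t by (intro mult_left_mono) auto
  also have "\<dots> \<le> real (card P) * t + real m * ((2 * H + 1) * (sqrt T * real n))"
  proof -
    have "real (card P) * ((2 * H + 1) * (sqrt T * real n)) \<le> real m * ((2 * H + 1) * (sqrt T * real n))"
      using PQ H T by (intro mult_right_mono) auto
    then show ?thesis by (simp add: distrib_left)
  qed
  also have "\<dots> \<le> X + (2 * (65536 * H) + 1) * (sqrt T * (real m * real n)) + real m * ((2 * H + 1) * (sqrt T * real n))"
    using X by simp
  also have "\<dots> = X + (131074 * H + 2) * (sqrt T * real m * real n)" by (simp add: algebra_simps)
  also have "X \<le> energy m n a d" unfolding X_def by (rule energy_ge_rows[OF PQ(1,2)])
  finally show ?thesis unfolding S_def H_def by simp
qed

text \<open>The threshold and the compensator add up to 37/32 \<le> 5/4, and 5/4 * 8 = 10.\<close>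

lemma Yw_bound:
  assumes "Yw L n \<sigma> w < real L * real n" "\<sigma> > 0" "L \<ge> 1"
  shows "(\<Sum>l<L. \<Sum>j<n. (w (l, j))\<^sup>2) / real L \<le> 10 * \<sigma>\<^sup>2 * real n"
proof -
  have "(\<Sum>l<L. \<Sum>j<n. (w (l, j))\<^sup>2) / (8 * \<sigma>\<^sup>2) < real L * real n * (37/32)"
    using assms(1) by (simp add: Yw_def)
  also have "\<dots> \<le> real L * real n * (5/4)" by (intro mult_left_mono) auto
  finally have "(\<Sum>l<L. \<Sum>j<n. (w (l, j))\<^sup>2) \<le> real L * real n * (5/4) * (8 * \<sigma>\<^sup>2)"
    using assms(2) by (simp add: pos_divide_less_eq)
  then show ?thesis using assms(3) by (simp add: field_simps)
qed

text \<open>On the good event a net point x within \<open>1/n^2\<close> of a minimiser is almost a minimiser, which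
  bounds its relative precision error, hence the energy of \<open>A diag(x^2 - xo^2) A^T\<close>, hence x itself.\<close>
lemma net_point_bound:
  assumes mn: "2 \<le> m" "m < n" and L: "L \<ge> 1" and \<sigma>: "\<sigma> > 0" and lo: "0 < lo" "lo \<le> hi"
    and T: "T > 0" and rank: "fdet m (\<lambda>i j. a (i, j)) \<noteq> 0"
    and x: "boxed n lo hi x" "boxed n lo hi x'" "boxed n lo hi xo"
    and close: "\<And>j. j < n \<Longrightarrow> \<bar>x j - x' j\<bar> \<le> 1 / (real n)\<^sup>2"
    and opt: "nll_fun m n L \<sigma> xo a w x' \<le> nll_fun m n L \<sigma> xo a w xo"
    and op: "\<And>z. z \<in> lattice_ball n \<Longrightarrow> Yop m n z a < 7 * real n"
    and Y1: "Ydiag {m div 2..<m} n (sqrt T / real n) (\<lambda>j. (x j)\<^sup>2 - (xo j)\<^sup>2) a < T"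
    and Y2: "Yen {..<m div 2} {m div 2..<m} n (sqrt T / (real m * real n)) (\<lambda>j. (x j)\<^sup>2 - (xo j)\<^sup>2) a < T"
    and Y3: "Ylik m n L \<sigma> (1 / (5 * kap lo hi)) xo x (a, w) < T"
    and Y4: "Yw L n \<sigma> w < real L * real n"
  defines "c \<equiv> 1 / (5 * kap lo hi)" and "e \<equiv> (2 / lo + 1 / lo\<^sup>2) * (1 + 10 * kap lo hi)"
  shows "(\<Sum>j<n. (x j - xo j)\<^sup>2) / real n \<le> 3 / (2 * lo\<^sup>2) * (65536 * (hi^6 / lo\<^sup>2) * (2 / c) * (real n / (real m)\<^sup>2 * (4 / c * T / real L) + e / real m)
      + (131074 * hi^8 + 2) * (sqrt T / real m))"
proof -
  define d where "d = (\<lambda>j. (x j)\<^sup>2 - (xo j)\<^sup>2)"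
  define \<delta> where "\<delta> = 1 / (real n)\<^sup>2"
  \<comment> \<open>This bounds the excess over 1 of a squared coordinate ratio: (1 + \<delta>/lo)^2
    \<le> 1 + \<eta> because \<delta> \<le> 1. The likelihood changes by \<eta> times O(n), and
    \<delta> n = 1/n turns this into e / n.\<close>
  define \<eta> where "\<eta> = \<delta> * (2 / lo + 1 / lo\<^sup>2)"
  define N where "N = frob2 n (precision_dev m n \<sigma> xo x a)"
  have n: "real n > 0" "real m > 0" "real m \<le> real n" "1 \<le> real n" using mn by auto
  have mn': "m \<le> n" using mn by simp
  have bnd: "lo \<le> x j" "x j \<le> hi" "lo \<le> x' j" "x' j \<le> hi" "lo \<le> xo j" "xo j \<le> hi" if "j < n" for j
    using x that by (auto simp: boxed_def)
  have opb: "op_bound m n a (256 * real n)" by (rule Yop_op_bound[OF _ mn' op]) (use mn in auto)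
  have k: "kap lo hi \<ge> 1" by (rule kap_ge1[OF lo])
  have c: "c > 0" unfolding c_def using k by simp
  have \<delta>: "\<delta> > 0" "\<delta> \<le> 1" using n by (auto simp: \<delta>_def)
  have \<eta>: "\<eta> \<ge> 0" using \<delta> lo by (simp add: \<eta>_def)
  have ratio: "(u / v)\<^sup>2 \<le> 1 + \<eta>" if uv: "lo \<le> u" "lo \<le> v" "\<bar>u - v\<bar> \<le> \<delta>" for u v :: real
  proof -
    have "u / v = 1 + (u - v) / v" using uv lo by (simp add: field_simps)
    also have "(u - v) / v \<le> \<delta> / lo" using uv lo \<delta> by (intro frac_le) auto
    finally have 1: "u / v \<le> 1 + \<delta> / lo" by simp
    have "(u / v)\<^sup>2 \<le> (1 + \<delta> / lo)\<^sup>2" using uv lo by (intro power_mono 1) auto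
    also have "\<dots> = 1 + 2 * \<delta> / lo + \<delta> * \<delta> / lo\<^sup>2" by (simp add: power2_eq_square algebra_simps)
    also have "\<dots> \<le> 1 + 2 * \<delta> / lo + \<delta> * 1 / lo\<^sup>2"
      using \<delta> by (intro add_left_mono divide_right_mono mult_left_mono) auto
    also have "\<dots> = 1 + \<eta>" by (simp add: \<eta>_def algebra_simps)
    finally show ?thesis .
  qed
  have "nll_fun m n L \<sigma> xo a w x \<le> nll_fun m n L \<sigma> xo a w x'
    + \<eta> * (real n + kap lo hi / \<sigma>\<^sup>2 * ((\<Sum>l<L. \<Sum>j<n. (w (l, j))\<^sup>2) / real L))"
  proof (rule nll_fun_close[OF mn' \<sigma> lo rank x L \<eta>])
    fix j assume j: "j < n"
    show "(x j / x' j)\<^sup>2 \<le> 1 + \<eta>" using ratio[of "x j" "x' j"] bnd[OF j] close[OF j] by (simp add: \<delta>_def)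
    show "(x' j / x j)\<^sup>2 \<le> 1 + \<eta>" using ratio[of "x' j" "x j"] bnd[OF j] close[OF j] by (simp add: \<delta>_def abs_minus_commute)
  qed
  also have "\<dots> \<le> nll_fun m n L \<sigma> xo a w x' + \<eta> * (real n + kap lo hi / \<sigma>\<^sup>2 * (10 * \<sigma>\<^sup>2 * real n))"
    using Yw_bound[OF Y4 \<sigma> L] k \<eta> by (intro add_left_mono mult_left_mono) auto
  also have "\<dots> = nll_fun m n L \<sigma> xo a w x' + \<delta> * real n * e"
    using \<sigma> by (simp add: \<eta>_def e_def field_simps)
  also have "\<delta> * real n = 1 / real n" using n by (simp add: \<delta>_def power2_eq_square)
  finally have dl: "nll_fun m n L \<sigma> xo a w x - nll_fun m n L \<sigma> xo a w xo \<le> e / real n" using opt by simp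
  have cL: "c / 4 * real L > 0" using c L by simp
  \<comment> \<open>The event for \<open>Ylik\<close> says that |N|_F^2 cannot be large unless the
    likelihood at \<open>x\<close> clearly exceeds that at \<open>xo\<close>; near-optimality rules
    this out.\<close>
  have N: "N \<le> 2 / c * (4 / c * T / real L + e / real n)"
  proof -
    have "c / 4 * real L * (c / 2 * N) < T + c / 4 * real L * (nll_fun m n L \<sigma> xo a w x - nll_fun m n L \<sigma> xo a w xo)"
      using Y3 unfolding Ylik_def prod.case c_def[symmetric] N_def[symmetric] by (simp add: algebra_simps)
    also have "\<dots> \<le> T + c / 4 * real L * (e / real n)" using dl cL by (intro add_left_mono mult_left_mono) auto
    also have "\<dots> = c / 4 * real L * (4 / c * T / real L + e / real n)" using c L by (simp add: field_simps)
    finally have "c / 2 * N < 4 / c * T / real L + e / real n" using cL by (simp only: mult_less_cancel_left_pos)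
    then show ?thesis using c by (simp add: field_simps)
  qed
  have "(real m)\<^sup>2 / 6 * (\<Sum>j<n. (d j)\<^sup>2) \<le> energy m n a d + (131074 * hi^8 + 2) * (sqrt T * real m * real n)"
  proof (rule signal_energy_bound[OF mn T _ opb])
    fix j assume j: "j < n"
    have "0 \<le> (x j)\<^sup>2" "(x j)\<^sup>2 \<le> hi\<^sup>2" "0 \<le> (xo j)\<^sup>2" "(xo j)\<^sup>2 \<le> hi\<^sup>2"
      using bnd[OF j] lo by (auto intro!: power_mono)
    then show "\<bar>d j\<bar> \<le> hi\<^sup>2" unfolding d_def by linarith
  qed (use Y1 Y2 in \<open>simp_all add: d_def\<close>)
  also have "energy m n a d \<le> (256 * real n)\<^sup>2 * (hi^6 / lo\<^sup>2) * N"
    unfolding d_def N_def by (rule energy_le[OF mn' \<sigma> lo rank x(1,3) opb]) simp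
  also have "\<dots> \<le> (256 * real n)\<^sup>2 * (hi^6 / lo\<^sup>2) * (2 / c * (4 / c * T / real L + e / real n))"
    using N by (intro mult_left_mono) auto
  finally have main: "(real m)\<^sup>2 / 6 * (\<Sum>j<n. (d j)\<^sup>2) \<le> (256 * real n)\<^sup>2 * (hi^6 / lo\<^sup>2) * (2 / c * (4 / c * T / real L + e / real n))
     + (131074 * hi^8 + 2) * (sqrt T * real m * real n)" by simp
  define S where "S = (\<Sum>j<n. (x j - xo j)\<^sup>2)"
  have "4 * lo\<^sup>2 * S \<le> (\<Sum>j<n. (d j)\<^sup>2)"
    unfolding S_def sum_distrib_left
  proof (rule sum_mono)
    fix j assume "j \<in> {..<n}"
    then have j: "j < n" by simp
    have "(2 * lo)\<^sup>2 \<le> (x j + xo j)\<^sup>2" using bnd[OF j] lo by (intro power_mono) auto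
    then have "(2 * lo)\<^sup>2 * (x j - xo j)\<^sup>2 \<le> (x j + xo j)\<^sup>2 * (x j - xo j)\<^sup>2" by (intro mult_right_mono) auto
    also have "\<dots> = (d j)\<^sup>2" unfolding d_def power_mult_distrib[symmetric] by (simp add: power2_eq_square algebra_simps)
    finally show "4 * lo\<^sup>2 * (x j - xo j)\<^sup>2 \<le> (d j)\<^sup>2" by (simp add: power_mult_distrib)
  qed
  then have "(real m)\<^sup>2 / 6 * (4 * lo\<^sup>2 * S) \<le> (real m)\<^sup>2 / 6 * (\<Sum>j<n. (d j)\<^sup>2)" by (intro mult_left_mono) auto
  with main have S: "(real m)\<^sup>2 / 6 * (4 * lo\<^sup>2 * S) \<le> (256 * real n)\<^sup>2 * (hi^6 / lo\<^sup>2) * (2 / c * (4 / c * T / real L + e / real n))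
     + (131074 * hi^8 + 2) * (sqrt T * real m * real n)" by linarith
  \<comment> \<open>The normalisation that isolates S / n. The factor n^2 from the squared operator
    bound becomes n / m^2, so the net error e / n shrinks to e / m^2.\<close>
  define f where "f = 6 / (4 * lo\<^sup>2 * (real m)\<^sup>2 * real n)"
  have f: "f \<ge> 0" by (simp add: f_def)
  define K where "K = hi^6 / lo\<^sup>2"
  have K: "K \<ge> 0" unfolding K_def using lo by simp
  have "S / real n = f * ((real m)\<^sup>2 / 6 * (4 * lo\<^sup>2 * S))" unfolding f_def using n lo by simp
  also have "\<dots> \<le> f * ((256 * real n)\<^sup>2 * K * (2 / c * (4 / c * T / real L + e / real n))
     + (131074 * hi^8 + 2) * (sqrt T * real m * real n))" using S f unfolding K_def by (intro mult_left_mono)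
  also have "\<dots> = 3 / (2 * lo\<^sup>2) * (65536 * K * (2 / c) * (real n / (real m)\<^sup>2 * (4 / c * T / real L) + e / (real m)\<^sup>2)
      + (131074 * hi^8 + 2) * (sqrt T / real m))"
    unfolding f_def using n lo c by (simp add: field_simps power2_eq_square)
  also have "\<dots> \<le> 3 / (2 * lo\<^sup>2) * (65536 * K * (2 / c) * (real n / (real m)\<^sup>2 * (4 / c * T / real L) + e / real m)
      + (131074 * hi^8 + 2) * (sqrt T / real m))"
  proof -
    have "e \<ge> 0" unfolding e_def using lo k by simp
    moreover have "real m \<le> (real m)\<^sup>2" using mn by (simp add: power2_eq_square)
    ultimately have "e / (real m)\<^sup>2 \<le> e / real m" using n by (intro divide_left_mono) auto
    then show ?thesis using K c by (intro mult_left_mono add_mono order_refl) auto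
  qed
  finally show ?thesis unfolding S_def K_def .
qed

section \<open>Net size, good event and final constants\<close>

text \<open>The factors sqrt k cancel, so each axis has at most (2 hi + 3) n^3 cells. The constant
  is converted into a multiple of log n using n \<ge> 2.\<close>

lemma net_cardinality:
  fixes k n :: nat and hi :: real
  assumes n: "2 \<le> n" and k: "1 \<le> k" and hi: "0 < hi"
  shows "(2 * (hi * sqrt (real n / real k) * sqrt (real k) / (1 / (real n)\<^sup>2)) + 3) ^ k
    \<le> exp ((ln (2 * hi + 3) / ln 2 + 3) * (real k * ln (real n)))"
proof -
  define B where "B = 2 * hi + 3"
  have B: "B \<ge> 1" using hi by (simp add: B_def)
  have n1: "1 \<le> real n" using n by simp
  have "hi * sqrt (real n / real k) * sqrt (real k) / (1 / (real n)\<^sup>2) = hi * sqrt (real n) * (real n)\<^sup>2"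
    using k by (simp add: real_sqrt_divide)
  also have "\<dots> \<le> hi * real n * (real n)\<^sup>2"
  proof -
    have "sqrt (real n) \<le> sqrt ((real n)\<^sup>2)" using n1 by (intro real_sqrt_le_mono) (simp add: power2_eq_square)
    then have "sqrt (real n) \<le> real n" by simp
    then show ?thesis using hi by (intro mult_right_mono mult_left_mono) auto
  qed
  also have "\<dots> = hi * real n ^ 3" by (simp add: power2_eq_square power3_eq_cube)
  finally have "2 * (hi * sqrt (real n / real k) * sqrt (real k) / (1 / (real n)\<^sup>2)) + 3 \<le> 2 * hi * real n ^ 3 + 3 * real n ^ 3"
    using one_le_power[OF n1, of 3] by linarith
  also have "\<dots> = B * real n ^ 3" by (simp add: B_def algebra_simps)
  finally have "(2 * (hi * sqrt (real n / real k) * sqrt (real k) / (1 / (real n)\<^sup>2)) + 3) ^ k \<le> (B * real n ^ 3) ^ k"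
    using hi by (intro power_mono) auto
  also have "B * real n ^ 3 = exp (ln B + 3 * ln (real n))"
    using B n by (simp add: exp_add exp_of_nat_mult[of 3, simplified])
  also have "\<dots> ^ k = exp (real k * (ln B + 3 * ln (real n)))" by (simp add: exp_of_nat_mult)
  also have "\<dots> \<le> exp ((ln B / ln 2 + 3) * (real k * ln (real n)))"
  proof -
    have "ln B * 1 \<le> ln B * (ln (real n) / ln 2)" using B n by (intro mult_left_mono) auto
    then have "real k * (ln B + 3 * ln (real n)) \<le> real k * (ln B * (ln (real n) / ln 2) + 3 * ln (real n))"
      by (intro mult_left_mono) auto
    also have "\<dots> = (ln B / ln 2 + 3) * (real k * ln (real n))" by (simp add: algebra_simps)
    finally show ?thesis by simp
  qed
  finally show ?thesis unfolding B_def .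
qed

text \<open>Allows errors of order 1/m to be absorbed into sqrt (k log n) / m.\<close>

lemma sqrt_k_ln_ge:
  fixes k n :: nat assumes "2 \<le> n" "1 \<le> k" shows "1 / 2 \<le> sqrt (real k * ln (real n))"
proof (rule real_le_rsqrt)
  have "ln (1/2::real) \<le> 1/2 - 1" by (rule ln_le_minus_one) simp
  then have "1/2 \<le> ln (2::real)" by (simp add: ln_div)
  also have "\<dots> \<le> ln (real n)" using assms by simp
  also have "\<dots> \<le> real k * ln (real n)" using assms by simp
  finally show "(1/2)\<^sup>2 \<le> real k * ln (real n)" by (simp add: power2_eq_square)
qed

definition good :: "nat \<Rightarrow> nat \<Rightarrow> nat \<Rightarrow> real \<Rightarrow> real \<Rightarrow> real \<Rightarrow> real \<Rightarrow> (nat \<Rightarrow> real) \<Rightarrow> (nat \<Rightarrow> real) set \<Rightarrow>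
    ((nat \<times> nat \<Rightarrow> real) \<times> (nat \<times> nat \<Rightarrow> real)) set" where
  "good m n L \<sigma> lo hi T xo F = {\<omega> \<in> space (speckle_space m n L \<sigma>). fdet m (\<lambda>i j. fst \<omega> (i, j)) \<noteq> 0 \<and>
     (\<forall>z\<in>lattice_ball n. Yop m n z (fst \<omega>) < 7 * real n) \<and>
     (\<forall>x\<in>F. Ydiag {m div 2..<m} n (sqrt T / real n) (\<lambda>j. (x j)\<^sup>2 - (xo j)\<^sup>2) (fst \<omega>) < T) \<and>
     (\<forall>x\<in>F. Yen {..<m div 2} {m div 2..<m} n (sqrt T / (real m * real n)) (\<lambda>j. (x j)\<^sup>2 - (xo j)\<^sup>2) (fst \<omega>) < T) \<and>
     (\<forall>x\<in>F. Ylik m n L \<sigma> (1 / (5 * kap lo hi)) xo x \<omega> < T) \<and>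
     Yw L n \<sigma> (snd \<omega>) < real L * real n}"

lemma measurable_Yop: "Yop m n z \<in> borel_measurable (MA m n)"
  unfolding Yop_def
  by (intro borel_measurable_add borel_measurable_divide borel_measurable_const borel_measurable_sum
      borel_measurable_power borel_measurable_times measurable_coord) auto

lemma measurable_Ydiag: "Q \<subseteq> {..<m} \<Longrightarrow> Ydiag Q n s d \<in> borel_measurable (MA m n)"
  unfolding Ydiag_def trc_def
  by (intro borel_measurable_add borel_measurable_const borel_measurable_sum
      borel_measurable_times measurable_rowcov) (auto intro: finite_subset)

lemma measurable_Yen: "P \<subseteq> {..<m} \<Longrightarrow> Q \<subseteq> {..<m} \<Longrightarrow> Yen P Q n s d \<in> borel_measurable (MA m n)"
  unfolding Yen_def trc_def frob2_def qform_def
  by (intro borel_measurable_add borel_measurable_const borel_measurable_sum borel_measurable_diff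
      borel_measurable_power borel_measurable_times measurable_rowcov measurable_coord) (auto intro: finite_subset)

lemma measurable_Yw: "Yw L n \<sigma> \<in> borel_measurable (MW L n \<sigma>)"
  unfolding Yw_def
  by (intro borel_measurable_add borel_measurable_const borel_measurable_sum borel_measurable_divide
      borel_measurable_power measurable_coord) auto

lemma good_probability:
  assumes mn: "2 \<le> m" "m < n" and L: "L \<ge> 1" and \<sigma>: "\<sigma> > 0" and lo: "0 < lo" "lo \<le> hi"
    and T: "T > 0" and F: "finite F" "\<And>x. x \<in> F \<Longrightarrow> boxed n lo hi x" and xo: "boxed n lo hi xo"
  shows "good m n L \<sigma> lo hi T xo F \<in> sets (speckle_space m n L \<sigma>)"
    and "1 - (exp (- real n) + 3 * (real (card F) * exp (- T)) + exp (- (real L * real n)))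
      \<le> measure (speckle_space m n L \<sigma>) (good m n L \<sigma> lo hi T xo F)"
proof -
  let ?M = "speckle_space m n L \<sigma>"
  have A: "prob_space (MA m n)" by (intro prob_space_gaussian_PiM) simp
  have W: "prob_space (MW L n \<sigma>)" by (intro prob_space_gaussian_PiM \<sigma>)
  interpret A: prob_space "MA m n" by (rule A)
  interpret W: prob_space "MW L n \<sigma>" by (rule W)
  interpret M: prob_space ?M by (rule prob_space_speckle[OF \<sigma>])
  have M_eq: "?M = MA m n \<Otimes>\<^sub>M MW L n \<sigma>" by (rule speckle_space_eq)
  define P where "P = {..<m div 2}"
  define Q where "Q = {m div 2..<m}"
  have PQ: "P \<inter> Q = {}" "Q \<union> P = {..<m}" "P \<subseteq> {..<m}" "Q \<subseteq> {..<m}" by (auto simp: P_def Q_def)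
  define B0 where "B0 = {\<omega> \<in> space ?M. fdet m (\<lambda>i j. fst \<omega> (i, j)) = 0}"
  define B1 where "B1 = {\<omega> \<in> space ?M. \<exists>z\<in>lattice_ball n. 7 * real n \<le> Yop m n z (fst \<omega>)}"
  define B2 where "B2 = {\<omega> \<in> space ?M. \<exists>x\<in>F. T \<le> Ydiag Q n (sqrt T / real n) (\<lambda>j. (x j)\<^sup>2 - (xo j)\<^sup>2) (fst \<omega>)}"
  define B3 where "B3 = {\<omega> \<in> space ?M. \<exists>x\<in>F. T \<le> Yen P Q n (sqrt T / (real m * real n)) (\<lambda>j. (x j)\<^sup>2 - (xo j)\<^sup>2) (fst \<omega>)}"
  define B4 where "B4 = {\<omega> \<in> space ?M. \<exists>x\<in>F. T \<le> Ylik m n L \<sigma> (1 / (5 * kap lo hi)) xo x \<omega>}"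
  \<comment> \<open>The one-element index set casts this event in the shape of the common union
    bound.\<close>
  define B5 where "B5 = {\<omega> \<in> space ?M. \<exists>u\<in>{()}. real L * real n \<le> Yw L n \<sigma> (snd \<omega>)}"
  have fst_le: "(\<integral>\<^sup>+\<omega>. ennreal (exp (f (fst \<omega>))) \<partial>?M) \<le> 1" if "f \<in> borel_measurable (MA m n)" "(\<integral>\<^sup>+a. ennreal (exp (f a)) \<partial>MA m n) \<le> 1" for f
    unfolding M_eq by (rule nn_integral_fst_le_1[OF A W _ that(2)]) (use that(1) in measurable)
  have s: "sqrt T / real n \<ge> 0" "sqrt T / (real m * real n) \<ge> 0" using T by auto
  have fstm: "(\<lambda>\<omega>. f (fst \<omega>)) \<in> borel_measurable ?M" if "f \<in> borel_measurable (MA m n)" for f :: "_ \<Rightarrow> real"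
    unfolding M_eq by (rule measurable_compose[OF measurable_fst that])
  have sndm: "(\<lambda>\<omega>. f (snd \<omega>)) \<in> borel_measurable ?M" if "f \<in> borel_measurable (MW L n \<sigma>)" for f :: "_ \<Rightarrow> real"
    unfolding M_eq by (rule measurable_compose[OF measurable_snd that])
  have dtm: "(\<lambda>a. fdet m (\<lambda>i j. a (i, j))) \<in> borel_measurable (MA m n)"
    by (intro measurable_fdet measurable_coord) (use mn in auto)
  have B0s: "B0 \<in> sets ?M" unfolding B0_def using fstm[OF dtm] by measurable
  have "AE a in MA m n. fdet m (\<lambda>i j. a (i, j)) \<noteq> 0"
    by (rule AE_minor_nonzero) (use mn in auto)
  have B0: "M.prob B0 = 0"
  proof -
    define N where "N = {a \<in> space (MA m n). fdet m (\<lambda>i j. a (i, j)) = 0}"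
    have Ns: "N \<in> sets (MA m n)" unfolding N_def using dtm by measurable
    have "emeasure (MA m n) N = 0"
      using \<open>AE a in MA m n. fdet m (\<lambda>i j. a (i, j)) \<noteq> 0\<close> Ns AE_iff_measurable[OF Ns]
      unfolding N_def by simp
    moreover have "B0 = N \<times> space (MW L n \<sigma>)" unfolding B0_def N_def M_eq by (auto simp: space_pair_measure)
    ultimately have "emeasure ?M B0 = 0"
      unfolding M_eq using W.emeasure_pair_measure_Times[OF Ns, of "space (MW L n \<sigma>)"] by simp
    then show ?thesis by (simp add: measure_def)
  qed
  have B1: "B1 \<in> sets ?M" "M.prob B1 \<le> real (card (lattice_ball n)) * exp (- (7 * real n))"
    unfolding B1_def
    by (intro M.union_exp_markov finite_lattice_ball fstm measurable_Yop fst_le Yop_mgf; use mn in simp)+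
  have B2: "B2 \<in> sets ?M" "M.prob B2 \<le> real (card F) * exp (- T)"
    unfolding B2_def
    by (intro M.union_exp_markov F(1) fstm fst_le measurable_Ydiag[OF PQ(4)] Ydiag_mgf[OF PQ(1,2)] s)+
  have B3: "B3 \<in> sets ?M" "M.prob B3 \<le> real (card F) * exp (- T)"
    unfolding B3_def
    by (intro M.union_exp_markov F(1) fstm fst_le measurable_Yen[OF PQ(3,4)] Yen_mgf[OF PQ(1,2)] s)+
  have Y4: "Ylik m n L \<sigma> (1 / (5 * kap lo hi)) xo x \<in> borel_measurable ?M"
    "(\<integral>\<^sup>+\<omega>. ennreal (exp (Ylik m n L \<sigma> (1 / (5 * kap lo hi)) xo x \<omega>)) \<partial>?M) \<le> 1" if "x \<in> F" for x
    unfolding M_eq by (rule measurable_Ylik) (rule Ylik_mgf[OF _ \<sigma> lo F(2)[OF that] xo L], use mn in simp)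
  have B4: "B4 \<in> sets ?M" "M.prob B4 \<le> real (card F) * exp (- T)"
    unfolding B4_def by (intro M.union_exp_markov F(1) Y4; assumption)+
  have Y5: "(\<integral>\<^sup>+\<omega>. ennreal (exp (Yw L n \<sigma> (snd \<omega>))) \<partial>?M) \<le> 1"
    unfolding M_eq
  proof (rule nn_integral_pair_le_1[OF A W])
    show "(\<lambda>\<omega>. ennreal (exp (Yw L n \<sigma> (snd \<omega>)))) \<in> borel_measurable (MA m n \<Otimes>\<^sub>M MW L n \<sigma>)"
      using sndm[OF measurable_Yw] unfolding M_eq by measurable
    show "AE a in MA m n. (\<integral>\<^sup>+w. ennreal (exp (Yw L n \<sigma> (snd (a, w)))) \<partial>MW L n \<sigma>) \<le> 1"
      using Yw_mgf[OF \<sigma>] by simp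
  qed
  have B5: "B5 \<in> sets ?M" "M.prob B5 \<le> real (card {()}) * exp (- (real L * real n))"
    unfolding B5_def by (intro M.union_exp_markov sndm measurable_Yw Y5; simp)+
  have good: "good m n L \<sigma> lo hi T xo F = space ?M - (B0 \<union> B1 \<union> B2 \<union> B3 \<union> B4 \<union> B5)"
    unfolding good_def B0_def B1_def B2_def B3_def B4_def B5_def P_def[symmetric] Q_def[symmetric]
    by (auto simp: not_le)
  have Bs: "B0 \<union> B1 \<union> B2 \<union> B3 \<union> B4 \<union> B5 \<in> sets ?M"
    using B0s B1(1) B2(1) B3(1) B4(1) B5(1) by (intro sets.Un)
  show "good m n L \<sigma> lo hi T xo F \<in> sets ?M" unfolding good using Bs by (rule sets.compl_sets)
  have "M.prob (B0 \<union> B1 \<union> B2 \<union> B3 \<union> B4 \<union> B5)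
    \<le> M.prob B0 + M.prob B1 + M.prob B2 + M.prob B3 + M.prob B4 + M.prob B5"
    using B0s B1(1) B2(1) B3(1) B4(1) B5(1)
    by (intro order_trans[OF measure_Un_le] add_right_mono order_refl sets.Un)
  also have "\<dots> \<le> 0 + exp (- real n) + real (card F) * exp (- T) + real (card F) * exp (- T)
      + real (card F) * exp (- T) + exp (- (real L * real n))"
  proof (intro add_mono)
    have "M.prob B1 \<le> exp (6 * real n) * exp (- (7 * real n))"
      by (rule order_trans[OF B1(2)]) (intro mult_right_mono card_lattice_ball, simp)
    then show "M.prob B1 \<le> exp (- real n)" by (simp add: exp_add[symmetric])
  qed (use B0 B2 B3 B4 B5 in simp_all)
  finally show "1 - (exp (- real n) + 3 * (real (card F) * exp (- T)) + exp (- (real L * real n)))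
      \<le> M.prob (good m n L \<sigma> lo hi T xo F)"
    unfolding good M.prob_compl[OF Bs] by simp
qed

lemma combine_bounds:
  fixes u v A Kc H c e l :: real
  assumes "0 \<le> u" "0 \<le> v" "0 \<le> A" "0 \<le> Kc" "0 \<le> H" "0 < c" "0 \<le> e" "0 \<le> l" "0 \<le> r"
  shows "4 * v + l * (Kc * (4 / c * A * u + 2 * e * v) + H * (A * v)) \<le> (4 + l * (Kc * (4 / c * A + 2 * e) + H * A) + r) * (u + v)"
proof -
  have "4 / c * A * u + 2 * e * v \<le> (4 / c * A + 2 * e) * (u + v)"
    using assms by (simp add: distrib_left distrib_right add_increasing add_increasing2)
  moreover have "A * v \<le> A * (u + v)" using assms by (intro mult_left_mono) auto
  ultimately have "l * (Kc * (4 / c * A * u + 2 * e * v) + H * (A * v)) \<le> l * (Kc * ((4 / c * A + 2 * e) * (u + v)) + H * (A * (u + v)))"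
    using assms by (intro mult_left_mono add_mono) auto
  moreover have "4 * v \<le> 4 * (u + v) + r * (u + v)" using assms by (simp add: add_increasing)
  ultimately show ?thesis by (simp add: algebra_simps)
qed

text \<open>The summand 4 absorbs the squared distance from minimiser to net point, and 3 / lo^2 is
  twice the factor in the net point bound, from (p + q)^2 \<le> 2 p^2 + 2 q^2. The summand 2 hi^2
  serves m = 1.\<close>

definition mle_const :: "real \<Rightarrow> real \<Rightarrow> real" where
  "mle_const lo hi = (let c = 1 / (5 * kap lo hi); A = ln (2 * hi + 3) / ln 2 + 4;
      e = (2 / lo + 1 / lo\<^sup>2) * (1 + 10 * kap lo hi) in
    4 + 3 / lo\<^sup>2 * (65536 * (hi^6 / lo\<^sup>2) * (2 / c) * (4 / c * A + 2 * e) + (131074 * hi^8 + 2) * A) + 2 * hi\<^sup>2)"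

lemma dist_boxed:
  assumes "dim_vec x = n" "dim_vec y = n" "0 \<le> lo" "boxed n lo hi (\<lambda>j. x $ j)" "boxed n lo hi (\<lambda>j. y $ j)"
  shows "(l2norm (x - y))\<^sup>2 \<le> real n * hi\<^sup>2"
proof -
  have "(l2norm (x - y))\<^sup>2 = (\<Sum>i<n. (x $ i - y $ i)\<^sup>2)" by (rule l2norm_diff_sq[OF assms(2,1)])
  also have "\<dots> \<le> (\<Sum>i<n. hi\<^sup>2)"
  proof (rule sum_mono)
    fix i assume "i \<in> {..<n}"
    then have "\<bar>x $ i - y $ i\<bar> \<le> \<bar>hi\<bar>" using assms(3-5) by (force simp: boxed_def)
    then show "(x $ i - y $ i)\<^sup>2 \<le> hi\<^sup>2" unfolding abs_le_square_iff .
  qed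
  finally show ?thesis by simp
qed

text \<open>Transfers the bound at the net point to the minimiser; all errors of order 1/m,
  including the squared net radius over n, are charged to \<open>v\<close>.\<close>

lemma mle_error_bound:
  fixes x xh xo :: "real Matrix.vec"
  assumes mn: "2 \<le> m" "m < n" and k: "1 \<le> k" and L: "L \<ge> 1" and \<sigma>: "\<sigma> > 0" and lo: "0 < lo" "lo \<le> hi"
    and dim: "dim_vec x = n" "dim_vec xh = n" "dim_vec xo = n"
    and bx: "boxed n lo hi (\<lambda>j. x $ j)" "boxed n lo hi (\<lambda>j. xh $ j)" "boxed n lo hi (\<lambda>j. xo $ j)"
    and close: "l2norm (xh - x) \<le> 1 / (real n)\<^sup>2"
    and opt: "nll_fun m n L \<sigma> (\<lambda>j. xo $ j) a w (\<lambda>j. xh $ j) \<le> nll_fun m n L \<sigma> (\<lambda>j. xo $ j) a w (\<lambda>j. xo $ j)"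
    and T: "T = (ln (2 * hi + 3) / ln 2 + 4) * (real k * ln (real n))"
    and good: "(a, w) \<in> good m n L \<sigma> lo hi T (\<lambda>j. xo $ j) F" and F: "(\<lambda>j. x $ j) \<in> F"
  shows "(1 / real n) * (l2norm (xh - xo))\<^sup>2
    \<le> mle_const lo hi * (real n / (real m)\<^sup>2 * (real k * ln (real n) / real L) + sqrt (real k * ln (real n)) / real m)"
proof -
  define \<tau> where "\<tau> = real k * ln (real n)"
  define A where "A = ln (2 * hi + 3) / ln 2 + 4"
  define c where "c = 1 / (5 * kap lo hi)"
  define e where "e = (2 / lo + 1 / lo\<^sup>2) * (1 + 10 * kap lo hi)"
  define Kc where "Kc = 65536 * (hi^6 / lo\<^sup>2) * (2 / c)"
  define H where "H = 131074 * hi^8 + 2"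
  define u where "u = real n / (real m)\<^sup>2 * (\<tau> / real L)"
  define v where "v = sqrt \<tau> / real m"
  define S where "S = (\<Sum>j<n. (x $ j - xo $ j)\<^sup>2)"
  have n: "real n > 0" "real m > 0" "real m \<le> real n" "1 \<le> real n" using mn by auto
  have \<tau>: "1/2 \<le> sqrt \<tau>" unfolding \<tau>_def by (rule sqrt_k_ln_ge) (use mn k in auto)
  have \<tau>0: "\<tau> > 0" unfolding \<tau>_def using mn k by simp
  have A: "A \<ge> 1" unfolding A_def using lo by (simp add: add_increasing)
  have kp: "kap lo hi \<ge> 1" by (rule kap_ge1[OF lo])
  have c: "c > 0" unfolding c_def using kp by simp
  have e: "e \<ge> 0" unfolding e_def using kp lo by simp
  have Kc: "Kc \<ge> 0" unfolding Kc_def using c by simp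
  have H: "H \<ge> 0" unfolding H_def by simp
  have T: "T = A * \<tau>" "T > 0" using T A \<tau>0 by (auto simp: A_def \<tau>_def)
  have uv: "u \<ge> 0" "v \<ge> 0" using \<tau>0 by (auto simp: u_def v_def)
  have mv: "1 / real m \<le> 2 * v" unfolding v_def using \<tau> n by (simp add: field_simps)
  have sT: "sqrt T / real m \<le> A * v"
  proof -
    have "sqrt T = sqrt A * sqrt \<tau>" unfolding T(1) by (rule real_sqrt_mult)
    also have "\<dots> \<le> A * sqrt \<tau>"
    proof (rule mult_right_mono)
      have "sqrt A \<le> sqrt (A\<^sup>2)" using A by (intro real_sqrt_le_mono) (simp add: power2_eq_square)
      then show "sqrt A \<le> A" using A by simp
    qed (use \<tau>0 in simp)
    finally have "sqrt T / real m \<le> A * sqrt \<tau> / real m" by (intro divide_right_mono) auto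
    then show ?thesis by (simp add: v_def)
  qed
  have \<delta>: "1 / (real n)\<^sup>2 \<le> 1" using n by simp
  have l0: "0 \<le> l2norm (xh - x)" by (simp add: l2norm_eq)
  have cl: "(\<Sum>j<n. (xh $ j - x $ j)\<^sup>2) = (l2norm (xh - x))\<^sup>2" by (rule l2norm_diff_sq[OF dim(1,2), symmetric])
  have close_j: "\<bar>x $ j - xh $ j\<bar> \<le> 1 / (real n)\<^sup>2" if "j < n" for j
  proof -
    have "(x $ j - xh $ j)\<^sup>2 \<le> (\<Sum>j<n. (xh $ j - x $ j)\<^sup>2)"
      using member_le_sum[of j "{..<n}" "\<lambda>j. (xh $ j - x $ j)\<^sup>2"] that by (simp add: power2_commute)
    also have "\<dots> \<le> (1 / (real n)\<^sup>2)\<^sup>2" unfolding cl using close l0 by (intro power_mono)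
    finally have "\<bar>x $ j - xh $ j\<bar> \<le> \<bar>1 / (real n)\<^sup>2\<bar>" unfolding abs_le_square_iff .
    then show ?thesis by simp
  qed
  have "S / real n \<le> 3 / (2 * lo\<^sup>2) * (65536 * (hi^6 / lo\<^sup>2) * (2 / c) * (real n / (real m)\<^sup>2 * (4 / c * T / real L) + e / real m)
      + (131074 * hi^8 + 2) * (sqrt T / real m))"
    unfolding S_def c_def e_def
    by (rule net_point_bound[OF mn L \<sigma> lo T(2) _ bx close_j opt])
       (use good F in \<open>auto simp: good_def\<close>)
  also have "\<dots> = 3 / (2 * lo\<^sup>2) * (Kc * (4 / c * A * u + e * (1 / real m)) + H * (sqrt T / real m))"
    unfolding Kc_def H_def u_def T(1) by (simp add: mult_ac)
  also have "\<dots> \<le> 3 / (2 * lo\<^sup>2) * (Kc * (4 / c * A * u + e * (2 * v)) + H * (A * v))"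
    using Kc H e mv sT by (intro mult_left_mono add_mono order_refl) auto
  finally have "S / real n \<le> 3 / (2 * lo\<^sup>2) * (Kc * (4 / c * A * u + e * (2 * v)) + H * (A * v))" .
  moreover have "2 * (3 / (2 * lo\<^sup>2) * W) = 3 / lo\<^sup>2 * W" for W by simp
  moreover have "e * (2 * v) = 2 * e * v" by simp
  ultimately have S: "2 * (S / real n) \<le> 3 / lo\<^sup>2 * (Kc * (4 / c * A * u + 2 * e * v) + H * (A * v))"
    by (metis mult_left_mono zero_le_numeral)
  have "(l2norm (xh - xo))\<^sup>2 = (\<Sum>j<n. ((xh $ j - x $ j) + (x $ j - xo $ j))\<^sup>2)"
    unfolding l2norm_diff_sq[OF dim(3,2)] by simp
  also have "\<dots> \<le> (\<Sum>j<n. 2 * (xh $ j - x $ j)\<^sup>2 + 2 * (x $ j - xo $ j)\<^sup>2)"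
  proof (rule sum_mono)
    have "(p + q)\<^sup>2 \<le> 2 * p\<^sup>2 + 2 * q\<^sup>2" for p q :: real
      using zero_le_power2[of "p - q"] unfolding power2_diff power2_sum by linarith
    then show "((xh $ j - x $ j) + (x $ j - xo $ j))\<^sup>2 \<le> 2 * (xh $ j - x $ j)\<^sup>2 + 2 * (x $ j - xo $ j)\<^sup>2" for j .
  qed
  also have "\<dots> = 2 * (l2norm (xh - x))\<^sup>2 + 2 * S"
    unfolding sum.distrib sum_distrib_left[symmetric] cl S_def ..
  also have "(l2norm (xh - x))\<^sup>2 \<le> 1\<^sup>2" using close \<delta> l0 by (intro power_mono) auto
  finally have "(l2norm (xh - xo))\<^sup>2 \<le> 2 + 2 * S" by simp
  then have "(1 / real n) * (l2norm (xh - xo))\<^sup>2 \<le> (1 / real n) * (2 + 2 * S)" by (intro mult_left_mono) auto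
  also have "\<dots> = 2 * (1 / real n) + 2 * (S / real n)" by (simp add: distrib_left)
  also have "\<dots> \<le> 4 * v + 3 / lo\<^sup>2 * (Kc * (4 / c * A * u + 2 * e * v) + H * (A * v))"
  proof (rule add_mono[OF _ S])
    have "1 / real n \<le> 1 / real m" using n by (intro divide_left_mono) auto
    then show "2 * (1 / real n) \<le> 4 * v" using mv by linarith
  qed
  also have "\<dots> \<le> (4 + 3 / lo\<^sup>2 * (Kc * (4 / c * A + 2 * e) + H * A) + 2 * hi\<^sup>2) * (u + v)"
    by (rule combine_bounds) (use uv A Kc H c e in auto)
  also have "\<dots> = mle_const lo hi * (u + v)"
    unfolding mle_const_def Let_def c_def[symmetric] A_def[symmetric] e_def[symmetric] Kc_def H_def ..
  finally show ?thesis unfolding u_def v_def \<tau>_def .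
qed

lemma mle_const_ge: "0 < lo \<Longrightarrow> lo \<le> hi \<Longrightarrow> 2 * hi\<^sup>2 \<le> mle_const lo hi" "0 < lo \<Longrightarrow> lo \<le> hi \<Longrightarrow> 0 < mle_const lo hi"
proof -
  have *: "4 + 2 * hi\<^sup>2 \<le> mle_const lo hi" if lo: "0 < lo" "lo \<le> hi"
    unfolding mle_const_def Let_def using kap_ge1[OF lo] lo
    by (auto intro!: add_nonneg_nonneg mult_nonneg_nonneg divide_nonneg_nonneg)
  show "0 < lo \<Longrightarrow> lo \<le> hi \<Longrightarrow> 2 * hi\<^sup>2 \<le> mle_const lo hi" using * by force
  show "0 < lo \<Longrightarrow> lo \<le> hi \<Longrightarrow> 0 < mle_const lo hi" using * by (smt (verit) zero_le_power2)
qed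

lemma diff_le_self_nonneg: "0 \<le> q \<Longrightarrow> 1 - 3 * q \<le> (1::real)"
  by simp

text \<open>The factor 3 comes from the three families of events indexed by the net, each
  contributing \<open>r3\<close>.\<close>

lemma tail_sum_le:
  fixes p1 p2 p3 p4 :: real
  assumes "1 - (r1 + 3 * r3 + r2) \<le> q" "r1 \<le> p1" "r2 \<le> p2" "r3 \<le> p3" "0 \<le> p1" "0 \<le> p2" "0 \<le> p4"
  shows "1 - 3 * (p1 + p2 + p3 + p4) \<le> q"
proof -
  have "r1 + r2 + 3 * r3 \<le> 3 * p1 + 3 * p2 + 3 * p3 + 3 * p4"
    using assms by (intro add_increasing2 add_mono) simp_all
  then show ?thesis using assms(1) by (simp add: algebra_simps)
qed

text \<open>The success set quantifies over all minimisers in a possibly uncountable set and is not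
  evidently measurable, so the probability is stated for a measurable event inside it. The constants
  are chosen before all dimensions, signals and generators.\<close>

theorem theorem1:
  fixes \<sigma>w xmin xmax :: real
  assumes "\<sigma>w > 0" and "0 < xmin" and "xmin \<le> xmax"
  shows "\<exists>C1 C2 C3 :: real. C1 > 0 \<and> C2 > 0 \<and> C3 > 0 \<and>
    (\<forall>(m::nat) (n::nat) (k::nat) (L::nat) (xo :: real Matrix.vec)
        (g :: real Matrix.vec \<Rightarrow> real Matrix.vec) (\<C> :: real Matrix.vec set).
      1 \<le> m \<longrightarrow> m < n \<longrightarrow> 1 \<le> k \<longrightarrow> 1 \<le> L \<longrightarrow>
      (\<forall>\<theta>. dim_vec \<theta> = k \<and> l2norm \<theta> \<le> xmax * sqrt (real n / real k) \<longrightarrow> dim_vec (g \<theta>) = n) \<longrightarrow>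
      (\<forall>\<theta> \<theta>'. dim_vec \<theta> = k \<and> l2norm \<theta> \<le> xmax * sqrt (real n / real k) \<longrightarrow>
               dim_vec \<theta>' = k \<and> l2norm \<theta>' \<le> xmax * sqrt (real n / real k) \<longrightarrow>
               l2norm (g \<theta> - g \<theta>') \<le> l2norm (\<theta> - \<theta>')) \<longrightarrow>
      \<C> \<subseteq> g ` {\<theta>. dim_vec \<theta> = k \<and> l2norm \<theta> \<le> xmax * sqrt (real n / real k)} \<longrightarrow>
      xo \<in> \<C> \<longrightarrow>
      (\<forall>x\<in>\<C>. dim_vec x = n \<and> (\<forall>i<n. xmin \<le> x $ i \<and> x $ i \<le> xmax)) \<longrightarrow>
      (\<exists>E\<in>sets (speckle_space m n L \<sigma>w).
         E \<subseteq> {(a, w). \<forall>xh\<in>\<C>.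
                 (\<forall>x\<in>\<C>. nll \<sigma>w (sensA m n a) L
                           (\<lambda>l. sensA m n a *\<^sub>v (diagm xo *\<^sub>v speckle n w l)) xh
                        \<le> nll \<sigma>w (sensA m n a) L
                           (\<lambda>l. sensA m n a *\<^sub>v (diagm xo *\<^sub>v speckle n w l)) x) \<longrightarrow>
                 (1 / real n) * (l2norm (xh - xo))^2
                   \<le> C1 * (real n / (real m)^2 * (real k * ln (real n) / real L)
                            + sqrt (real k * ln (real n)) / real m)} \<and>
         measure (speckle_space m n L \<sigma>w) E \<ge>
           1 - C2 * (exp (- real m / 2) + exp (- real L * real n / 8)
                     + exp (- C3 * real k * ln (real n))
                     + exp (real k * ln (real n) - real n / 2))))"
proof (rule exI[of _ "mle_const xmin xmax"], rule exI[of _ "3::real"], rule exI[of _ "1::real"], intro conjI allI impI)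
  show "0 < mle_const xmin xmax" by (rule mle_const_ge(2)[OF assms(2,3)])
  fix m n k L :: nat and xo :: "real Matrix.vec" and g :: "real Matrix.vec \<Rightarrow> real Matrix.vec" and \<C> :: "real Matrix.vec set"
  assume m: "1 \<le> m" and mn: "m < n" and k: "1 \<le> k" and L: "1 \<le> L"
    and lip: "\<forall>\<theta> \<theta>'. dim_vec \<theta> = k \<and> l2norm \<theta> \<le> xmax * sqrt (real n / real k) \<longrightarrow>
               dim_vec \<theta>' = k \<and> l2norm \<theta>' \<le> xmax * sqrt (real n / real k) \<longrightarrow>
               l2norm (g \<theta> - g \<theta>') \<le> l2norm (\<theta> - \<theta>')"
    and C: "\<C> \<subseteq> g ` {\<theta>. dim_vec \<theta> = k \<and> l2norm \<theta> \<le> xmax * sqrt (real n / real k)}"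
    and xo: "xo \<in> \<C>" and box: "\<forall>x\<in>\<C>. dim_vec x = n \<and> (\<forall>i<n. xmin \<le> x $ i \<and> x $ i \<le> xmax)"
  let ?M = "speckle_space m n L \<sigma>w"
  interpret M: prob_space ?M by (rule prob_space_speckle[OF assms(1)])
  have dim: "dim_vec x = n" if "x \<in> \<C>" for x using box that by auto
  have bx: "boxed n xmin xmax (\<lambda>j. x $ j)" if "x \<in> \<C>" for x using box that by (auto simp: boxed_def)
  define \<tau> where "\<tau> = real k * ln (real n)"
  define R where "R = mle_const xmin xmax * (real n / (real m)^2 * (real k * ln (real n) / real L) + sqrt (real k * ln (real n)) / real m)"
  define J where "J = (\<lambda>a w x. nll \<sigma>w (sensA m n a) L (\<lambda>l. sensA m n a *\<^sub>v (diagm xo *\<^sub>v speckle n w l)) x)"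
  have J: "J a w x = nll_fun m n L \<sigma>w (\<lambda>j. xo $ j) a w (\<lambda>j. x $ j)" if "x \<in> \<C>" for a w x
    unfolding J_def using assms(1) by (intro nll_eq dim that xo) auto
  have \<tau>: "1/2 \<le> sqrt \<tau>" unfolding \<tau>_def by (rule sqrt_k_ln_ge) (use m mn k in auto)
  have "\<exists>E\<in>sets ?M. E \<subseteq> {(a, w). \<forall>xh\<in>\<C>. (\<forall>x\<in>\<C>. J a w xh \<le> J a w x) \<longrightarrow> (1 / real n) * (l2norm (xh - xo))^2 \<le> R} \<and>
     measure ?M E \<ge> 1 - 3 * (exp (- real m / 2) + exp (- real L * real n / 8) + exp (- 1 * real k * ln (real n)) + exp (real k * ln (real n) - real n / 2))"
  \<comment> \<open>A single row cannot be split into two nonempty halves. For m = 1 the claim holds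
    surely: the error is at most xmax^2, the constant is at least 2 xmax^2, and sqrt (k log n) \<ge>
    1/2.\<close>
  proof (cases "m = 1")
    case True
    have "(1 / real n) * (l2norm (xh - xo))^2 \<le> R" if "xh \<in> \<C>" for xh
    proof -
      have "(1 / real n) * (l2norm (xh - xo))^2 \<le> (1 / real n) * (real n * xmax\<^sup>2)"
        using assms(2) by (intro mult_left_mono dist_boxed[where lo = xmin] dim bx that xo) auto
      also have "\<dots> = 2 * xmax\<^sup>2 * (1/2)" using mn by simp
      also have "\<dots> \<le> mle_const xmin xmax * sqrt \<tau>"
        using \<tau> mle_const_ge[OF assms(2,3)] by (intro mult_mono) auto
      also have "\<dots> \<le> R"
        unfolding R_def \<tau>_def[symmetric] True
        using mle_const_ge(2)[OF assms(2,3)] mn by (intro mult_left_mono) (auto simp: \<tau>_def)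
      finally show ?thesis .
    qed
    then have "space ?M \<subseteq> {(a, w). \<forall>xh\<in>\<C>. (\<forall>x\<in>\<C>. J a w xh \<le> J a w x) \<longrightarrow> (1 / real n) * (l2norm (xh - xo))^2 \<le> R}"
      by auto
    moreover have "measure ?M (space ?M) \<ge> 1 - 3 * (exp (- real m / 2) + exp (- real L * real n / 8) + exp (- 1 * real k * ln (real n)) + exp (real k * ln (real n) - real n / 2))"
    proof -
      have "0 \<le> exp (- real m / 2) + exp (- real L * real n / 8) + exp (- 1 * real k * ln (real n)) + exp (real k * ln (real n) - real n / 2)"
        by (intro add_nonneg_nonneg exp_ge_zero)
      then have "1 - 3 * (exp (- real m / 2) + exp (- real L * real n / 8) + exp (- 1 * real k * ln (real n)) + exp (real k * ln (real n) - real n / 2)) \<le> 1"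
        by (rule diff_le_self_nonneg)
      then show ?thesis unfolding M.prob_space .
    qed
    ultimately show ?thesis by blast
  next
    case False
    then have m2: "2 \<le> m" using m by simp
    \<comment> \<open>One more than the exponent in the net cardinality, so that card F * exp (-T)
      \<le> exp (-\<tau>); this yields C3 = 1.\<close>
    define A where "A = ln (2 * xmax + 3) / ln 2 + 4"
    define T where "T = A * \<tau>"
    have hi: "0 < xmax" using assms by simp
    have A: "A \<ge> 1" unfolding A_def using hi by (simp add: add_increasing)
    have \<tau>0: "\<tau> > 0" unfolding \<tau>_def using k mn m by simp
    have T: "T > 0" unfolding T_def using A \<tau>0 by simp
    obtain F where F: "finite F" "F \<subseteq> \<C>" "\<And>x. x \<in> \<C> \<Longrightarrow> \<exists>x'\<in>F. l2norm (x - x') \<le> 1 / (real n)\<^sup>2"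
      "real (card F) \<le> (2 * (xmax * sqrt (real n / real k) * sqrt (real k) / (1 / (real n)\<^sup>2)) + 3) ^ k"
    proof (rule lipschitz_net[OF k _ _ _ C])
      show "0 < 1 / (real n)\<^sup>2" using mn by simp
      show "0 \<le> xmax * sqrt (real n / real k)" using hi by simp
    qed (use lip in blast)+
    \<comment> \<open>The good event speaks about coordinate functions, so the net of vectors is
      translated; its cardinality cannot grow.\<close>
    define F' where "F' = (\<lambda>x j. x $ j) ` F"
    have cF: "real (card F') * exp (- T) \<le> exp (- \<tau>)"
    proof -
      have "real (card F') \<le> real (card F)" unfolding F'_def using card_image_le[OF F(1)] by simp
      also have "\<dots> \<le> exp ((A - 1) * \<tau>)"
      proof -
        have A1: "A - 1 = ln (2 * xmax + 3) / ln 2 + 3" by (simp add: A_def)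
        have "2 \<le> n" using m mn by simp
        then show ?thesis unfolding A1 \<tau>_def by (rule order_trans[OF F(4) net_cardinality[OF _ k hi]])
      qed
      finally have "real (card F') * exp (- T) \<le> exp ((A - 1) * \<tau>) * exp (- T)" by (intro mult_right_mono) auto
      then show ?thesis unfolding exp_add[symmetric] T_def by (simp add: algebra_simps)
    qed
    define E where "E = good m n L \<sigma>w xmin xmax T (\<lambda>j. xo $ j) F'"
    have gp: "E \<in> sets ?M" "1 - (exp (- real n) + 3 * (real (card F') * exp (- T)) + exp (- (real L * real n))) \<le> measure ?M E"
      unfolding E_def
      by (rule good_probability[OF m2 mn L assms T]; use F bx xo in \<open>auto simp: F'_def\<close>)+
    have "(1 / real n) * (l2norm (xh - xo))^2 \<le> R" if aw: "(a, w) \<in> E" and xh: "xh \<in> \<C>" and opt: "\<forall>x\<in>\<C>. J a w xh \<le> J a w x" for a w xh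
    proof -
      obtain x where x: "x \<in> F" "l2norm (xh - x) \<le> 1 / (real n)\<^sup>2" using F(3)[OF xh] by blast
      have xC: "x \<in> \<C>" using x F by auto
      have "J a w xh \<le> J a w xo" using opt xo by blast
      then have o: "nll_fun m n L \<sigma>w (\<lambda>j. xo $ j) a w (\<lambda>j. xh $ j) \<le> nll_fun m n L \<sigma>w (\<lambda>j. xo $ j) a w (\<lambda>j. xo $ j)"
        unfolding J[OF xh] J[OF xo] .
      show ?thesis unfolding R_def
        by (rule mle_error_bound[OF m2 mn k L assms dim[OF xC] dim[OF xh] dim[OF xo] bx[OF xC] bx[OF xh] bx[OF xo] x(2) o _ aw[unfolded E_def]])
           (use x in \<open>auto simp: T_def A_def \<tau>_def F'_def\<close>)
    qed
    then have "E \<subseteq> {(a, w). \<forall>xh\<in>\<C>. (\<forall>x\<in>\<C>. J a w xh \<le> J a w x) \<longrightarrow> (1 / real n) * (l2norm (xh - xo))^2 \<le> R}"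
      by auto
    moreover have "1 - 3 * (exp (- real m / 2) + exp (- real L * real n / 8) + exp (- 1 * real k * ln (real n)) + exp (real k * ln (real n) - real n / 2)) \<le> measure ?M E"
    proof (rule tail_sum_le[OF gp(2)])
      show "exp (- real n) \<le> exp (- real m / 2)" using mn by simp
      show "exp (- (real L * real n)) \<le> exp (- real L * real n / 8)" by simp
      show "real (card F') * exp (- T) \<le> exp (- 1 * real k * ln (real n))" using cF by (simp add: \<tau>_def)
    qed (rule exp_ge_zero)+
    ultimately show ?thesis using gp(1) by blast
  qed
  then show "\<exists>E\<in>sets ?M. E \<subseteq> {(a, w). \<forall>xh\<in>\<C>. (\<forall>x\<in>\<C>. nll \<sigma>w (sensA m n a) L (\<lambda>l. sensA m n a *\<^sub>v (diagm xo *\<^sub>v speckle n w l)) xh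
        \<le> nll \<sigma>w (sensA m n a) L (\<lambda>l. sensA m n a *\<^sub>v (diagm xo *\<^sub>v speckle n w l)) x) \<longrightarrow>
        (1 / real n) * (l2norm (xh - xo))^2 \<le> mle_const xmin xmax * (real n / (real m)^2 * (real k * ln (real n) / real L) + sqrt (real k * ln (real n)) / real m)} \<and>
     measure ?M E \<ge> 1 - 3 * (exp (- real m / 2) + exp (- real L * real n / 8) + exp (- 1 * real k * ln (real n)) + exp (real k * ln (real n) - real n / 2))"
    unfolding J_def R_def .
qed simp_all

end
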